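(* Let $p\in\mathbb{Z}$ be a prime. For any $r\ge2$, $d\ge3$ and $1<n<d$, the graphs $$\mathbb{P}_{1,n}^{d-1}\bigl(\mathbb{Z}/(p^r)\bigr)\quad\text{and}\quad \mathbb{P}_{1,n}^{d-1}\bigl(\mathbb{F}_p[t]/(t^r)\bigr)$$ are isospectral and non-isomorphic.
   Context: For a finite local ring $R$ (here $R=\mathbb{Z}/(p^r)$ or $R=\mathbb{F}_p[t]/(t^r)$), $\mathbb{P}_{1,n}^{d-1}(R)$ denotes the bipartite graph whose vertices are the free $R$-submodules of $R^d$ of rank $1$ and of rank $n$, with a rank-$1$ submodule $L$ adjacent to a rank-$n$ submodule $V$ iff $L\le V$. Two graphs are isospectral if their adjacency matrices have the same spectrum, counted with multiplicities. *)

theory Defs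
  imports
    "HOL-Algebra.Algebra"
    "HOL-Number_Theory.Residues"
    "Jordan_Normal_Form.Char_Poly"
    "Graph_Theory.Pair_Digraph"
    "Graph_Theory.Digraph_Isomorphism"
begin

text \<open>
  The module \<open>R\<^sup>d\<close>. Its elements are the functions on \<open>{..<d}\<close> that are \<^const>\<open>undefined\<close> elsewhere,
  so that equality of functions is equality of coordinates. The fields \<open>mult\<close> and \<open>one\<close> are there
  only because the record of modules extends that of rings.
\<close>

definition coord_module :: "('a, 'b) ring_scheme \<Rightarrow> nat \<Rightarrow> ('a, nat \<Rightarrow> 'a) module" where
  "coord_module R d =
    \<lparr>carrier = {..<d} \<rightarrow>\<^sub>E carrier R,
     monoid.mult = (\<lambda>v w. \<lambda>i\<in>{..<d}. v i \<otimes>\<^bsub>R\<^esub> w i),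
     one = (\<lambda>i\<in>{..<d}. \<one>\<^bsub>R\<^esub>),
     ring.zero = (\<lambda>i\<in>{..<d}. \<zero>\<^bsub>R\<^esub>),
     add = (\<lambda>v w. \<lambda>i\<in>{..<d}. v i \<oplus>\<^bsub>R\<^esub> w i),
     module.smult = (\<lambda>c v. \<lambda>i\<in>{..<d}. c \<otimes>\<^bsub>R\<^esub> v i)\<rparr>"

lemma module_coord_module:
  assumes "cring R"
  shows "module R (coord_module R d)"
proof -
  interpret R: cring R by fact
  show ?thesis
  proof (rule moduleI)
    show "abelian_group (coord_module R d)"
    proof (rule abelian_groupI)
      fix v assume v: "v \<in> carrier (coord_module R d)"
      show "\<exists>w\<in>carrier (coord_module R d).
          w \<oplus>\<^bsub>coord_module R d\<^esub> v = \<zero>\<^bsub>coord_module R d\<^esub>"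
        using v
        by (intro bexI[of _ "\<lambda>i\<in>{..<d}. \<ominus>\<^bsub>R\<^esub> v i"])
           (auto simp: coord_module_def PiE_iff R.l_neg intro!: ext)
    qed (auto simp: coord_module_def PiE_iff extensional_def R.a_ac intro!: ext)
  qed (use assms in \<open>auto simp: coord_module_def PiE_iff extensional_def R.l_distr R.r_distr
         R.m_assoc intro!: ext\<close>)
qed

definition module_basis ::
  "('a, 'b) ring_scheme \<Rightarrow> ('a, 'm, 'c) module_scheme \<Rightarrow> 'm set \<Rightarrow> nat \<Rightarrow> (nat \<Rightarrow> 'm) \<Rightarrow> bool" where
  "module_basis R M V k b \<longleftrightarrow>
    b \<in> {..<k} \<rightarrow> V \<and>
    (\<forall>v\<in>V. \<exists>!a. a \<in> {..<k} \<rightarrow>\<^sub>E carrier R \<and> v = (\<Oplus>\<^bsub>M\<^esub>i\<in>{..<k}. a i \<odot>\<^bsub>M\<^esub> b i))"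

definition free_submodules ::
  "('a, 'b) ring_scheme \<Rightarrow> ('a, 'm, 'c) module_scheme \<Rightarrow> nat \<Rightarrow> 'm set set" where
  "free_submodules R M k = {V. submodule V R M \<and> (\<exists>b. module_basis R M V k b)}"

text \<open>
  The graph \<open>P\<^sub>1\<^sub>,\<^sub>n\<^sup>d\<^sup>-\<^sup>1(R)\<close>. An undirected edge is represented by its two orientations. For \<open>n \<noteq> 1\<close>
  and \<open>R\<close> a nontrivial commutative ring, no submodule is free of both ranks, so that the union of
  the two classes of vertices is disjoint.
\<close>

definition incidence_graph ::
  "('a, 'b) ring_scheme \<Rightarrow> nat \<Rightarrow> nat \<Rightarrow> (nat \<Rightarrow> 'a) set pair_pre_digraph" where
  "incidence_graph R d n =
    (let P = free_submodules R (coord_module R d) 1;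
         Q = free_submodules R (coord_module R d) n
     in \<lparr>pverts = P \<union> Q,
         parcs = {(L, V). L \<in> P \<and> V \<in> Q \<and> L \<subseteq> V} \<union> {(V, L). L \<in> P \<and> V \<in> Q \<and> L \<subseteq> V}\<rparr>)"

lemma pair_sym_digraph_incidence_graph: "pair_sym_digraph (incidence_graph R d n)"
  by unfold_locales
     (auto simp: incidence_graph_def Let_def arcs_ends_conv symmetric_def intro!: symI)

text \<open>
  \<^const>\<open>digraph_iso\<close> is stated for graphs with named arcs and asks its first argument to be well
  formed. On graphs whose arcs are pairs of vertices it is the usual isomorphism of graphs.
\<close>

lemma digraph_iso_with_proj_iff:
  assumes "pair_wf_digraph G" "pair_wf_digraph H"
  shows "digraph_iso (with_proj G) (with_proj H) \<longleftrightarrow>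
    (\<exists>f. bij_betw f (pverts G) (pverts H) \<and>
      (\<forall>u\<in>pverts G. \<forall>v\<in>pverts G. (u, v) \<in> parcs G \<longleftrightarrow> (f u, f v) \<in> parcs H))"
proof
  interpret G: pair_wf_digraph G by fact
  assume "digraph_iso (with_proj G) (with_proj H)"
  then obtain h where h: "pre_digraph.digraph_isomorphism (with_proj G) h"
      "with_proj H = app_iso h (with_proj G)"
    by (auto simp: digraph_iso_def)
  have "iso_tail h = fst" "iso_head h = snd"
      and V: "pverts H = iso_verts h ` pverts G" and A: "parcs H = iso_arcs h ` parcs G"
    using h(2) by (auto simp: with_proj_def app_iso_def)
  then have arc: "iso_arcs h (u, v) = (iso_verts h u, iso_verts h v)" if "(u, v) \<in> parcs G" for u v
    using h(1) that by (auto simp: pre_digraph.digraph_isomorphism_def prod_eq_iff)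
  have inj: "inj_on (iso_verts h) (pverts G)"
    using h(1) by (auto simp: pre_digraph.digraph_isomorphism_def)
  have "(u, v) \<in> parcs G \<longleftrightarrow> (iso_verts h u, iso_verts h v) \<in> parcs H"
    if "u \<in> pverts G" "v \<in> pverts G" for u v
  proof
    assume "(u, v) \<in> parcs G"
    then show "(iso_verts h u, iso_verts h v) \<in> parcs H"
      unfolding A by (metis arc imageI)
  next
    assume "(iso_verts h u, iso_verts h v) \<in> parcs H"
    then obtain u' v' where a: "(u', v') \<in> parcs G"
        "(iso_verts h u, iso_verts h v) = (iso_verts h u', iso_verts h v')"
      unfolding A using arc by force
    then have "u = u'" "v = v'"
      using inj that G.in_arcsD1[OF a(1)] G.in_arcsD2[OF a(1)] by (auto dest: inj_onD)
    then show "(u, v) \<in> parcs G"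
      using a(1) by simp
  qed
  then show "\<exists>f. bij_betw f (pverts G) (pverts H) \<and>
      (\<forall>u\<in>pverts G. \<forall>v\<in>pverts G. (u, v) \<in> parcs G \<longleftrightarrow> (f u, f v) \<in> parcs H)"
    using inj V by (intro exI[of _ "iso_verts h"]) (auto simp: bij_betw_def)
next
  interpret G: pair_wf_digraph G by fact
  interpret H: pair_wf_digraph H by fact
  assume "\<exists>f. bij_betw f (pverts G) (pverts H) \<and>
      (\<forall>u\<in>pverts G. \<forall>v\<in>pverts G. (u, v) \<in> parcs G \<longleftrightarrow> (f u, f v) \<in> parcs H)"
  then obtain f where f: "inj_on f (pverts G)" "f ` pverts G = pverts H"
      and e: "\<And>u v. u \<in> pverts G \<Longrightarrow> v \<in> pverts G \<Longrightarrow> (u, v) \<in> parcs G \<longleftrightarrow> (f u, f v) \<in> parcs H"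
    unfolding bij_betw_def by blast
  define h where "h = \<lparr>iso_verts = f, iso_arcs = map_prod f f, iso_head = snd, iso_tail = fst\<rparr>"
  have A: "map_prod f f ` parcs G = parcs H"
  proof
    show "map_prod f f ` parcs G \<subseteq> parcs H"
    proof
      fix a assume "a \<in> map_prod f f ` parcs G"
      then obtain u v where a: "(u, v) \<in> parcs G" "a = (f u, f v)" by auto
      then show "a \<in> parcs H"
        using e[OF G.in_arcsD1 G.in_arcsD2] by blast
    qed
    show "parcs H \<subseteq> map_prod f f ` parcs G"
    proof
      fix a assume "a \<in> parcs H"
      then obtain x y where a: "a = (x, y)" "(x, y) \<in> parcs H" by (cases a) auto
      then have "x \<in> f ` pverts G" "y \<in> f ` pverts G"
        unfolding f(2) by (blast dest: H.in_arcsD1 H.in_arcsD2)+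
      then obtain u v where uv: "x = f u" "y = f v" "u \<in> pverts G" "v \<in> pverts G"
        by blast
      then have "(u, v) \<in> parcs G"
        using e a(2) by blast
      then show "a \<in> map_prod f f ` parcs G"
        unfolding a(1) uv(1,2) by (metis map_prod_simp imageI)
    qed
  qed
  have "inj_on (map_prod f f) (parcs G)"
    by (rule inj_on_subset[OF map_prod_inj_on[OF f(1) f(1)]])
       (auto dest: G.in_arcsD1 G.in_arcsD2)
  then have "pre_digraph.digraph_isomorphism (with_proj G) h"
    using f(1) G.wf_digraph_axioms
    by (auto simp: pre_digraph.digraph_isomorphism_def h_def)
  moreover have "with_proj H = app_iso h (with_proj G)"
    using f(2) A by (simp add: with_proj_def app_iso_def h_def)
  ultimately show "digraph_iso (with_proj G) (with_proj H)"
    unfolding digraph_iso_def by blast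
qed

definition adjacency_matrix :: "'v pair_pre_digraph \<Rightarrow> 'v list \<Rightarrow> complex mat" where
  "adjacency_matrix G vs =
    mat (length vs) (length vs) (\<lambda>(i, j). if (vs ! i, vs ! j) \<in> parcs G then 1 else 0)"

definition eigenvalue_mset :: "complex mat \<Rightarrow> complex multiset" where
  "eigenvalue_mset A = proots (char_poly A)"

text \<open>
  Reordering the vertices conjugates the adjacency matrix by a permutation matrix, so the spectrum
  does not depend on the enumerations \<open>vs\<close> and \<open>ws\<close> of the vertices. Their existence makes both
  graphs finite.
\<close>

definition isospectral :: "'v pair_pre_digraph \<Rightarrow> 'w pair_pre_digraph \<Rightarrow> bool" where
  "isospectral G H \<longleftrightarrow>
    (\<exists>vs ws. distinct vs \<and> set vs = pverts G \<and> distinct ws \<and> set ws = pverts H \<and>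
      eigenvalue_mset (adjacency_matrix G vs) = eigenvalue_mset (adjacency_matrix H ws))"

text \<open>The ring \<open>\<int>/(m)\<close> is \<^const>\<open>residue_ring\<close>, and the field with \<open>p\<close> elements is \<open>\<int>/(p)\<close>.\<close>

definition truncated_poly_ring :: "int \<Rightarrow> nat \<Rightarrow> int list set ring" where
  "truncated_poly_ring p r =
    (let F = residue_ring p; A = poly_ring F
     in A Quot (PIdl\<^bsub>A\<^esub> (X\<^bsub>F\<^esub> [^]\<^bsub>A\<^esub> r)))"

end

theory Submission
  imports Defs
begin

text \<open>
  Both rings are finite chain rings: local with maximal ideal \<open>(\<pi>)\<close>, residue field of size \<open>q = p\<close> and
  \<open>\<pi>\<^sup>r = 0 \<noteq> \<pi>\<^sup>r\<^sup>-\<^sup>1\<close>. The number of free submodules of rank \<open>n\<close> containing two given points \<open>L\<close> and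
  \<open>L'\<close> depends only on \<open>q, r, d, n\<close> and on the largest \<open>k\<close> with \<open>L = L'\<close> modulo \<open>\<pi>\<^sup>k\<close>. Expansion in
  \<open>\<pi>\<close>-adic digits is a bijection between the rings which preserves congruence modulo \<open>\<pi>\<^sup>k\<close>; applied to
  the coordinates of normalised generators it carries \<open>B B\<^sup>T\<close> for the incidence matrix \<open>B\<close> of one graph
  to that of the other. As \<open>B B\<^sup>T\<close> and the numbers of vertices determine the characteristic polynomial of
  the bipartite graph, the graphs are isospectral.

  Conversely the graph determines the relation \<open>L'' \<le> L + L'\<close> between points, hence also which pairs of
  points have independent generators. With these relations one can carry out von Staudt's construction
  of the translation by one, which has order \<open>p\<close> over \<open>F\<^sub>p[t]/(t\<^sup>r)\<close> but not over \<open>\<int>/(p\<^sup>r)\<close>. An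
  isomorphism exchanging the two classes of vertices exists at most for \<open>n = d - 1\<close>, by counting, and is
  then composed with the duality between points and hyperplanes.
\<close>

section \<open>Finite chain rings\<close>

text \<open>Both rings are treated at once through the axioms below; the only difference used is the
  additive order of 1. The digit bijection is not additive, so it induces no map on submodules of
  rank n. None is required: B B^T records only how many of them pass through two points. That this
  number depends on the level alone is a matter of symmetry: two points at level k have generators x
  and \<alpha> x + \<pi>^k y with x, y part of a basis, and linear automorphisms act transitively on
  bases. For the second half the obstacle is that free submodules of rank 2 are not vertices unless
  n = 2. The span of two points is recovered as the intersection of all rank-n submodules through
  them, which is where n < d enters, and independence of the generators as maximality of that span.
  Two points that agree modulo \<pi> do not span a free module of rank 2, so the configuration
  demands independence wherever a coordinate has to be a unit.\<close>

text \<open>\<open>T\<close> is a set of representatives of the residue field.\<close>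

locale chain_ring = cring R for R (structure) +
  fixes T :: "'a set" and \<pi> :: 'a and r :: nat
  assumes finite_T: "finite T" and T_subset: "T \<subseteq> carrier R"
    and zero_in_T: "\<zero> \<in> T" and one_in_T: "\<one> \<in> T"
    and T_diff_unit: "\<lbrakk>s \<in> T; t \<in> T; s \<noteq> t\<rbrakk> \<Longrightarrow> s \<ominus> t \<in> Units R"
    and pi_closed [simp, intro]: "\<pi> \<in> carrier R"
    and pi_pow_r: "\<pi> [^] r = \<zero>" and pi_pow_pred: "\<pi> [^] (r - 1) \<noteq> \<zero>"
    and T_decomp: "x \<in> carrier R \<Longrightarrow> \<exists>t\<in>T. \<exists>y\<in>carrier R. x = t \<oplus> \<pi> \<otimes> y"
begin

section \<open>Powers of the uniformiser, units and valuations\<close>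

definition pideal :: "nat \<Rightarrow> 'a set" where
  "pideal k = (\<lambda>y. \<pi> [^] k \<otimes> y) ` carrier R"

lemma pi_pow_closed [simp, intro]: "\<pi> [^] (k::nat) \<in> carrier R"
  by simp

lemma r_pos: "0 < r"
  using pi_pow_r pi_pow_pred by (cases r) auto

lemma one_not_zero: "\<one> \<noteq> \<zero>"
proof
  assume "\<one> = \<zero>"
  then have "carrier R = {\<zero>}" using one_zeroD by simp
  then show False using pi_pow_pred pi_pow_closed by blast
qed

lemma pi_pow_eq_zero_iff: "\<pi> [^] k = \<zero> \<longleftrightarrow> r \<le> k" for k :: nat
proof
  assume k: "\<pi> [^] k = \<zero>"
  show "r \<le> k"
  proof (rule ccontr)
    assume "\<not> r \<le> k"
    then have "r - 1 = k + (r - 1 - k)" by simp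
    then have "\<pi> [^] (r - 1) = \<pi> [^] k \<otimes> \<pi> [^] (r - 1 - k)"
      by (metis nat_pow_mult pi_closed)
    with k pi_pow_pred show False by simp
  qed
next
  assume "r \<le> k"
  then have "\<pi> [^] k = \<pi> [^] r \<otimes> \<pi> [^] (k - r)"
    by (metis nat_pow_mult pi_closed le_add_diff_inverse)
  then show "\<pi> [^] k = \<zero>" using pi_pow_r by simp
qed

lemma pidealI: "y \<in> carrier R \<Longrightarrow> \<pi> [^] k \<otimes> y \<in> pideal k"
  by (simp add: pideal_def)

lemma pidealE:
  assumes "x \<in> pideal k" obtains y where "y \<in> carrier R" "x = \<pi> [^] k \<otimes> y"
  using assms by (auto simp: pideal_def)

lemma pideal_closed: "x \<in> pideal k \<Longrightarrow> x \<in> carrier R"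
  by (auto elim: pidealE)

lemma pideal_0: "pideal 0 = carrier R"
  by (force simp: pideal_def)

lemma pideal_r: "r \<le> k \<Longrightarrow> pideal k = {\<zero>}"
  using pi_pow_eq_zero_iff[of k] by (auto simp: pideal_def intro!: image_eqI[of _ _ \<zero>])

lemma zero_pideal [simp]: "\<zero> \<in> pideal k"
  using pidealI[of \<zero> k] by simp

lemma pideal_add:
  assumes "x \<in> pideal k" "y \<in> pideal k" shows "x \<oplus> y \<in> pideal k"
proof -
  obtain v w where "v \<in> carrier R" "x = \<pi> [^] k \<otimes> v" "w \<in> carrier R" "y = \<pi> [^] k \<otimes> w"
    using assms by (elim pidealE)
  then show ?thesis using pidealI[of "v \<oplus> w" k] by (simp add: r_distr)
qed

lemma pideal_mult:
  assumes "a \<in> carrier R" "x \<in> pideal k" shows "a \<otimes> x \<in> pideal k"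
proof -
  obtain v where "v \<in> carrier R" "x = \<pi> [^] k \<otimes> v" using assms(2) by (elim pidealE)
  then show ?thesis using pidealI[of "a \<otimes> v" k] assms(1) by (simp add: m_lcomm)
qed

lemma pideal_mult2: "\<lbrakk>a \<in> carrier R; x \<in> pideal k\<rbrakk> \<Longrightarrow> x \<otimes> a \<in> pideal k"
  using pideal_mult[of a x k] pideal_closed m_comm by simp

lemma pideal_minus: "x \<in> pideal k \<Longrightarrow> \<ominus> x \<in> pideal k"
  using pideal_mult[of "\<ominus> \<one>" x k] pideal_closed by (simp add: l_minus)

lemma pideal_diff: "\<lbrakk>x \<in> pideal k; y \<in> pideal k\<rbrakk> \<Longrightarrow> x \<ominus> y \<in> pideal k"
  by (simp add: minus_eq pideal_add pideal_minus)

lemma pideal_antimono: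
  assumes "j \<le> k" shows "pideal k \<subseteq> pideal j"
proof
  fix x assume "x \<in> pideal k"
  then obtain y where y: "y \<in> carrier R" "x = \<pi> [^] k \<otimes> y" by (elim pidealE)
  have "\<pi> [^] k = \<pi> [^] j \<otimes> \<pi> [^] (k - j)"
    using assms by (simp add: nat_pow_mult)
  then have "x = \<pi> [^] j \<otimes> (\<pi> [^] (k - j) \<otimes> y)" using y by (simp add: m_assoc)
  then show "x \<in> pideal j" using y by (simp add: pidealI)
qed

lemma pow_pideal: "x \<in> pideal k \<Longrightarrow> \<pi> [^] j \<otimes> x \<in> pideal (j + k)"
  by (auto elim!: pidealE simp: m_assoc[symmetric] nat_pow_mult intro: pidealI)

text \<open>Geometric series: the partial sums w = 1 + n + ... + n^(k-1) satisfy (1 - n) w = 1 -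
  n^k, and the right-hand side is 1 for k = m.\<close>

lemma one_minus_nilpotent_unit:
  assumes n: "n \<in> carrier R" and nil: "n [^] (m::nat) = \<zero>"
  shows "\<one> \<ominus> n \<in> Units R"
proof -
  have "\<exists>w\<in>carrier R. (\<one> \<ominus> n) \<otimes> w = \<one> \<ominus> n [^] k" for k :: nat
  proof (induction k)
    case 0
    show ?case by (rule bexI[of _ \<zero>]) (use n in \<open>simp_all add: minus_eq r_neg\<close>)
  next
    case (Suc k)
    then obtain w where w: "w \<in> carrier R" "(\<one> \<ominus> n) \<otimes> w = \<one> \<ominus> n [^] k" by blast
    have pk: "n [^] k \<in> carrier R" using n by simp
    have "(\<one> \<ominus> n) \<otimes> (w \<oplus> n [^] k) = (\<one> \<ominus> n) \<otimes> w \<oplus> (n [^] k \<ominus> n [^] k \<otimes> n)"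
      using n w(1) pk by algebra
    also have "\<dots> = \<one> \<ominus> n [^] k \<otimes> n"
      unfolding w(2) using n pk by algebra
    finally show ?case using w(1) n by (intro bexI[of _ "w \<oplus> n [^] k"]) auto
  qed
  from this[of m] obtain w where "w \<in> carrier R" "(\<one> \<ominus> n) \<otimes> w = \<one> \<ominus> \<zero>"
    unfolding nil by blast
  then show ?thesis using n by (auto simp: Units_def minus_eq m_comm)
qed

lemma pi_mult_nilpotent:
  assumes "y \<in> carrier R" shows "(\<pi> \<otimes> y) [^] r = \<zero>"
  using assms by (simp add: nat_pow_distrib pi_pow_r)

text \<open>Locality. In x = t + \<pi> y a nonzero digit t is a unit, being the difference of two
  distinct elements of T, and x is t times 1 plus a nilpotent element.\<close>

lemma unit_or_pideal:
  assumes x: "x \<in> carrier R" shows "x \<in> Units R \<or> x \<in> pideal 1"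
proof -
  obtain t y where ty: "t \<in> T" "y \<in> carrier R" "x = t \<oplus> \<pi> \<otimes> y"
    using T_decomp[OF x] by blast
  have tc: "t \<in> carrier R" using ty T_subset by blast
  show ?thesis
  proof (cases "t = \<zero>")
    case True
    then show ?thesis using ty pidealI[of y 1] by simp
  next
    case False
    then have tu: "t \<in> Units R"
      using T_diff_unit[OF ty(1) zero_in_T] tc by (simp add: minus_eq)
    \<comment> \<open>The sign brings the cofactor into the form \<open>\<one> \<ominus> n\<close>
      with n nilpotent.\<close>
    define z where "z = \<ominus> (inv t \<otimes> y)"
    have z: "z \<in> carrier R" using ty tu by (simp add: z_def)
    have "t \<otimes> (\<one> \<ominus> \<pi> \<otimes> z) = t \<oplus> (t \<otimes> inv t) \<otimes> (\<pi> \<otimes> y)"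
      unfolding z_def using ty tc tu Units_inv_closed[OF tu] pi_closed by algebra
    then have "x = t \<otimes> (\<one> \<ominus> \<pi> \<otimes> z)" using ty tu by simp
    moreover have "\<one> \<ominus> \<pi> \<otimes> z \<in> Units R"
      using one_minus_nilpotent_unit[OF _ pi_mult_nilpotent[OF z]] z by simp
    ultimately show ?thesis using tu by (simp add: Units_m_closed)
  qed
qed

text \<open>A unit x = \<pi> y would give 1 = \<pi> (y inv x), and the r-th power of the right-hand
  side is 0.\<close>

lemma unit_not_pideal: "x \<in> Units R \<Longrightarrow> x \<notin> pideal 1"
proof
  assume u: "x \<in> Units R" and "x \<in> pideal 1"
  then obtain y where y: "y \<in> carrier R" "x = \<pi> \<otimes> y" by (auto elim!: pidealE)
  then have "\<one> = \<pi> \<otimes> (y \<otimes> inv x)" using u by (metis Units_inv_closed Units_r_inv m_assoc pi_closed)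
  then have "\<one> [^] r = \<pi> [^] r \<otimes> (y \<otimes> inv x) [^] r"
    using y u by (metis Units_inv_closed nat_pow_distrib m_closed pi_closed)
  then show False using one_not_zero pi_pow_r y u by simp
qed

lemma unit_mult_eq_zero_iff:
  "\<lbrakk>u \<in> Units R; x \<in> carrier R\<rbrakk> \<Longrightarrow> x \<otimes> u = \<zero> \<longleftrightarrow> x = \<zero>"
  by (metis Units_closed Units_inv_closed Units_r_inv l_null m_assoc r_one)

text \<open>Take k maximal with every \<zeta> i in \<open>pideal k\<close>; if all quotients were
  nonunits, locality would allow one more factor \<pi>. This substitute for a greatest common
  divisor produces unimodular vectors out of arbitrary ones.\<close>

lemma common_valuation:
  assumes J: "J \<noteq> {}" and c: "\<zeta> \<in> J \<rightarrow> carrier R"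
  obtains k \<xi> where "k \<le> r" "\<xi> \<in> J \<rightarrow> carrier R" "\<And>i. i \<in> J \<Longrightarrow> \<zeta> i = \<pi> [^] k \<otimes> \<xi> i"
    "\<exists>i\<in>J. \<xi> i \<in> Units R"
proof -
  define P where "P k \<longleftrightarrow> (\<forall>i\<in>J. \<zeta> i \<in> pideal k) \<and> k \<le> r" for k
  define k where "k = (GREATEST k. P k)"
  have P0: "P 0" using c by (auto simp: P_def pideal_0)
  have Pk: "P k" unfolding k_def by (rule GreatestI_nat[of P 0 r]) (auto simp: P0, simp add: P_def)
  have max: "j \<le> k" if "P j" for j
    unfolding k_def by (rule Greatest_le_nat[of P _ r]) (use that in \<open>auto simp: P_def\<close>)
  show thesis
  proof (cases "k = r")
    case True
    have "\<zeta> i = \<pi> [^] r \<otimes> \<one>" if "i \<in> J" for i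
      using Pk that pideal_r[of r] unfolding P_def True by (auto simp: pi_pow_r)
    \<comment> \<open>All \<zeta> i vanish here. As \<pi>^r = 0, every quotient fits, and 1 supplies
      the unit.\<close>
    then show thesis using J by (intro that[of r "\<lambda>_. \<one>"]) auto
  next
    case False
    then have kr: "k < r" using Pk by (simp add: P_def)
    have "\<forall>i\<in>J. \<exists>y. y \<in> carrier R \<and> \<zeta> i = \<pi> [^] k \<otimes> y"
      using Pk by (auto simp: P_def elim: pidealE)
    then obtain \<xi> where \<xi>: "\<And>i. i \<in> J \<Longrightarrow> \<xi> i \<in> carrier R \<and> \<zeta> i = \<pi> [^] k \<otimes> \<xi> i"
      using bchoice[of J "\<lambda>i y. y \<in> carrier R \<and> \<zeta> i = \<pi> [^] k \<otimes> y"] by blast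
    have "\<exists>i\<in>J. \<xi> i \<in> Units R"
    proof (rule ccontr)
      assume "\<not> ?thesis"
      then have "\<xi> i \<in> pideal 1" if "i \<in> J" for i using \<xi>[OF that] that unit_or_pideal by blast
      then have "P (k + 1)"
        unfolding P_def using \<xi> kr pow_pideal[of _ 1 k] by auto
      then show False using max by fastforce
    qed
    then show thesis using \<xi> kr by (intro that[of k \<xi>]) auto
  qed
qed

lemma valuation:
  assumes x: "x \<in> carrier R"
  obtains k u where "k \<le> r" "u \<in> Units R" "x = \<pi> [^] k \<otimes> u"
  by (rule common_valuation[of "{()}" "\<lambda>_. x"]) (use x in auto)

text \<open>Multiplication by \<pi>^(r-j) kills \<open>pideal j\<close> and turns \<pi>^k u into
  \<pi>^(r-j+k) u, which vanishes only for j <= k. The bound k < r excludes the element 0, which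
  lies in every \<open>pideal j\<close>.\<close>

lemma pow_unit_pideal_iff:
  assumes u: "u \<in> Units R" and k: "k < r"
  shows "\<pi> [^] k \<otimes> u \<in> pideal j \<longleftrightarrow> j \<le> k"
proof
  assume "\<pi> [^] k \<otimes> u \<in> pideal j"
  then have "\<pi> [^] (r - j) \<otimes> (\<pi> [^] k \<otimes> u) \<in> pideal (r - j + j)"
    by (rule pow_pideal)
  then have "\<pi> [^] (r - j) \<otimes> (\<pi> [^] k \<otimes> u) = \<zero>" using pideal_r[of "r - j + j"] by auto
  then have "\<pi> [^] (r - j + k) \<otimes> u = \<zero>"
    using Units_closed[OF u] by (simp add: m_assoc[symmetric] nat_pow_mult)
  then have "r \<le> r - j + k"
    using pi_pow_eq_zero_iff unit_mult_eq_zero_iff[OF u] by simp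
  then show "j \<le> k" using k by simp
next
  assume "j \<le> k"
  then show "\<pi> [^] k \<otimes> u \<in> pideal j" using pideal_antimono[of j k] pidealI[of u k] u by auto
qed

text \<open>The sum is \<pi>^j (u + \<pi> w), and u + \<pi> w is again a unit since the nonunits
  form the ideal generated by \<pi>. So the first nonzero digit alone decides membership.\<close>

lemma leading_digit_pideal_iff:
  assumes u: "u \<in> Units R" and z: "z \<in> pideal (Suc j)" and j: "j < r"
  shows "\<pi> [^] j \<otimes> u \<oplus> z \<in> pideal k \<longleftrightarrow> k \<le> j"
proof -
  obtain w where w: "w \<in> carrier R" "z = \<pi> [^] Suc j \<otimes> w" using z by (elim pidealE)
  have "u \<oplus> \<pi> \<otimes> w \<in> Units R"
  proof (rule ccontr)
    assume "u \<oplus> \<pi> \<otimes> w \<notin> Units R"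
    then have "u \<oplus> \<pi> \<otimes> w \<in> pideal 1"
      using unit_or_pideal[of "u \<oplus> \<pi> \<otimes> w"] Units_closed[OF u] w by blast
    moreover have "\<pi> \<otimes> w \<in> pideal 1" using pidealI[OF w(1), of 1] by simp
    ultimately have "(u \<oplus> \<pi> \<otimes> w) \<ominus> \<pi> \<otimes> w \<in> pideal 1" by (rule pideal_diff)
    moreover have "(u \<oplus> \<pi> \<otimes> w) \<ominus> \<pi> \<otimes> w = u"
      using u w Units_closed[OF u] pi_closed by algebra
    ultimately show False using unit_not_pideal[OF u] by simp
  qed
  moreover have "\<pi> [^] j \<otimes> u \<oplus> z = \<pi> [^] j \<otimes> (u \<oplus> \<pi> \<otimes> w)"
    using Units_closed[OF u] w by (simp add: r_distr m_assoc)
  ultimately show ?thesis using pow_unit_pideal_iff j by simp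
qed

text \<open>For x = \<pi>^k u the product vanishes only if j + k >= r. This is what permits dividing
  relations by powers of \<pi>.\<close>

lemma pow_annihilator:
  assumes x: "x \<in> carrier R" and j: "j \<le> r" and z: "\<pi> [^] j \<otimes> x = \<zero>"
  shows "x \<in> pideal (r - j)"
proof -
  obtain k u where k: "k \<le> r" "u \<in> Units R" "x = \<pi> [^] k \<otimes> u" using valuation[OF x] .
  then have "\<pi> [^] (j + k) \<otimes> u = \<zero>"
    using z Units_closed[OF k(2)] by (simp add: m_assoc[symmetric] nat_pow_mult)
  then have "r - j \<le> k" using pi_pow_eq_zero_iff unit_mult_eq_zero_iff[OF k(2)] by force
  then show ?thesis using pideal_antimono pidealI[of u k] k by auto
qed

text \<open>Splitting off the leading digit. Iterated, it is the \<pi>-adic expansion; a single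
  application is the inductive step both for the size of the ring and for the bijection between two
  rings.\<close>

lemma digit_bij:
  assumes j: "j < r"
  shows "bij_betw (\<lambda>(t, z). \<pi> [^] j \<otimes> t \<oplus> z) (T \<times> pideal (Suc j)) (pideal j)"
proof (rule bij_betwI')
  fix a b assume "a \<in> T \<times> pideal (Suc j)" "b \<in> T \<times> pideal (Suc j)"
  then obtain s z t w where ab: "a = (s, z)" "b = (t, w)" "s \<in> T" "t \<in> T"
    "z \<in> pideal (Suc j)" "w \<in> pideal (Suc j)" by blast
  have cl: "s \<in> carrier R" "t \<in> carrier R" "z \<in> carrier R" "w \<in> carrier R"
    using ab T_subset pideal_closed by blast+
  show "((case a of (t, z) \<Rightarrow> \<pi> [^] j \<otimes> t \<oplus> z) = (case b of (t, z) \<Rightarrow> \<pi> [^] j \<otimes> t \<oplus> z)) = (a = b)"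
  proof
    assume "(case a of (t, z) \<Rightarrow> \<pi> [^] j \<otimes> t \<oplus> z) = (case b of (t, z) \<Rightarrow> \<pi> [^] j \<otimes> t \<oplus> z)"
    then have eq: "\<pi> [^] j \<otimes> s \<oplus> z = \<pi> [^] j \<otimes> t \<oplus> w" by (simp add: ab)
    \<comment> \<open>Equal images turn \<pi>^j (s - t) into a difference of tails, hence an element
      of \<open>pideal (Suc j)\<close>; with a unit s - t its level would be exactly j.\<close>
    have "\<pi> [^] j \<otimes> (s \<ominus> t) = (\<pi> [^] j \<otimes> s \<oplus> z) \<ominus> z \<ominus> \<pi> [^] j \<otimes> t"
      using cl pi_pow_closed[of j] by algebra
    also have "\<dots> = w \<ominus> z" unfolding eq using cl pi_pow_closed[of j] by algebra
    also have "\<dots> \<in> pideal (Suc j)" using ab by (simp add: pideal_diff)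
    finally have "s = t"
      using pow_unit_pideal_iff[OF T_diff_unit[OF ab(3,4)] j, of "Suc j"] by auto
    then show "a = b" using eq cl by (simp add: ab)
  qed simp
next
  fix a assume "a \<in> T \<times> pideal (Suc j)"
  then obtain t z where "a = (t, z)" "t \<in> carrier R" "z \<in> pideal j"
    using T_subset pideal_antimono[of j "Suc j"] by auto
  then show "(case a of (t, z) \<Rightarrow> \<pi> [^] j \<otimes> t \<oplus> z) \<in> pideal j"
    by (simp add: pideal_add pidealI)
next
  fix x assume "x \<in> pideal j"
  then obtain y where y: "y \<in> carrier R" "x = \<pi> [^] j \<otimes> y" by (elim pidealE)
  obtain t w where tw: "t \<in> T" "w \<in> carrier R" "y = t \<oplus> \<pi> \<otimes> w" using T_decomp[OF y(1)] by blast
  have "t \<in> carrier R" using tw T_subset by blast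
  then have "x = \<pi> [^] j \<otimes> t \<oplus> \<pi> [^] Suc j \<otimes> w"
    using y tw by (simp add: r_distr m_assoc)
  then show "\<exists>a\<in>T \<times> pideal (Suc j). x = (case a of (t, z) \<Rightarrow> \<pi> [^] j \<otimes> t \<oplus> z)"
    using tw pidealI[of w "Suc j"] by (intro bexI[of _ "(t, \<pi> [^] Suc j \<otimes> w)"]) auto
qed

lemma card_pideal: "finite (pideal j) \<and> card (pideal j) = card T ^ (r - j)"
proof (induction "r - j" arbitrary: j)
  case 0
  then show ?case by (simp add: pideal_r)
next
  case (Suc m)
  then have j: "j < r" and IH: "finite (pideal (Suc j)) \<and> card (pideal (Suc j)) = card T ^ (r - Suc j)"
    by auto
  have rj: "r - j = Suc (r - Suc j)" using j by simp
  show ?case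
    using bij_betw_finite[OF digit_bij[OF j]] bij_betw_same_card[OF digit_bij[OF j]] IH finite_T
    unfolding rj by (simp add: card_cartesian_product)
qed

lemma finite_carrier: "finite (carrier R)" and card_carrier: "card (carrier R) = card T ^ r"
  using card_pideal[of 0] by (simp_all add: pideal_0)

lemma card_T: "2 \<le> card T"
proof -
  have "card {\<zero>, \<one>} \<le> card T"
    by (rule card_mono) (use finite_T zero_in_T one_in_T in auto)
  then show ?thesis using one_not_zero by simp
qed

end

text \<open>Digits are translated one at a time, starting from the deepest ideal. Two elements are
  congruent modulo \<pi>^k exactly if their first k digits agree, and any bijection of the digit
  sets respects that. Preserving 0 and 1 serves the normalised generators, which have a coordinate 1
  preceded by coordinates in (\<pi>).\<close>

lemma chain_ring_bijection:
  fixes R (structure) and S (structure)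
  assumes R: "chain_ring R T \<pi> r" and S: "chain_ring S T' \<pi>' r" and c: "card T = card T'"
  obtains \<phi> where "bij_betw \<phi> (carrier R) (carrier S)" "\<phi> \<zero>\<^bsub>R\<^esub> = \<zero>\<^bsub>S\<^esub>" "\<phi> \<one>\<^bsub>R\<^esub> = \<one>\<^bsub>S\<^esub>"
    "\<And>x y k. \<lbrakk>x \<in> carrier R; y \<in> carrier R\<rbrakk> \<Longrightarrow>
      \<phi> x \<ominus>\<^bsub>S\<^esub> \<phi> y \<in> chain_ring.pideal S \<pi>' k \<longleftrightarrow> x \<ominus>\<^bsub>R\<^esub> y \<in> chain_ring.pideal R \<pi> k"
proof -
  interpret R: chain_ring R T \<pi> r by fact
  interpret S: chain_ring S T' \<pi>' r by fact
  have "\<exists>\<tau>. bij_betw \<tau> (T - {\<zero>\<^bsub>R\<^esub>, \<one>\<^bsub>R\<^esub>}) (T' - {\<zero>\<^bsub>S\<^esub>, \<one>\<^bsub>S\<^esub>})"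
  proof (rule finite_same_card_bij)
    show "card (T - {\<zero>\<^bsub>R\<^esub>, \<one>\<^bsub>R\<^esub>}) = card (T' - {\<zero>\<^bsub>S\<^esub>, \<one>\<^bsub>S\<^esub>})"
      using R.zero_in_T R.one_in_T R.one_not_zero S.zero_in_T S.one_in_T S.one_not_zero c
      by (simp add: card_Diff_subset)
  qed (use R.finite_T S.finite_T in auto)
  then obtain \<tau>0 where t0: "bij_betw \<tau>0 (T - {\<zero>\<^bsub>R\<^esub>, \<one>\<^bsub>R\<^esub>}) (T' - {\<zero>\<^bsub>S\<^esub>, \<one>\<^bsub>S\<^esub>})" by blast
  define \<tau> where "\<tau> t = (if t = \<zero>\<^bsub>R\<^esub> then \<zero>\<^bsub>S\<^esub> else if t = \<one>\<^bsub>R\<^esub> then \<one>\<^bsub>S\<^esub> else \<tau>0 t)" for t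
  have tau: "bij_betw \<tau> T T'"
  proof -
    have 1: "bij_betw \<tau> {\<zero>\<^bsub>R\<^esub>, \<one>\<^bsub>R\<^esub>} {\<zero>\<^bsub>S\<^esub>, \<one>\<^bsub>S\<^esub>}"
      using R.one_not_zero S.one_not_zero by (auto simp: bij_betw_def \<tau>_def)
    have 2: "bij_betw \<tau> (T - {\<zero>\<^bsub>R\<^esub>, \<one>\<^bsub>R\<^esub>}) (T' - {\<zero>\<^bsub>S\<^esub>, \<one>\<^bsub>S\<^esub>})"
      using t0 by (subst bij_betw_cong[of _ _ \<tau>0]) (auto simp: \<tau>_def)
    have "T = {\<zero>\<^bsub>R\<^esub>, \<one>\<^bsub>R\<^esub>} \<union> (T - {\<zero>\<^bsub>R\<^esub>, \<one>\<^bsub>R\<^esub>})" "T' = {\<zero>\<^bsub>S\<^esub>, \<one>\<^bsub>S\<^esub>} \<union> (T' - {\<zero>\<^bsub>S\<^esub>, \<one>\<^bsub>S\<^esub>})"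
      using R.zero_in_T R.one_in_T S.zero_in_T S.one_in_T by auto
    then show ?thesis using bij_betw_combine[OF 1 2] by auto
  qed
  \<comment> \<open>The element 1 lies in \<open>pideal j\<close> only for j = 0, whence the
    restricted last clause; that 0 goes to 0 is carried along because the tail of 1 is 0.\<close>
  have step: "\<exists>\<phi>. bij_betw \<phi> (R.pideal j) (S.pideal j) \<and> \<phi> \<zero>\<^bsub>R\<^esub> = \<zero>\<^bsub>S\<^esub> \<and>
      (\<forall>x\<in>R.pideal j. \<forall>y\<in>R.pideal j. \<forall>k. \<phi> x \<ominus>\<^bsub>S\<^esub> \<phi> y \<in> S.pideal k \<longleftrightarrow> x \<ominus>\<^bsub>R\<^esub> y \<in> R.pideal k) \<and>
      (j = 0 \<longrightarrow> \<phi> \<one>\<^bsub>R\<^esub> = \<one>\<^bsub>S\<^esub>)" for j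
  proof (induction "r - j" arbitrary: j)
    case 0
    then have j: "j \<noteq> 0" "R.pideal j = {\<zero>\<^bsub>R\<^esub>}" "S.pideal j = {\<zero>\<^bsub>S\<^esub>}"
      using R.r_pos R.pideal_r S.pideal_r by auto
    have zz: "\<zero>\<^bsub>R\<^esub> \<ominus>\<^bsub>R\<^esub> \<zero>\<^bsub>R\<^esub> = \<zero>\<^bsub>R\<^esub>" "\<zero>\<^bsub>S\<^esub> \<ominus>\<^bsub>S\<^esub> \<zero>\<^bsub>S\<^esub> = \<zero>\<^bsub>S\<^esub>"
      by (simp_all add: R.minus_eq S.minus_eq)
    show ?case
      using j by (intro exI[of _ "\<lambda>_. \<zero>\<^bsub>S\<^esub>"]) (simp add: bij_betw_def zz)
  next
    case (Suc m)
    then have j: "j < r" by simp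
    have "m = r - Suc j" using Suc(2) by simp
    from Suc(1)[OF this] obtain \<psi> where psi: "bij_betw \<psi> (R.pideal (Suc j)) (S.pideal (Suc j))" "\<psi> \<zero>\<^bsub>R\<^esub> = \<zero>\<^bsub>S\<^esub>"
      "\<And>x y k. \<lbrakk>x \<in> R.pideal (Suc j); y \<in> R.pideal (Suc j)\<rbrakk> \<Longrightarrow>
        \<psi> x \<ominus>\<^bsub>S\<^esub> \<psi> y \<in> S.pideal k \<longleftrightarrow> x \<ominus>\<^bsub>R\<^esub> y \<in> R.pideal k"
      by blast
    define f where "f = (\<lambda>(t, z). \<pi> [^]\<^bsub>R\<^esub> j \<otimes>\<^bsub>R\<^esub> t \<oplus>\<^bsub>R\<^esub> z)"
    define g where "g = (\<lambda>(t, z). \<pi>' [^]\<^bsub>S\<^esub> j \<otimes>\<^bsub>S\<^esub> t \<oplus>\<^bsub>S\<^esub> z)"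
    have f: "bij_betw f (T \<times> R.pideal (Suc j)) (R.pideal j)"
      unfolding f_def by (rule R.digit_bij[OF j])
    have g: "bij_betw g (T' \<times> S.pideal (Suc j)) (S.pideal j)"
      unfolding g_def by (rule S.digit_bij[OF j])
    define \<phi> where "\<phi> = g \<circ> map_prod \<tau> \<psi> \<circ> inv_into (T \<times> R.pideal (Suc j)) f"
    have "bij_betw (map_prod \<tau> \<psi>) (T \<times> R.pideal (Suc j)) (T' \<times> S.pideal (Suc j))"
      by (rule bij_betw_map_prod[OF tau psi(1)])
    then have bij: "bij_betw \<phi> (R.pideal j) (S.pideal j)"
      unfolding \<phi>_def by (rule bij_betw_trans[OF bij_betw_inv_into[OF f] bij_betw_trans[OF _ g]])
    have phi: "\<phi> (\<pi> [^]\<^bsub>R\<^esub> j \<otimes>\<^bsub>R\<^esub> t \<oplus>\<^bsub>R\<^esub> z) = \<pi>' [^]\<^bsub>S\<^esub> j \<otimes>\<^bsub>S\<^esub> \<tau> t \<oplus>\<^bsub>S\<^esub> \<psi> z"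
      if "t \<in> T" "z \<in> R.pideal (Suc j)" for t z
    proof -
      have "\<phi> (f (t, z)) = g (\<tau> t, \<psi> z)"
        using bij_betw_inv_into_left[OF f, of "(t, z)"] that by (simp add: \<phi>_def)
      then show ?thesis by (simp add: f_def g_def)
    qed
    have onto: thesis
      if "x \<in> R.pideal j"
        "\<And>t z. \<lbrakk>t \<in> T; z \<in> R.pideal (Suc j); x = \<pi> [^]\<^bsub>R\<^esub> j \<otimes>\<^bsub>R\<^esub> t \<oplus>\<^bsub>R\<^esub> z\<rbrakk> \<Longrightarrow> thesis" for x thesis
    proof -
      have "x \<in> f ` (T \<times> R.pideal (Suc j))"
        unfolding bij_betw_imp_surj_on[OF f] by (rule that(1))
      then obtain a where a: "a \<in> T \<times> R.pideal (Suc j)" "x = f a" by (elim imageE)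
      show thesis
        by (rule that(2)[of "fst a" "snd a"]) (use a in \<open>simp_all add: f_def case_prod_beta mem_Times_iff\<close>)
    qed
    have "\<phi> x \<ominus>\<^bsub>S\<^esub> \<phi> y \<in> S.pideal k \<longleftrightarrow> x \<ominus>\<^bsub>R\<^esub> y \<in> R.pideal k"
      if xy: "x \<in> R.pideal j" "y \<in> R.pideal j" for x y k
    proof -
      obtain s z where x: "s \<in> T" "z \<in> R.pideal (Suc j)" "x = \<pi> [^]\<^bsub>R\<^esub> j \<otimes>\<^bsub>R\<^esub> s \<oplus>\<^bsub>R\<^esub> z"
        using onto[OF xy(1)] .
      obtain t w where y: "t \<in> T" "w \<in> R.pideal (Suc j)" "y = \<pi> [^]\<^bsub>R\<^esub> j \<otimes>\<^bsub>R\<^esub> t \<oplus>\<^bsub>R\<^esub> w"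
        using onto[OF xy(2)] .
      have tT: "\<tau> s \<in> T'" "\<tau> t \<in> T'" and pz: "\<psi> z \<in> S.pideal (Suc j)" "\<psi> w \<in> S.pideal (Suc j)"
        using x y tau psi(1) bij_betwE by blast+
      have clR: "s \<in> carrier R" "t \<in> carrier R" "z \<in> carrier R" "w \<in> carrier R"
        using x y R.T_subset R.pideal_closed by blast+
      have clS: "\<tau> s \<in> carrier S" "\<tau> t \<in> carrier S" "\<psi> z \<in> carrier S" "\<psi> w \<in> carrier S"
        using tT pz S.T_subset S.pideal_closed by blast+
      have dR: "x \<ominus>\<^bsub>R\<^esub> y = \<pi> [^]\<^bsub>R\<^esub> j \<otimes>\<^bsub>R\<^esub> (s \<ominus>\<^bsub>R\<^esub> t) \<oplus>\<^bsub>R\<^esub> (z \<ominus>\<^bsub>R\<^esub> w)"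
        unfolding x y using clR R.pi_pow_closed[of j] by algebra
      have dS: "\<phi> x \<ominus>\<^bsub>S\<^esub> \<phi> y = \<pi>' [^]\<^bsub>S\<^esub> j \<otimes>\<^bsub>S\<^esub> (\<tau> s \<ominus>\<^bsub>S\<^esub> \<tau> t) \<oplus>\<^bsub>S\<^esub> (\<psi> z \<ominus>\<^bsub>S\<^esub> \<psi> w)"
        unfolding x(3) y(3) phi[OF x(1,2)] phi[OF y(1,2)]
        using clS S.pi_pow_closed[of j] by algebra
      show ?thesis
      \<comment> \<open>Equal leading digits leave the tails to the induction hypothesis; distinct
        ones put both differences at level exactly j.\<close>
      proof (cases "s = t")
        case True
        then have "x \<ominus>\<^bsub>R\<^esub> y = z \<ominus>\<^bsub>R\<^esub> w" "\<phi> x \<ominus>\<^bsub>S\<^esub> \<phi> y = \<psi> z \<ominus>\<^bsub>S\<^esub> \<psi> w"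
          unfolding dR dS using clR clS by (simp_all add: R.minus_eq R.r_neg S.minus_eq S.r_neg)
        then show ?thesis using psi(3) x y by simp
      next
        case False
        then have ne: "\<tau> s \<noteq> \<tau> t" using tau x y by (auto simp: bij_betw_def dest: inj_onD)
        have uR: "s \<ominus>\<^bsub>R\<^esub> t \<in> Units R" and uS: "\<tau> s \<ominus>\<^bsub>S\<^esub> \<tau> t \<in> Units S"
          using R.T_diff_unit S.T_diff_unit x y tT False ne by auto
        have "x \<ominus>\<^bsub>R\<^esub> y \<in> R.pideal k \<longleftrightarrow> k \<le> j"
          unfolding dR by (rule R.leading_digit_pideal_iff[OF uR _ j]) (use x y R.pideal_diff in auto)
        moreover have "\<phi> x \<ominus>\<^bsub>S\<^esub> \<phi> y \<in> S.pideal k \<longleftrightarrow> k \<le> j"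
          unfolding dS by (rule S.leading_digit_pideal_iff[OF uS _ j]) (use pz S.pideal_diff in auto)
        ultimately show ?thesis by simp
      qed
    qed
    moreover have "\<phi> \<zero>\<^bsub>R\<^esub> = \<zero>\<^bsub>S\<^esub>"
      using phi[OF R.zero_in_T R.zero_pideal] psi(2) by (simp add: \<tau>_def)
    moreover have "\<phi> \<one>\<^bsub>R\<^esub> = \<one>\<^bsub>S\<^esub>" if "j = 0"
      using phi[OF R.one_in_T R.zero_pideal] psi(2) R.one_not_zero that by (simp add: \<tau>_def)
    ultimately show ?case using bij by blast
  qed
  show thesis using step[of 0] that unfolding R.pideal_0 S.pideal_0 by blast
qed

section \<open>Free submodules\<close>

locale chain_module = chain_ring R T \<pi> r + module R M
  for R (structure) and T \<pi> r and M (structure)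
begin

text \<open>Families are functions on nat with an explicit index set, so that extending or
  restricting a basis changes only the set or one value of the function.\<close>

definition lc :: "nat set \<Rightarrow> (nat \<Rightarrow> 'a) \<Rightarrow> (nat \<Rightarrow> 'c) \<Rightarrow> 'c" where
  "lc I a b = (\<Oplus>\<^bsub>M\<^esub>i\<in>I. a i \<odot>\<^bsub>M\<^esub> b i)"

definition indep :: "nat set \<Rightarrow> (nat \<Rightarrow> 'c) \<Rightarrow> bool" where
  "indep I b \<longleftrightarrow> finite I \<and> b \<in> I \<rightarrow> carrier M \<and>
    (\<forall>a\<in>I \<rightarrow> carrier R. lc I a b = \<zero>\<^bsub>M\<^esub> \<longrightarrow> (\<forall>i\<in>I. a i = \<zero>))"

text \<open>Spans, the multiples \<pi>^k V and the sums <b> + \<pi>^k V all have this shape in a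
  suitable basis, each coefficient ranging over an ideal of its own; one cardinality formula then
  covers them all.\<close>

definition box :: "nat set \<Rightarrow> (nat \<Rightarrow> 'a set) \<Rightarrow> (nat \<Rightarrow> 'c) \<Rightarrow> 'c set" where
  "box I A b = (\<lambda>a. lc I a b) ` Pi I A"

definition spn :: "nat set \<Rightarrow> (nat \<Rightarrow> 'c) \<Rightarrow> 'c set" where
  "spn I b = box I (\<lambda>_. carrier R) b"

definition free_subs :: "nat \<Rightarrow> 'c set set" where
  "free_subs k = {spn I b | I b. indep I b \<and> card I = k}"

definition pmult :: "nat \<Rightarrow> 'c set \<Rightarrow> 'c set" where
  "pmult k V = (\<lambda>v. \<pi> [^] k \<odot>\<^bsub>M\<^esub> v) ` V"

section \<open>Rules for linear combinations, independence and spans\<close>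

lemma indepD:
  assumes "indep I b"
  shows "finite I" "b \<in> I \<rightarrow> carrier M"
    "\<lbrakk>a \<in> I \<rightarrow> carrier R; lc I a b = \<zero>\<^bsub>M\<^esub>; i \<in> I\<rbrakk> \<Longrightarrow> a i = \<zero>"
  using assms unfolding indep_def by blast+

lemma lc_cong:
  assumes "\<And>i. i \<in> I \<Longrightarrow> a i = a' i" "\<And>i. i \<in> I \<Longrightarrow> b i = b' i"
    "a' \<in> I \<rightarrow> carrier R" "b' \<in> I \<rightarrow> carrier M"
  shows "lc I a b = lc I a' b'"
  unfolding lc_def
proof (rule M.finsum_cong')
  show "(\<lambda>i. a' i \<odot>\<^bsub>M\<^esub> b' i) \<in> I \<rightarrow> carrier M" using assms(3,4) by blast
qed (use assms in auto)

lemma indep_cong: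
  assumes "indep I b" "\<And>i. i \<in> I \<Longrightarrow> b' i = b i"
  shows "indep I b'"
proof -
  note b = indepD[OF assms(1)]
  have b': "b' \<in> I \<rightarrow> carrier M" using b(2) assms(2) by (simp add: Pi_def)
  have "lc I a b' = lc I a b" if "a \<in> I \<rightarrow> carrier R" for a
    by (rule lc_cong) (use that b assms(2) in auto)
  then show ?thesis using b b' unfolding indep_def by auto
qed

lemma lc_closed [simp]:
  "\<lbrakk>a \<in> I \<rightarrow> carrier R; b \<in> I \<rightarrow> carrier M\<rbrakk> \<Longrightarrow> lc I a b \<in> carrier M"
  unfolding lc_def by (rule M.finsum_closed) blast

lemma lc_add:
  assumes "a \<in> I \<rightarrow> carrier R" "a' \<in> I \<rightarrow> carrier R" "b \<in> I \<rightarrow> carrier M"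
  shows "lc I (\<lambda>i. a i \<oplus> a' i) b = lc I a b \<oplus>\<^bsub>M\<^esub> lc I a' b"
proof -
  have "lc I (\<lambda>i. a i \<oplus> a' i) b = (\<Oplus>\<^bsub>M\<^esub>i\<in>I. a i \<odot>\<^bsub>M\<^esub> b i \<oplus>\<^bsub>M\<^esub> a' i \<odot>\<^bsub>M\<^esub> b i)"
    unfolding lc_def
    by (rule M.finsum_cong') (use assms in \<open>auto simp: Pi_def smult_l_distr\<close>)
  also have "\<dots> = lc I a b \<oplus>\<^bsub>M\<^esub> lc I a' b"
    unfolding lc_def by (rule M.finsum_addf) (use assms in auto)
  finally show ?thesis .
qed

lemma lc_smult:
  assumes "finite I" "c \<in> carrier R" "a \<in> I \<rightarrow> carrier R" "b \<in> I \<rightarrow> carrier M"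
  shows "lc I (\<lambda>i. c \<otimes> a i) b = c \<odot>\<^bsub>M\<^esub> lc I a b"
proof -
  have "c \<odot>\<^bsub>M\<^esub> lc I a b = (\<Oplus>\<^bsub>M\<^esub>i\<in>I. c \<odot>\<^bsub>M\<^esub> (a i \<odot>\<^bsub>M\<^esub> b i))"
    unfolding lc_def by (rule finsum_smult_ldistr) (use assms in auto)
  also have "\<dots> = lc I (\<lambda>i. c \<otimes> a i) b"
    unfolding lc_def
    by (rule M.finsum_cong') (use assms in \<open>auto simp: Pi_def smult_assoc1\<close>)
  finally show ?thesis by simp
qed

lemma lc_minus:
  assumes "finite I" "a \<in> I \<rightarrow> carrier R" "b \<in> I \<rightarrow> carrier M"
  shows "lc I (\<lambda>i. \<ominus> a i) b = \<ominus>\<^bsub>M\<^esub> lc I a b"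
proof -
  have "lc I (\<lambda>i. \<ominus> a i) b = lc I (\<lambda>i. \<ominus> \<one> \<otimes> a i) b"
    by (rule lc_cong) (use assms in \<open>auto simp: l_minus Pi_def\<close>)
  also have "\<dots> = \<ominus>\<^bsub>M\<^esub> lc I a b"
    using assms by (subst lc_smult) (auto simp: smult_l_minus)
  finally show ?thesis .
qed

lemma lc_diff:
  assumes "finite I" "a \<in> I \<rightarrow> carrier R" "a' \<in> I \<rightarrow> carrier R" "b \<in> I \<rightarrow> carrier M"
  shows "lc I (\<lambda>i. a i \<ominus> a' i) b = lc I a b \<ominus>\<^bsub>M\<^esub> lc I a' b"
proof -
  have "(\<lambda>i. \<ominus> a' i) \<in> I \<rightarrow> carrier R" using assms(3) by auto
  from lc_add[OF assms(2) this assms(4)] show ?thesis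
    using lc_minus[OF assms(1,3,4)] by (simp add: a_minus_def)
qed

lemma lc_empty [simp]: "lc {} a b = \<zero>\<^bsub>M\<^esub>"
  by (simp add: lc_def)

lemma lc_insert:
  assumes "finite I" "j \<notin> I" "a \<in> insert j I \<rightarrow> carrier R" "b \<in> insert j I \<rightarrow> carrier M"
  shows "lc (insert j I) a b = a j \<odot>\<^bsub>M\<^esub> b j \<oplus>\<^bsub>M\<^esub> lc I a b"
  unfolding lc_def by (rule M.finsum_insert) (use assms in auto)

lemma lc_neutral:
  assumes "finite I" "J \<subseteq> I" "a \<in> I \<rightarrow> carrier R" "b \<in> I \<rightarrow> carrier M"
    "\<And>i. i \<in> I - J \<Longrightarrow> a i = \<zero>"
  shows "lc I a b = lc J a b"
  unfolding lc_def
  by (rule M.add.finprod_mono_neutral_cong_left[symmetric]) (use assms in \<open>auto simp: Pi_def\<close>)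

lemma lc_zero: "finite I \<Longrightarrow> b \<in> I \<rightarrow> carrier M \<Longrightarrow> (\<And>i. i \<in> I \<Longrightarrow> a i = \<zero>) \<Longrightarrow> lc I a b = \<zero>\<^bsub>M\<^esub>"
  using lc_neutral[of I "{}" a b] by (auto simp: Pi_def)

lemma lc_single:
  assumes "finite I" "j \<in> I" "c \<in> carrier R" "b \<in> I \<rightarrow> carrier M"
  shows "lc I (\<lambda>i. if i = j then c else \<zero>) b = c \<odot>\<^bsub>M\<^esub> b j"
proof -
  have "lc I (\<lambda>i. if i = j then c else \<zero>) b = lc (insert j {}) (\<lambda>i. if i = j then c else \<zero>) b"
    by (rule lc_neutral) (use assms in auto)
  also have "\<dots> = c \<odot>\<^bsub>M\<^esub> b j"
    using assms by (subst lc_insert) (auto simp: Pi_def)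
  finally show ?thesis .
qed

lemma indep_unique:
  assumes "indep I b" "a \<in> I \<rightarrow> carrier R" "a' \<in> I \<rightarrow> carrier R" "lc I a b = lc I a' b" "i \<in> I"
  shows "a i = a' i"
proof -
  note b = indepD[OF assms(1)]
  have "lc I (\<lambda>i. a i \<ominus> a' i) b = \<zero>\<^bsub>M\<^esub>"
    using lc_diff[OF b(1) assms(2,3) b(2)] assms(4) lc_closed[OF assms(3) b(2)]
    by (simp add: M.minus_eq M.r_neg)
  then have "a i \<ominus> a' i = \<zero>"
    using b(3)[of "\<lambda>i. a i \<ominus> a' i" i] assms by auto
  then show ?thesis using assms(2,3,5) by (simp add: Pi_def)
qed

lemma box_PiE: 
  assumes "\<And>i. i \<in> I \<Longrightarrow> A i \<subseteq> carrier R" "b \<in> I \<rightarrow> carrier M"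
  shows "box I A b = (\<lambda>a. lc I a b) ` Pi\<^sub>E I A"
proof
  show "box I A b \<subseteq> (\<lambda>a. lc I a b) ` Pi\<^sub>E I A"
  proof
    fix x assume "x \<in> box I A b"
    then obtain a where a: "a \<in> Pi I A" "x = lc I a b" by (auto simp: box_def)
    have "lc I a b = lc I (restrict a I) b"
      by (rule lc_cong) (use a assms in auto)
    then show "x \<in> (\<lambda>a. lc I a b) ` Pi\<^sub>E I A" using a by (intro image_eqI[of _ _ "restrict a I"]) auto
  qed
qed (auto simp: box_def PiE_def)

text \<open>Independence makes coefficient functions unique once they are fixed to be
  \<open>undefined\<close> off I.\<close>

lemma card_box:
  assumes b: "indep I b" and A: "\<And>i. i \<in> I \<Longrightarrow> A i \<subseteq> carrier R"
  shows "card (box I A b) = (\<Prod>i\<in>I. card (A i))"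
proof -
  note bD = indepD[OF b]
  have "inj_on (\<lambda>a. lc I a b) (Pi\<^sub>E I A)"
  proof (rule inj_onI)
    fix a a' assume a: "a \<in> Pi\<^sub>E I A" "a' \<in> Pi\<^sub>E I A" "lc I a b = lc I a' b"
    have "a i = a' i" if "i \<in> I" for i
      by (rule indep_unique[OF b _ _ a(3) that]) (use a A in auto)
    then show "a = a'" using a(1,2) by (intro PiE_ext[of a I A a']) auto
  qed
  then have "card (box I A b) = card (Pi\<^sub>E I A)"
    using box_PiE[of I A b] A bD(2) by (simp add: card_image)
  then show ?thesis using bD(1) by (simp add: card_PiE)
qed

lemma card_spn: "indep I b \<Longrightarrow> card (spn I b) = card (carrier R) ^ card I"
  unfolding spn_def by (simp add: card_box)

lemma spn_mem: "a \<in> I \<rightarrow> carrier R \<Longrightarrow> lc I a b \<in> spn I b"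
  by (auto simp: spn_def box_def)

lemma spnE:
  assumes "x \<in> spn I b" obtains a where "a \<in> I \<rightarrow> carrier R" "x = lc I a b"
  using assms by (auto simp: spn_def box_def)

lemma submodule_spn:
  assumes "finite I" "b \<in> I \<rightarrow> carrier M" shows "submodule (spn I b) R M"
proof (rule submoduleI)
  show "spn I b \<subseteq> carrier M" using assms by (auto elim!: spnE)
  show "\<zero>\<^bsub>M\<^esub> \<in> spn I b"
    using spn_mem[of "\<lambda>_. \<zero>" I b] lc_zero[OF assms, of "\<lambda>_. \<zero>"] by simp
  fix x assume "x \<in> spn I b"
  then obtain a where a: "a \<in> I \<rightarrow> carrier R" "x = lc I a b" by (elim spnE)
  show "\<ominus>\<^bsub>M\<^esub> x \<in> spn I b"
    unfolding a(2) lc_minus[OF assms(1) a(1) assms(2), symmetric] by (rule spn_mem) (use a in auto)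
  show "c \<odot>\<^bsub>M\<^esub> x \<in> spn I b" if "c \<in> carrier R" for c
    unfolding a(2) lc_smult[OF assms(1) that a(1) assms(2), symmetric] by (rule spn_mem) (use a that in auto)
  fix y assume "y \<in> spn I b"
  then obtain a' where a': "a' \<in> I \<rightarrow> carrier R" "y = lc I a' b" by (elim spnE)
  show "x \<oplus>\<^bsub>M\<^esub> y \<in> spn I b"
    unfolding a(2) a'(2) lc_add[OF a(1) a'(1) assms(2), symmetric] by (rule spn_mem) (use a a' in auto)
qed

lemma lc_mem_submodule:
  assumes V: "submodule V R M" and "finite I" "a \<in> I \<rightarrow> carrier R" "b \<in> I \<rightarrow> V"
  shows "lc I a b \<in> V"
  using assms(2-)
proof (induction I rule: finite_induct)
  case empty
  then show ?case using V submodule.axioms(1) subgroup.one_closed by fastforce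
next
  case (insert j I)
  have "lc (insert j I) a b = a j \<odot>\<^bsub>M\<^esub> b j \<oplus>\<^bsub>M\<^esub> lc I a b"
    by (rule lc_insert) (use insert submoduleE(1)[OF V] in auto)
  then show ?case
    using insert submoduleE(4,5)[OF V] by (auto simp: Pi_def)
qed

lemma spn_subset: "\<lbrakk>submodule V R M; finite I; b \<in> I \<rightarrow> V\<rbrakk> \<Longrightarrow> spn I b \<subseteq> V"
  by (auto elim!: spnE intro: lc_mem_submodule)

lemma basis_mem_spn: "\<lbrakk>finite I; b \<in> I \<rightarrow> carrier M; i \<in> I\<rbrakk> \<Longrightarrow> b i \<in> spn I b"
  using lc_single[of I i \<one> b] spn_mem[of "\<lambda>j. if j = i then \<one> else \<zero>" I b] by (auto simp: Pi_def)

lemma indep_subset: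
  assumes "indep I b" "J \<subseteq> I" shows "indep J b"
proof -
  note b = indepD[OF assms(1)]
  have "a i = \<zero>" if a: "a \<in> J \<rightarrow> carrier R" "lc J a b = \<zero>\<^bsub>M\<^esub>" "i \<in> J" for a i
  proof -
    define a' where "a' i = (if i \<in> J then a i else \<zero>)" for i
    have "lc I a' b = lc J a' b"
      by (rule lc_neutral) (use b assms a in \<open>auto simp: a'_def\<close>)
    also have "\<dots> = lc J a b"
      by (rule lc_cong) (use b assms a in \<open>auto simp: a'_def\<close>)
    finally have "lc I a' b = \<zero>\<^bsub>M\<^esub>" using a by simp
    moreover have "a' \<in> I \<rightarrow> carrier R" using a by (auto simp: a'_def)
    ultimately have "a' i = \<zero>" using b(3) a(3) assms(2) by blast
    then show ?thesis using a by (simp add: a'_def)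
  qed
  then show ?thesis using b assms(2) finite_subset unfolding indep_def by blast
qed

section \<open>Free submodules: cardinality, rank, multiples of the uniformiser, extension of
  bases\<close>

lemma free_subsE:
  assumes "V \<in> free_subs n"
  obtains I b where "indep I b" "card I = n" "V = spn I b"
  using assms by (auto simp: free_subs_def)

lemma free_subsI: "indep I b \<Longrightarrow> card I = n \<Longrightarrow> spn I b \<in> free_subs n"
  by (auto simp: free_subs_def)

lemma free_subs_submodule: "V \<in> free_subs n \<Longrightarrow> submodule V R M"
  by (auto elim!: free_subsE intro: submodule_spn dest: indepD)

lemma free_subs_carrier: "V \<in> free_subs n \<Longrightarrow> V \<subseteq> carrier M"
  by (rule submoduleE(1)[OF free_subs_submodule])

lemma card_free_subs: "V \<in> free_subs n \<Longrightarrow> card V = card (carrier R) ^ n"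
  by (auto elim!: free_subsE simp: card_spn)

lemma card_carrier_gt_1: "1 < card (carrier R)"
  unfolding card_carrier using card_T r_pos one_less_power[of "card T" r] by simp

lemma finite_free_subs: "V \<in> free_subs n \<Longrightarrow> finite V"
  using card_free_subs[of V n] card_carrier_gt_1 by (intro card_ge_0_finite) simp

text \<open>The cardinality |R|^n determines n, as R has more than one element.\<close>

lemma free_subs_rank_unique: "V \<in> free_subs n \<Longrightarrow> V \<in> free_subs m \<Longrightarrow> n = m"
  using card_free_subs card_carrier_gt_1 by (metis power_inject_exp)

lemma pmult_subset: "V \<in> free_subs n \<Longrightarrow> pmult k V \<subseteq> V"
  using submoduleE(4)[OF free_subs_submodule] by (auto simp: pmult_def)

lemma pmult_spn:
  assumes b: "finite I" "b \<in> I \<rightarrow> carrier M"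
  shows "pmult k (spn I b) = box I (\<lambda>_. pideal k) b"
proof
  show "pmult k (spn I b) \<subseteq> box I (\<lambda>_. pideal k) b"
  proof
    fix x assume "x \<in> pmult k (spn I b)"
    then obtain a where a: "a \<in> I \<rightarrow> carrier R" "x = \<pi> [^] k \<odot>\<^bsub>M\<^esub> lc I a b"
      by (auto simp: pmult_def elim: spnE)
    have "x = lc I (\<lambda>i. \<pi> [^] k \<otimes> a i) b" using lc_smult[OF b(1) _ a(1) b(2)] a(2) by simp
    then show "x \<in> box I (\<lambda>_. pideal k) b" using a(1) pidealI by (auto simp: box_def)
  qed
  show "box I (\<lambda>_. pideal k) b \<subseteq> pmult k (spn I b)"
  proof
    fix x assume "x \<in> box I (\<lambda>_. pideal k) b"
    then obtain a where a: "a \<in> I \<rightarrow> pideal k" "x = lc I a b" by (auto simp: box_def)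
    have "\<forall>i\<in>I. \<exists>y. y \<in> carrier R \<and> a i = \<pi> [^] k \<otimes> y" using a(1) by (auto elim: pidealE)
    then obtain y where y: "\<And>i. i \<in> I \<Longrightarrow> y i \<in> carrier R \<and> a i = \<pi> [^] k \<otimes> y i"
      using bchoice[of I "\<lambda>i y. y \<in> carrier R \<and> a i = \<pi> [^] k \<otimes> y"] by blast
    have "x = lc I (\<lambda>i. \<pi> [^] k \<otimes> y i) b"
      unfolding a(2) by (rule lc_cong) (use y b in auto)
    also have "\<dots> = \<pi> [^] k \<odot>\<^bsub>M\<^esub> lc I y b" by (rule lc_smult) (use y b in auto)
    finally show "x \<in> pmult k (spn I b)"
      using spn_mem[of y I b] y by (auto simp: pmult_def)
  qed
qed

text \<open>The annihilator of \<pi>^j in R is generated by \<pi>^(r-j); in a free module this holds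
  coordinate by coordinate. It measures what is lost when a relation is divided by a power of
  \<pi>.\<close>

lemma annihilator_pmult:
  assumes V: "V \<in> free_subs n" and v: "v \<in> V" and j: "j \<le> r" and z: "\<pi> [^] j \<odot>\<^bsub>M\<^esub> v = \<zero>\<^bsub>M\<^esub>"
  shows "v \<in> pmult (r - j) V"
proof -
  obtain I b where b: "indep I b" "V = spn I b" using V by (elim free_subsE)
  note bD = indepD[OF b(1)]
  obtain a where a: "a \<in> I \<rightarrow> carrier R" "v = lc I a b" using v b(2) by (auto elim: spnE)
  have "lc I (\<lambda>i. \<pi> [^] j \<otimes> a i) b = \<zero>\<^bsub>M\<^esub>"
    using lc_smult[OF bD(1) _ a(1) bD(2)] z a(2) by simp
  then have "\<pi> [^] j \<otimes> a i = \<zero>" if "i \<in> I" for i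
    using bD(3)[of "\<lambda>i. \<pi> [^] j \<otimes> a i" i] that a(1) by auto
  then have "a \<in> I \<rightarrow> pideal (r - j)" using pow_annihilator[OF _ j] a(1) by auto
  then show ?thesis using a(2) by (auto simp: b(2) pmult_spn[OF bD(1,2)] box_def)
qed

text \<open>The submodule <b> + \<pi>^k V. For k = 1 it is the span modulo \<pi>, which controls
  independence; for a single generator and V the whole module it collects the vectors that agree
  modulo \<pi>^k with a multiple of that generator.\<close>

definition psum :: "nat \<Rightarrow> nat set \<Rightarrow> (nat \<Rightarrow> 'c) \<Rightarrow> 'c set \<Rightarrow> 'c set" where
  "psum k I b V = {x \<oplus>\<^bsub>M\<^esub> y | x y. x \<in> spn I b \<and> y \<in> pmult k V}"

text \<open>If a relation has the coefficient \<pi>^s u at v, with s < r, all its other coefficients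
  are divisible by \<pi>^s. Dividing by \<pi>^s leaves an element u v + ... of \<pi>^(r-s) V, which
  is inside \<pi> V, so v would lie in <b> + \<pi> V.\<close>

lemma indep_insert:
  assumes V: "V \<in> free_subs n" and b: "indep I b" "b \<in> I \<rightarrow> V" and v: "v \<in> V" and j: "j \<notin> I"
    and out: "v \<notin> psum 1 I b V"
  shows "indep (insert j I) (b(j := v))"
proof -
  note bD = indepD[OF b(1)]
  note Vs = submoduleE[OF free_subs_submodule[OF V]]
  have vM: "v \<in> carrier M" using v Vs(1) by blast
  have bM: "b(j := v) \<in> insert j I \<rightarrow> carrier M" using bD(2) vM by auto
  have "a j = \<zero> \<and> (\<forall>i\<in>I. a i = \<zero>)"
    if a: "a \<in> insert j I \<rightarrow> carrier R" "lc (insert j I) a (b(j := v)) = \<zero>\<^bsub>M\<^esub>" for a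
  proof -
    have aI: "a \<in> I \<rightarrow> carrier R" and aj: "a j \<in> carrier R" using a by auto
    have "lc I a (b(j := v)) = lc I a b" by (rule lc_cong) (use aI bD j in auto)
    then have rel: "a j \<odot>\<^bsub>M\<^esub> v \<oplus>\<^bsub>M\<^esub> lc I a b = \<zero>\<^bsub>M\<^esub>"
      using lc_insert[OF bD(1) j a(1) bM] a(2) by simp
    obtain s u where su: "s \<le> r" "u \<in> Units R" "a j = \<pi> [^] s \<otimes> u" using valuation[OF aj] .
    have u: "u \<in> carrier R" using Units_closed[OF su(2)] .
    show ?thesis
    proof (cases "s = r")
      case True
      then have z: "a j = \<zero>" using su u by (simp add: pi_pow_r)
      then have "lc I a b = \<zero>\<^bsub>M\<^esub>" using rel vM lc_closed[OF aI bD(2)] by simp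
      then show ?thesis using z bD(3)[OF aI] by blast
    next
      case False
      then have s: "s < r" using su by simp
      \<comment> \<open>\<pi>^(r-s) annihilates the coefficient at v, and independence of b
        transfers this to each \<open>a i\<close>.\<close>
      have "\<pi> [^] (r - s) \<otimes> a j = \<zero>"
        using su u pi_pow_eq_zero_iff[of "r - s + s"]
        by (simp add: m_assoc[symmetric] nat_pow_mult)
      then have "\<pi> [^] (r - s) \<odot>\<^bsub>M\<^esub> lc I a b = \<zero>\<^bsub>M\<^esub>"
        using arg_cong[OF rel, of "\<lambda>x. \<pi> [^] (r - s) \<odot>\<^bsub>M\<^esub> x"] vM aj lc_closed[OF aI bD(2)]
        by (simp add: smult_r_distr smult_assoc1[symmetric])
      then have "lc I (\<lambda>i. \<pi> [^] (r - s) \<otimes> a i) b = \<zero>\<^bsub>M\<^esub>"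
        using lc_smult[OF bD(1) _ aI bD(2)] by simp
      then have "\<pi> [^] (r - s) \<otimes> a i = \<zero>" if "i \<in> I" for i
        using bD(3)[of "\<lambda>i. \<pi> [^] (r - s) \<otimes> a i" i] that aI by auto
      then have "a i \<in> pideal s" if "i \<in> I" for i
        using pow_annihilator[of "a i" "r - s"] that aI s by auto
      then have "\<forall>i\<in>I. \<exists>y. y \<in> carrier R \<and> a i = \<pi> [^] s \<otimes> y" by (auto elim: pidealE)
      then obtain y where y: "\<And>i. i \<in> I \<Longrightarrow> y i \<in> carrier R \<and> a i = \<pi> [^] s \<otimes> y i"
        using bchoice[of I "\<lambda>i y. y \<in> carrier R \<and> a i = \<pi> [^] s \<otimes> y"] by blast
      have yI: "y \<in> I \<rightarrow> carrier R" using y by auto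
      have "lc I a b = lc I (\<lambda>i. \<pi> [^] s \<otimes> y i) b" by (rule lc_cong) (use y bD in auto)
      also have "\<dots> = \<pi> [^] s \<odot>\<^bsub>M\<^esub> lc I y b" by (rule lc_smult) (use yI bD in auto)
      finally have "\<pi> [^] s \<odot>\<^bsub>M\<^esub> (u \<odot>\<^bsub>M\<^esub> v \<oplus>\<^bsub>M\<^esub> lc I y b) = \<zero>\<^bsub>M\<^esub>"
        using rel su(3) vM u lc_closed[OF yI bD(2)] by (simp add: smult_r_distr smult_assoc1)
      moreover have yV: "lc I y b \<in> V"
        by (rule lc_mem_submodule[OF free_subs_submodule[OF V] bD(1) yI b(2)])
      then have "u \<odot>\<^bsub>M\<^esub> v \<oplus>\<^bsub>M\<^esub> lc I y b \<in> V" using Vs(4,5) u v by blast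
      ultimately have "u \<odot>\<^bsub>M\<^esub> v \<oplus>\<^bsub>M\<^esub> lc I y b \<in> pmult (r - s) V"
        using annihilator_pmult[OF V] s by simp
      then obtain w where w: "w \<in> V" "u \<odot>\<^bsub>M\<^esub> v \<oplus>\<^bsub>M\<^esub> lc I y b = \<pi> [^] (r - s) \<odot>\<^bsub>M\<^esub> w"
        by (auto simp: pmult_def)
      have iu: "inv u \<in> carrier R" "inv u \<otimes> u = \<one>" using su by auto
      \<comment> \<open>One factor \<pi> of \<pi>^(r-s) stays outside; it exists because s <
        r.\<close>
      define w' where "w' = inv u \<odot>\<^bsub>M\<^esub> (\<pi> [^] (r - s - 1) \<odot>\<^bsub>M\<^esub> w)"
      have w'V: "w' \<in> V" unfolding w'_def using Vs(4) w iu by blast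
      have wM: "w \<in> carrier M" using w Vs(1) by blast
      define l where "l = lc I (\<lambda>i. \<ominus> (inv u) \<otimes> y i) b"
      have l: "l \<in> spn I b" unfolding l_def by (rule spn_mem) (use yI iu in auto)
      have l2: "l = \<ominus> (inv u) \<odot>\<^bsub>M\<^esub> lc I y b"
        unfolding l_def by (rule lc_smult) (use yI iu bD in auto)
      have p1: "\<pi> [^] (r - s) = \<pi> [^] (1::nat) \<otimes> \<pi> [^] (r - s - 1)"
      proof -
        have "r - s = 1 + (r - s - 1)" using s by simp
        then show ?thesis by (metis nat_pow_mult pi_closed)
      qed
      have "\<pi> [^] (1::nat) \<odot>\<^bsub>M\<^esub> w' = inv u \<odot>\<^bsub>M\<^esub> (\<pi> [^] (r - s) \<odot>\<^bsub>M\<^esub> w)"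
        unfolding w'_def p1 using iu wM by (simp add: smult_assoc1[symmetric] m_ac)
      also have "\<dots> = v \<oplus>\<^bsub>M\<^esub> inv u \<odot>\<^bsub>M\<^esub> lc I y b"
        unfolding w(2)[symmetric] using iu u vM lc_closed[OF yI bD(2)]
        by (simp add: smult_r_distr smult_assoc1[symmetric])
      finally have "v = l \<oplus>\<^bsub>M\<^esub> \<pi> [^] (1::nat) \<odot>\<^bsub>M\<^esub> w'"
        unfolding l2 using iu vM lc_closed[OF yI bD(2)]
        by (simp add: smult_l_minus M.a_lcomm M.l_neg)
      then have "v \<in> psum 1 I b V"
        using l w'V unfolding psum_def pmult_def by blast
      then show ?thesis using out by blast
    qed
  qed
  then show ?thesis unfolding indep_def using bM bD(1) by blast
qed

text \<open>Multiplying v = l + \<pi> w by \<pi>^(r-1) removes the second term and leaves a relation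
  in which v has the nonzero coefficient \<pi>^(r-1).\<close>

lemma indep_insertD:
  assumes V: "V \<subseteq> carrier M" and b: "indep (insert j I) (b(j := v))" and j: "j \<notin> I"
  shows "v \<notin> psum 1 I b V"
proof
  assume "v \<in> psum 1 I b V"
  then obtain a w where w: "a \<in> I \<rightarrow> carrier R" "w \<in> V"
      "v = lc I a b \<oplus>\<^bsub>M\<^esub> \<pi> [^] (1::nat) \<odot>\<^bsub>M\<^esub> w"
    unfolding psum_def pmult_def by (blast elim: spnE)
  note bD = indepD[OF b]
  have fI: "finite I" using bD(1) by simp
  have bM: "b \<in> I \<rightarrow> carrier M" and vM: "v \<in> carrier M" using bD(2) j by (auto simp: Pi_def split: if_splits)
  have wM: "w \<in> carrier M" using w V by blast
  define c where "c = \<pi> [^] (r - 1)"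
  have c: "c \<in> carrier R" "c \<otimes> \<pi> = \<zero>"
    unfolding c_def using r_pos nat_pow_Suc[of \<pi> "r - 1"] pi_pow_r by auto
  define a' where "a' i = (if i = j then c else \<ominus> c \<otimes> a i)" for i
  have a': "a' \<in> insert j I \<rightarrow> carrier R" using w(1) c by (auto simp: a'_def Pi_def)
  have "lc I a' (b(j := v)) = lc I (\<lambda>i. \<ominus> c \<otimes> a i) b"
    by (rule lc_cong) (use w(1) c bM j in \<open>auto simp: a'_def Pi_def\<close>)
  also have "\<dots> = \<ominus> c \<odot>\<^bsub>M\<^esub> lc I a b"
    by (rule lc_smult) (use fI w(1) c bM in \<open>auto simp: Pi_def\<close>)
  finally have 1: "lc I a' (b(j := v)) = \<ominus>\<^bsub>M\<^esub> (c \<odot>\<^bsub>M\<^esub> lc I a b)"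
    using c lc_closed[OF w(1) bM] by (simp add: smult_l_minus)
  have "lc (insert j I) a' (b(j := v)) = c \<odot>\<^bsub>M\<^esub> v \<oplus>\<^bsub>M\<^esub> lc I a' (b(j := v))"
    using lc_insert[OF fI j a' bD(2)] by (simp add: a'_def)
  also have "c \<odot>\<^bsub>M\<^esub> v = c \<odot>\<^bsub>M\<^esub> lc I a b"
    unfolding w(3) using c wM lc_closed[OF w(1) bM]
    by (simp add: smult_r_distr smult_assoc1[symmetric])
  finally have "lc (insert j I) a' (b(j := v)) = \<zero>\<^bsub>M\<^esub>"
    unfolding 1 M.r_neg[OF smult_closed[OF c(1) lc_closed[OF w(1) bM]]] .
  then have "a' j = \<zero>" using bD(3)[OF a'] by blast
  then show False using pi_pow_pred by (simp add: a'_def c_def)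
qed

text \<open>Nakayama: \<open>\<pi>\<close> is nilpotent, so a proper free submodule of \<open>V\<close> does not span \<open>V\<close> modulo \<open>\<pi>\<close>.\<close>

lemma exists_outside_psum:
  assumes V: "V \<in> free_subs n" and b: "indep I b" "b \<in> I \<rightarrow> V" and less: "card I < n"
  shows "\<exists>v\<in>V. v \<notin> psum 1 I b V"
proof (rule ccontr)
  assume "\<not> ?thesis"
  then have all: "v \<in> psum 1 I b V" if "v \<in> V" for v using that by blast
  note bD = indepD[OF b(1)]
  note S = submoduleE[OF submodule_spn[OF bD(1,2)]]
  note Vs = submoduleE[OF free_subs_submodule[OF V]]
  \<comment> \<open>The error term is again in V, so v = x + \<pi> w can be substituted into itself;
    after r rounds the error is 0.\<close>
  have approx: "\<exists>x\<in>spn I b. \<exists>w\<in>V. v = x \<oplus>\<^bsub>M\<^esub> \<pi> [^] k \<odot>\<^bsub>M\<^esub> w" if v: "v \<in> V" for v and k :: nat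
  proof (induction k)
    case 0
    have "\<zero>\<^bsub>M\<^esub> \<in> spn I b"
      using spn_mem[of "\<lambda>_. \<zero>" I b] lc_zero[OF bD(1,2), of "\<lambda>_. \<zero>"] by simp
    moreover have "v \<in> carrier M" using v Vs(1) by blast
    ultimately show ?case using v by (intro bexI[of _ "\<zero>\<^bsub>M\<^esub>"] bexI[of _ v]) auto
  next
    case (Suc k)
    then obtain x w where xw: "x \<in> spn I b" "w \<in> V" "v = x \<oplus>\<^bsub>M\<^esub> \<pi> [^] k \<odot>\<^bsub>M\<^esub> w" by blast
    obtain y z where yz: "y \<in> spn I b" "z \<in> V" "w = y \<oplus>\<^bsub>M\<^esub> \<pi> [^] (1::nat) \<odot>\<^bsub>M\<^esub> z"
      using all[OF xw(2)] unfolding psum_def pmult_def by blast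
    have M: "x \<in> carrier M" "y \<in> carrier M" "z \<in> carrier M" using xw yz S(1) Vs(1) by blast+
    have "v = (x \<oplus>\<^bsub>M\<^esub> \<pi> [^] k \<odot>\<^bsub>M\<^esub> y) \<oplus>\<^bsub>M\<^esub> \<pi> [^] Suc k \<odot>\<^bsub>M\<^esub> z"
      unfolding xw(3) yz(3) using M by (simp add: smult_r_distr smult_assoc1 M.a_assoc)
    moreover have "x \<oplus>\<^bsub>M\<^esub> \<pi> [^] k \<odot>\<^bsub>M\<^esub> y \<in> spn I b" using S(4,5) xw yz by auto
    ultimately show ?case using yz by blast
  qed
  have "v \<in> spn I b" if v: "v \<in> V" for v
  proof -
    from approx[OF v, of r] obtain x w where
      xw: "x \<in> spn I b" "w \<in> V" "v = x \<oplus>\<^bsub>M\<^esub> \<pi> [^] r \<odot>\<^bsub>M\<^esub> w" by blast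
    then have "x \<in> carrier M" "w \<in> carrier M" using S(1) Vs(1) by blast+
    then have "v = x" using xw by (simp add: pi_pow_r)
    then show ?thesis using xw by simp
  qed
  then have "card V \<le> card (spn I b)"
    using finite_free_subs[OF free_subsI[OF b(1) refl]] by (intro card_mono) auto
  then show False
    using card_free_subs[OF V] card_spn[OF b(1)] less card_carrier_gt_1
    by (metis leD power_strict_increasing)
qed

lemma spn_eq_free_sub:
  assumes V: "V \<in> free_subs n" and b: "indep I b" "b \<in> I \<rightarrow> V" and c: "card I = n"
  shows "spn I b = V"
proof (rule card_subset_eq[OF finite_free_subs[OF V]])
  show "spn I b \<subseteq> V" by (rule spn_subset[OF free_subs_submodule[OF V] indepD(1)[OF b(1)] b(2)])
  show "card (spn I b) = card V" using card_free_subs[OF V] card_spn[OF b(1)] c by simp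
qed

text \<open>Vectors outside <b> + \<pi> V are adjoined until the prescribed index set is exhausted;
  a full independent family spans by cardinality. With V the whole module, every free submodule is
  spanned by part of a basis.\<close>

lemma extend_to_basis:
  assumes V: "V \<in> free_subs n" and b: "indep I b" "b \<in> I \<rightarrow> V"
    and J: "finite J" "I \<subseteq> J" "card J = n"
  obtains b' where "\<And>i. i \<in> I \<Longrightarrow> b' i = b i" "indep J b'" "b' \<in> J \<rightarrow> V" "spn J b' = V"
proof -
  have "\<exists>b'. (\<forall>i\<in>I. b' i = b i) \<and> indep J b' \<and> b' \<in> J \<rightarrow> V"
    using b J(2)
  proof (induction "card (J - I)" arbitrary: I b)
    case 0
    then have "I = J" using J(1) by auto
    then show ?case using 0 by blast
  next
    case (Suc m)
    then obtain j where j: "j \<in> J" "j \<notin> I" by (metis card_eq_0_iff Diff_eq_empty_iff nat.distinct(1) subsetI)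
    have "card I < n"
      using psubset_card_mono[OF J(1), of I] j Suc(5) J(3) by blast
    then obtain v where v: "v \<in> V" "v \<notin> psum 1 I b V"
      using exists_outside_psum[OF V Suc(3,4)] by blast
    have "m = card (J - insert j I)"
    proof -
      have "J - insert j I = (J - I) - {j}" by auto
      then show ?thesis using Suc(2) j J(1) by (simp add: card_Diff_singleton)
    qed
    moreover have "b(j := v) \<in> insert j I \<rightarrow> V" using Suc(4) v by auto
    ultimately obtain b' where b': "\<forall>i\<in>insert j I. b' i = (b(j := v)) i" "indep J b'" "b' \<in> J \<rightarrow> V"
      using Suc(1)[of "insert j I" "b(j := v)"] indep_insert[OF V Suc(3,4) v(1) j(2) v(2)] j Suc(5)
      by blast
    then have "\<forall>i\<in>I. b' i = b i" using j by auto
    then show ?case using b' by blast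
  qed
  then show thesis using that spn_eq_free_sub[OF V _ _ J(3)] by blast
qed

lemma free_subs_basis:
  assumes V: "V \<in> free_subs n" and J: "finite J" "card J = n"
  obtains b where "indep J b" "b \<in> J \<rightarrow> V" "spn J b = V"
proof -
  have "indep {} (\<lambda>_. undefined)" by (simp add: indep_def)
  then show thesis using extend_to_basis[OF V _ _ J(1) _ J(2), of "{}"] that by blast
qed

end

section \<open>Counting free submodules\<close>

text \<open>The counts below are functions of the residue field size \<open>q\<close>, the length \<open>r\<close> and the ranks
  only, so that they agree for any two chain rings with the same \<open>q\<close> and \<open>r\<close>.\<close>

definition psum_count :: "nat \<Rightarrow> nat \<Rightarrow> nat \<Rightarrow> nat \<Rightarrow> nat \<Rightarrow> nat" where
  "psum_count q r k m n = q ^ (r * m) * q ^ ((r - k) * (n - m))"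

text \<open>The number of independent k-tuples in a free module of rank n: after i vectors b the
  next one has to avoid <b> + \<pi> V.\<close>

definition tuple_count :: "nat \<Rightarrow> nat \<Rightarrow> nat \<Rightarrow> nat \<Rightarrow> nat" where
  "tuple_count q r k n = (\<Prod>i<k. q ^ (r * n) - psum_count q r 1 i n)"

text \<open>Independent k-tuples, divided by the number of those that span a given submodule;
  \<open>card_free_subs_below\<close> shows that the quotient is exact.\<close>

definition sub_count :: "nat \<Rightarrow> nat \<Rightarrow> nat \<Rightarrow> nat \<Rightarrow> nat" where
  "sub_count q r k n = tuple_count q r k n div tuple_count q r k k"

text \<open>Incidences counted from both sides: all points lie on equally many submodules of rank n,
  and each of these contains \<open>sub_count q r 1 n\<close> points.\<close>

definition point_degree :: "nat \<Rightarrow> nat \<Rightarrow> nat \<Rightarrow> nat \<Rightarrow> nat" where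
  "point_degree q r d n = (sub_count q r n d * sub_count q r 1 n) div sub_count q r 1 d"

text \<open>The division comes from counting the pairs \<open>(z, V)\<close> with \<open>x, z \<in> V\<close> and \<open>z\<close> in
  \<open>\<langle>x\<rangle> + \<pi>\<^sup>k M\<close> but not in \<open>\<langle>x\<rangle> + \<pi>\<^sup>k\<^sup>+\<^sup>1 M\<close>.\<close>

definition pair_count :: "nat \<Rightarrow> nat \<Rightarrow> nat \<Rightarrow> nat \<Rightarrow> nat \<Rightarrow> nat" where
  "pair_count q r d n k =
    (if k = r then point_degree q r d n
     else point_degree q r d n * (psum_count q r k 1 n - psum_count q r (Suc k) 1 n)
       div (psum_count q r k 1 d - psum_count q r (Suc k) 1 d))"

text \<open>The exponent r m + (r - 1) (n - m) falls short of r n by n - m. This keeps the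
  natural-number differences in \<open>tuple_count\<close> positive.\<close>

lemma psum_count_less:
  assumes "2 \<le> q" "0 < r" "m < n"
  shows "psum_count q r 1 m n < q ^ (r * n)"
proof -
  have "r * n = r * m + r * (n - m)"
    using assms(3) by (simp add: distrib_left[symmetric])
  moreover have "r * m + (r - 1) * (n - m) < r * m + r * (n - m)" using assms by simp
  ultimately show ?thesis
    unfolding psum_count_def power_add[symmetric] using assms(1)
    by (metis power_strict_increasing_iff Suc_1 Suc_le_lessD)
qed

lemma tuple_count_pos: "2 \<le> q \<Longrightarrow> 0 < r \<Longrightarrow> k \<le> n \<Longrightarrow> 0 < tuple_count q r k n"
  unfolding tuple_count_def using psum_count_less by (intro prod_pos) auto

text \<open>The exponent (r - k) (n - 1) drops strictly with k; this makes the divisor in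
  \<open>pair_count\<close> positive.\<close>

lemma psum_count_Suc_less:
  assumes "2 \<le> q" "k < r" "2 \<le> n"
  shows "psum_count q r (Suc k) 1 n < psum_count q r k 1 n"
proof -
  have "(r - Suc k) * (n - 1) < (r - k) * (n - 1)" using assms by simp
  then have "q ^ ((r - Suc k) * (n - 1)) < q ^ ((r - k) * (n - 1))"
    using assms(1) by (intro power_strict_increasing) auto
  then show ?thesis unfolding psum_count_def using assms(1) by simp
qed

context chain_module
begin

section \<open>Sizes of the sums <b> + \<pi>^k V, and the numbers of tuples and of
  submodules\<close>

lemma psumI: "x \<in> spn I b \<Longrightarrow> y \<in> pmult k V \<Longrightarrow> x \<oplus>\<^bsub>M\<^esub> y \<in> psum k I b V"
  unfolding psum_def by blast

lemma psumE:
  assumes "z \<in> psum k I b V"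
  obtains x y where "x \<in> spn I b" "y \<in> pmult k V" "z = x \<oplus>\<^bsub>M\<^esub> y"
  using assms unfolding psum_def by blast

text \<open>In a basis of V that contains the family on I, both summands are boxes, and the
  coordinates in I absorb the multiples of \<pi>^k.\<close>

lemma psum_eq_box:
  assumes V: "V \<in> free_subs n" and J: "I \<subseteq> J" "indep J b" "b \<in> J \<rightarrow> V" "spn J b = V"
  shows "psum k I b V = box J (\<lambda>i. if i \<in> I then carrier R else pideal k) b"
proof -
  note bD = indepD[OF J(2)]
  have I: "finite I" "b \<in> I \<rightarrow> carrier M" using bD J(1) finite_subset by (auto simp: Pi_def)
  have pV: "pmult k V = box J (\<lambda>_. pideal k) b"
    using pmult_spn[OF bD(1,2)] J(4) by simp
  show ?thesis
  proof (intro equalityI subsetI)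
    fix z assume "z \<in> psum k I b V"
    then obtain a a' where a: "a \<in> I \<rightarrow> carrier R" "a' \<in> J \<rightarrow> pideal k" "z = lc I a b \<oplus>\<^bsub>M\<^esub> lc J a' b"
      unfolding psum_def pV by (auto simp: box_def elim!: spnE)
    define a1 where "a1 i = (if i \<in> I then a i else \<zero>)" for i
    have a1: "a1 \<in> J \<rightarrow> carrier R" using a(1) by (auto simp: a1_def)
    have a'c: "a' \<in> J \<rightarrow> carrier R" using a(2) pideal_closed by blast
    have "lc J a1 b = lc I a1 b"
      by (rule lc_neutral) (use bD J a1 in \<open>auto simp: a1_def\<close>)
    also have "\<dots> = lc I a b" by (rule lc_cong) (use a I in \<open>auto simp: a1_def\<close>)
    finally have "z = lc J (\<lambda>i. a1 i \<oplus> a' i) b"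
      using a(3) lc_add[OF a1 a'c bD(2)] by simp
    moreover have "(\<lambda>i. a1 i \<oplus> a' i) \<in> (\<Pi> i\<in>J. if i \<in> I then carrier R else pideal k)"
      using a(1,2) a'c pideal_closed by (auto simp: a1_def Pi_def)
    ultimately show "z \<in> box J (\<lambda>i. if i \<in> I then carrier R else pideal k) b"
      by (auto simp: box_def)
  next
    fix z assume "z \<in> box J (\<lambda>i. if i \<in> I then carrier R else pideal k) b"
    then obtain a where a: "a \<in> (\<Pi> i\<in>J. if i \<in> I then carrier R else pideal k)" "z = lc J a b"
      by (auto simp: box_def)
    have aI: "a i \<in> carrier R" if "i \<in> I" for i
      using a(1) that J(1) Pi_mem[OF a(1), of i] by auto
    have aJ: "a i \<in> pideal k" if "i \<in> J" "i \<notin> I" for i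
      using Pi_mem[OF a(1), of i] that by auto
    have ac: "a \<in> J \<rightarrow> carrier R" using aI aJ pideal_closed by blast
    define a1 where "a1 i = (if i \<in> I then a i else \<zero>)" for i
    define a2 where "a2 i = (if i \<in> I then \<zero> else a i)" for i
    have a12: "a1 \<in> J \<rightarrow> carrier R" "a2 \<in> J \<rightarrow> carrier R" using ac by (auto simp: a1_def a2_def)
    have "lc J a b = lc J (\<lambda>i. a1 i \<oplus> a2 i) b"
      by (rule lc_cong) (use ac a12 bD in \<open>auto simp: a1_def a2_def Pi_def\<close>)
    then have "z = lc J a1 b \<oplus>\<^bsub>M\<^esub> lc J a2 b" using a(2) lc_add[OF a12 bD(2)] by simp
    moreover have "lc J a1 b = lc I a1 b"
      by (rule lc_neutral) (use bD J a12 in \<open>auto simp: a1_def\<close>)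
    moreover have "lc I a1 b \<in> spn I b" by (rule spn_mem) (use aI in \<open>auto simp: a1_def\<close>)
    moreover have "lc J a2 b \<in> pmult k V"
      unfolding pV box_def using aJ by (auto simp: a2_def)
    ultimately show "z \<in> psum k I b V" by (simp add: psumI)
  qed
qed

lemma psum_cong:
  assumes "\<And>i. i \<in> I \<Longrightarrow> b' i = b i" "b \<in> I \<rightarrow> carrier M"
  shows "psum k I b' V = psum k I b V"
proof -
  have "lc I a b' = lc I a b" if "a \<in> I \<rightarrow> carrier R" for a
    by (rule lc_cong) (use assms that in auto)
  then have "spn I b' = spn I b" unfolding spn_def box_def by (intro image_cong) auto
  then show ?thesis by (simp add: psum_def)
qed

text \<open>After extension to a basis of V, m coordinates are free and the remaining n - m range
  over \<open>pideal k\<close>.\<close>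

lemma card_psum:
  assumes V: "V \<in> free_subs n" and b: "indep {..<m} b" "b \<in> {..<m} \<rightarrow> V" and m: "m \<le> n"
  shows "card (psum k {..<m} b V) = psum_count (card T) r k m n"
proof -
  obtain b' where b': "\<And>i. i \<in> {..<m} \<Longrightarrow> b' i = b i" "indep {..<n} b'" "b' \<in> {..<n} \<rightarrow> V" "spn {..<n} b' = V"
    using extend_to_basis[OF V b, of "{..<n}"] m by auto
  have "psum k {..<m} b V = psum k {..<m} b' V"
    using psum_cong[of "{..<m}" b' b] b'(1) indepD(2)[OF b(1)] by auto
  also have "\<dots> = box {..<n} (\<lambda>i. if i \<in> {..<m} then carrier R else pideal k) b'"
    by (rule psum_eq_box[OF V _ b'(2-4)]) (use m in auto)
  also have "card \<dots> = (\<Prod>i<n. card (if i \<in> {..<m} then carrier R else pideal k))"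
    by (rule card_box[OF b'(2)]) (auto intro: pideal_closed)
  also have "\<dots> = (\<Prod>i\<in>{..<m} \<union> {m..<n}. if i < m then card (carrier R) else card (pideal k))"
    using m by (intro prod.cong) auto
  also have "\<dots> = (\<Prod>i<m. card (carrier R)) * (\<Prod>i\<in>{m..<n}. card (pideal k))"
    by (subst prod.union_disjoint) auto
  also have "\<dots> = psum_count (card T) r k m n"
    using card_pideal[of k] by (simp add: card_carrier psum_count_def power_mult)
  finally show ?thesis .
qed

lemma psum_subset:
  assumes V: "V \<in> free_subs n" and b: "indep I b" "b \<in> I \<rightarrow> V"
  shows "psum k I b V \<subseteq> V"
  using spn_subset[OF free_subs_submodule[OF V] indepD(1)[OF b(1)] b(2)] pmult_subset[OF V]
    submoduleE(5)[OF free_subs_submodule[OF V]] unfolding psum_def by blast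

definition tuples :: "nat \<Rightarrow> 'c set \<Rightarrow> (nat \<Rightarrow> 'c) set" where
  "tuples k V = {b \<in> {..<k} \<rightarrow>\<^sub>E V. indep {..<k} b}"

lemma finite_tuples: "V \<in> free_subs n \<Longrightarrow> finite (tuples k V)"
  unfolding tuples_def
  by (rule finite_subset[of _ "{..<k} \<rightarrow>\<^sub>E V"]) (auto intro: finite_PiE finite_free_subs)

text \<open>Removing the last vector fibres the tuples of length k + 1 over those of length k. By
  \<open>indep_insert\<close> and \<open>indep_insertD\<close> the fibre over b is the complement of
  <b> + \<pi> V in V, whose size does not depend on b.\<close>

lemma card_tuples:
  assumes V: "V \<in> free_subs n"
  shows "k \<le> n \<Longrightarrow> card (tuples k V) = tuple_count (card T) r k n"
proof (induction k)
  case 0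
  have "tuples 0 V = {\<lambda>_. undefined}" by (auto simp: tuples_def indep_def)
  then show ?case by (simp add: tuple_count_def)
next
  case (Suc k)
  define S where "S = Sigma (tuples k V) (\<lambda>b. V - psum 1 {..<k} b V)"
  define f where "f = (\<lambda>(b, v). b(k := v :: 'c))"
  have Vc: "V \<subseteq> carrier M" using free_subs_carrier[OF V] .
  have ins: "insert k {..<k} = {..<Suc k}" by auto
  have "bij_betw f S (tuples (Suc k) V)"
  proof (rule bij_betwI[where g = "\<lambda>b. (restrict b {..<k}, b k)"])
    show "f \<in> S \<rightarrow> tuples (Suc k) V"
    proof
      fix p assume "p \<in> S"
      then obtain b v where p: "p = (b, v)" "b \<in> {..<k} \<rightarrow>\<^sub>E V" "indep {..<k} b" "v \<in> V" "v \<notin> psum 1 {..<k} b V"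
        by (auto simp: S_def tuples_def)
      have "b \<in> {..<k} \<rightarrow> V" using p(2) by auto
      then have "indep {..<Suc k} (b(k := v))"
        using indep_insert[OF V p(3) _ p(4) _ p(5), of k] ins by simp
      moreover have "b(k := v) \<in> {..<Suc k} \<rightarrow>\<^sub>E V"
        using p(2,4) by (auto simp: PiE_iff extensional_def less_Suc_eq)
      ultimately show "f p \<in> tuples (Suc k) V" using p(1) by (simp add: f_def tuples_def)
    qed
    show "(\<lambda>b. (restrict b {..<k}, b k)) \<in> tuples (Suc k) V \<rightarrow> S"
    proof
      fix b assume "b \<in> tuples (Suc k) V"
      then have b: "b \<in> {..<Suc k} \<rightarrow>\<^sub>E V" "indep {..<Suc k} b" by (auto simp: tuples_def)
      define b0 where "b0 = restrict b {..<k}"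
      have i0: "indep {..<k} b0"
        by (rule indep_cong[OF indep_subset[OF b(2)]]) (auto simp: b0_def)
      have "indep (insert k {..<k}) (b0(k := b k))"
        unfolding ins by (rule indep_cong[OF b(2)]) (auto simp: b0_def)
      then have "b k \<notin> psum 1 {..<k} b0 V" by (rule indep_insertD[OF Vc]) auto
      moreover have bV: "b i \<in> V" if "i < Suc k" for i using PiE_mem[OF b(1)] that by simp
      have "b0 \<in> {..<k} \<rightarrow>\<^sub>E V" "b k \<in> V"
        unfolding b0_def using bV by (simp_all add: restrict_PiE_iff)
      ultimately show "(restrict b {..<k}, b k) \<in> S"
        using i0 unfolding b0_def[symmetric] by (simp add: S_def tuples_def)
    qed
    show "(restrict (f p) {..<k}, f p k) = p" if "p \<in> S" for p
      using that by (auto simp: f_def S_def tuples_def PiE_iff extensional_def restrict_def fun_eq_iff)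
    show "f (restrict b {..<k}, b k) = b" if "b \<in> tuples (Suc k) V" for b
      using that by (auto simp: f_def tuples_def PiE_iff extensional_def restrict_def fun_eq_iff less_Suc_eq)
  qed
  then have "card (tuples (Suc k) V) = card S" by (simp add: bij_betw_same_card)
  also have "\<dots> = (\<Sum>b\<in>tuples k V. card (V - psum 1 {..<k} b V))"
    unfolding S_def using finite_tuples[OF V] finite_free_subs[OF V] by (intro card_SigmaI) auto
  also have "\<dots> = (\<Sum>b\<in>tuples k V. card T ^ (r * n) - psum_count (card T) r 1 k n)"
  proof (rule sum.cong)
    fix b assume "b \<in> tuples k V"
    then have b: "indep {..<k} b" "b \<in> {..<k} \<rightarrow> V" by (auto simp: tuples_def)
    have sub: "psum 1 {..<k} b V \<subseteq> V" by (rule psum_subset[OF V b])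
    have "card (V - psum 1 {..<k} b V) = card V - card (psum 1 {..<k} b V)"
      using sub finite_free_subs[OF V] by (intro card_Diff_subset) (auto intro: finite_subset)
    then show "card (V - psum 1 {..<k} b V) = card T ^ (r * n) - psum_count (card T) r 1 k n"
      using card_psum[OF V b] Suc(2) card_free_subs[OF V] by (simp add: card_carrier power_mult)
  qed simp
  also have "\<dots> = tuple_count (card T) r (Suc k) n"
    using Suc by (simp add: tuple_count_def)
  finally show ?case .
qed

text \<open>An independent k-tuple lies in exactly one free submodule of rank k, its span, so the
  tuples in V are partitioned into classes of equal size.\<close>

lemma card_free_subs_below:
  assumes V: "V \<in> free_subs n" and k: "k \<le> n"
  shows "finite {W \<in> free_subs k. W \<subseteq> V}" "card {W \<in> free_subs k. W \<subseteq> V} = sub_count (card T) r k n"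
proof -
  define A where "A = {W \<in> free_subs k. W \<subseteq> V}"
  show fin: "finite {W \<in> free_subs k. W \<subseteq> V}"
    by (rule finite_subset[of _ "Pow V"]) (auto simp: finite_free_subs[OF V])
  have un: "tuples k V = (\<Union>W\<in>A. tuples k W)"
  proof (intro equalityI subsetI)
    fix b assume "b \<in> tuples k V"
    then have b: "b \<in> {..<k} \<rightarrow>\<^sub>E V" "indep {..<k} b" by (auto simp: tuples_def)
    note bD = indepD[OF b(2)]
    have "spn {..<k} b \<subseteq> V" by (rule spn_subset[OF free_subs_submodule[OF V]]) (use b in auto)
    then have "spn {..<k} b \<in> A" using free_subsI[OF b(2)] by (auto simp: A_def)
    moreover have "b \<in> tuples k (spn {..<k} b)"
      using b basis_mem_spn[OF bD(1,2)] by (auto simp: tuples_def PiE_iff)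
    ultimately show "b \<in> (\<Union>W\<in>A. tuples k W)" by blast
  next
    fix b assume "b \<in> (\<Union>W\<in>A. tuples k W)"
    then show "b \<in> tuples k V" by (auto simp: A_def tuples_def PiE_iff)
  qed
  have "card (tuples k V) = (\<Sum>W\<in>A. card (tuples k W))"
    unfolding un
  proof (rule card_UN_disjoint)
    show "finite A" using fin by (simp add: A_def)
    show "\<forall>W\<in>A. finite (tuples k W)" using finite_tuples by (auto simp: A_def)
    have eq: "spn {..<k} b = W" if "W \<in> A" "b \<in> tuples k W" for W b
      using that by (intro spn_eq_free_sub[of W k]) (auto simp: A_def tuples_def)
    show "\<forall>W\<in>A. \<forall>W'\<in>A. W \<noteq> W' \<longrightarrow> tuples k W \<inter> tuples k W' = {}"
      using eq by blast
  qed
  also have "\<dots> = (\<Sum>W\<in>A. tuple_count (card T) r k k)"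
    by (rule sum.cong) (auto simp: A_def card_tuples)
  finally have "card A * tuple_count (card T) r k k = tuple_count (card T) r k n"
    using card_tuples[OF V k] by simp
  then show "card {W \<in> free_subs k. W \<subseteq> V} = sub_count (card T) r k n"
    using tuple_count_pos[OF card_T r_pos, of k k] unfolding sub_count_def A_def[symmetric]
    by (metis div_mult_self_is_m le_refl)
qed

end

locale free_chain_module = chain_module R T \<pi> r M
  for R (structure) and T \<pi> r and M (structure) + fixes d :: nat
  assumes carrier_free: "carrier M \<in> free_subs d"
begin

section \<open>The free ambient module and its automorphisms\<close>

lemma finite_free_subs_set: "finite (free_subs k)"
  by (rule finite_subset[of _ "Pow (carrier M)"])
    (auto dest: free_subs_carrier simp: finite_free_subs[OF carrier_free])

lemma card_free_subs_set:
  assumes "k \<le> d" shows "card (free_subs k) = sub_count (card T) r k d"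
proof -
  have "{W \<in> free_subs k. W \<subseteq> carrier M} = free_subs k" using free_subs_carrier by blast
  then show ?thesis using card_free_subs_below(2)[OF carrier_free assms] by simp
qed

lemma coordinates:
  assumes "indep J b" "card J = d" "x \<in> carrier M"
  obtains a where "a \<in> J \<rightarrow> carrier R" "x = lc J a b"
proof -
  have "spn J b = carrier M"
    by (rule spn_eq_free_sub[OF carrier_free assms(1) _ assms(2)]) (use indepD(2)[OF assms(1)] in auto)
  then show thesis using spnE[of x J b] assms(3) that by blast
qed

definition linear_auto :: "('c \<Rightarrow> 'c) \<Rightarrow> bool" where
  "linear_auto g \<longleftrightarrow> bij_betw g (carrier M) (carrier M) \<and>
    (\<forall>I a b. finite I \<longrightarrow> a \<in> I \<rightarrow> carrier R \<longrightarrow> b \<in> I \<rightarrow> carrier M \<longrightarrow> g (lc I a b) = lc I a (\<lambda>i. g (b i)))"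

text \<open>The vector with coordinates a in one basis goes to the vector with coordinates a in the
  other. The resulting transitivity on bases is the source of the symmetry arguments below.\<close>

lemma linear_auto_between_bases:
  assumes b: "indep J b" and b': "indep J b'" and J: "card J = d"
  obtains g where "linear_auto g" "\<And>i. i \<in> J \<Longrightarrow> g (b i) = b' i"
proof -
  note bD = indepD[OF b] and bD' = indepD[OF b']
  define co where "co x = (SOME a. a \<in> J \<rightarrow> carrier R \<and> x = lc J a b)" for x
  define g where "g x = lc J (co x) b'" for x
  have co: "co x \<in> J \<rightarrow> carrier R" "x = lc J (co x) b" if "x \<in> carrier M" for x
  proof -
    have "\<exists>a. a \<in> J \<rightarrow> carrier R \<and> x = lc J a b" using coordinates[OF b J that] by metis
    from someI_ex[OF this] show "co x \<in> J \<rightarrow> carrier R" "x = lc J (co x) b"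
      unfolding co_def by blast+
  qed
  have g_lc: "g (lc J a b) = lc J a b'" if a: "a \<in> J \<rightarrow> carrier R" for a
  proof -
    have x: "lc J a b \<in> carrier M" using a bD by simp
    show ?thesis
      unfolding g_def
      by (rule lc_cong) (use indep_unique[OF b co(1)[OF x] a] co(2)[OF x] a bD' in auto)
  qed
  have g_closed: "g x \<in> carrier M" if "x \<in> carrier M" for x
    unfolding g_def using co(1)[OF that] bD'(2) by simp
  have g_add: "g (x \<oplus>\<^bsub>M\<^esub> y) = g x \<oplus>\<^bsub>M\<^esub> g y" if "x \<in> carrier M" "y \<in> carrier M" for x y
  proof -
    note cx = co[OF that(1)] and cy = co[OF that(2)]
    have c: "(\<lambda>i. co x i \<oplus> co y i) \<in> J \<rightarrow> carrier R" using cx(1) cy(1) by (auto simp: Pi_def)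
    have "x \<oplus>\<^bsub>M\<^esub> y = lc J (\<lambda>i. co x i \<oplus> co y i) b"
      using cx cy lc_add[OF cx(1) cy(1) bD(2)] by simp
    then have "g (x \<oplus>\<^bsub>M\<^esub> y) = lc J (\<lambda>i. co x i \<oplus> co y i) b'" using g_lc[OF c] by simp
    then show ?thesis using lc_add[OF cx(1) cy(1) bD'(2)] by (simp add: g_def)
  qed
  have g_smult: "g (c \<odot>\<^bsub>M\<^esub> x) = c \<odot>\<^bsub>M\<^esub> g x" if "c \<in> carrier R" "x \<in> carrier M" for c x
  proof -
    note cx = co[OF that(2)]
    have c: "(\<lambda>i. c \<otimes> co x i) \<in> J \<rightarrow> carrier R" using cx(1) that(1) by (auto simp: Pi_def)
    have "c \<odot>\<^bsub>M\<^esub> x = lc J (\<lambda>i. c \<otimes> co x i) b"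
      using cx lc_smult[OF bD(1) that(1) cx(1) bD(2)] by simp
    then have "g (c \<odot>\<^bsub>M\<^esub> x) = lc J (\<lambda>i. c \<otimes> co x i) b'" using g_lc[OF c] by simp
    then show ?thesis using lc_smult[OF bD'(1) that(1) cx(1) bD'(2)] by (simp add: g_def)
  qed
  have inj: "inj_on g (carrier M)"
  proof (rule inj_onI)
    fix x y assume xy: "x \<in> carrier M" "y \<in> carrier M" "g x = g y"
    have "lc J (co x) b = lc J (co y) b"
      by (rule lc_cong)
        (use indep_unique[OF b' co(1)[OF xy(1)] co(1)[OF xy(2)]] xy(3) co(1)[OF xy(2)] bD in \<open>auto simp: g_def\<close>)
    then show "x = y" using co(2)[OF xy(1)] co(2)[OF xy(2)] by simp
  qed
  have bij: "bij_betw g (carrier M) (carrier M)"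
    using inj endo_inj_surj[OF finite_free_subs[OF carrier_free] _ inj] g_closed
    by (intro bij_betw_imageI) auto
  have lin: "g (lc I a w) = lc I a (\<lambda>i. g (w i))"
    if "finite I" "a \<in> I \<rightarrow> carrier R" "w \<in> I \<rightarrow> carrier M" for I a w
    using that
  proof (induction I rule: finite_induct)
    case empty
    have "g \<zero>\<^bsub>M\<^esub> = g (\<zero> \<odot>\<^bsub>M\<^esub> \<zero>\<^bsub>M\<^esub>)" by simp
    also have "\<dots> = \<zero>\<^bsub>M\<^esub>" using g_smult[of \<zero> "\<zero>\<^bsub>M\<^esub>"] g_closed[of "\<zero>\<^bsub>M\<^esub>"] by simp
    finally show ?case by simp
  next
    case (insert j I)
    have 1: "lc (insert j I) a w = a j \<odot>\<^bsub>M\<^esub> w j \<oplus>\<^bsub>M\<^esub> lc I a w"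
      by (rule lc_insert) (use insert in auto)
    have 2: "lc (insert j I) a (\<lambda>i. g (w i)) = a j \<odot>\<^bsub>M\<^esub> g (w j) \<oplus>\<^bsub>M\<^esub> lc I a (\<lambda>i. g (w i))"
      by (rule lc_insert) (use insert g_closed in \<open>auto simp: Pi_def\<close>)
    have "a \<in> I \<rightarrow> carrier R" "w \<in> I \<rightarrow> carrier M" "a j \<in> carrier R" "w j \<in> carrier M"
      using insert by auto
    then show ?case unfolding 1 2 using insert(3) by (simp add: g_add g_smult)
  qed
  have "g (b i) = b' i" if i: "i \<in> J" for i
  proof -
    have a: "(\<lambda>j. if j = i then \<one> else \<zero>) \<in> J \<rightarrow> carrier R" by auto
    have "b i \<in> carrier M" "b' i \<in> carrier M" using bD(2) bD'(2) i by auto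
    then show ?thesis
      using g_lc[OF a] lc_single[OF bD(1) i _ bD(2), of \<one>] lc_single[OF bD'(1) i _ bD'(2), of \<one>] by simp
  qed
  then show thesis using that bij lin unfolding linear_auto_def by blast
qed

lemma linear_auto_free_sub:
  assumes g: "linear_auto g" and V: "V \<in> free_subs n"
  shows "g ` V \<in> free_subs n"
proof -
  obtain I b where b: "indep I b" "card I = n" "V = spn I b" using V by (elim free_subsE)
  note bD = indepD[OF b(1)]
  have lin: "g (lc I a b) = lc I a (\<lambda>i. g (b i))" if "a \<in> I \<rightarrow> carrier R" for a
    using g bD that unfolding linear_auto_def by blast
  have inj: "inj_on g (carrier M)" using g by (simp add: linear_auto_def bij_betw_def)
  have gb: "(\<lambda>i. g (b i)) \<in> I \<rightarrow> carrier M"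
    using g bD(2) unfolding linear_auto_def by (auto simp: Pi_def intro: bij_betw_apply)
  have g0: "g \<zero>\<^bsub>M\<^esub> = \<zero>\<^bsub>M\<^esub>"
    using lin[of "\<lambda>_. \<zero>"] lc_zero[OF bD(1,2)] lc_zero[OF bD(1) gb] by simp
  have "indep I (\<lambda>i. g (b i))"
    unfolding indep_def
  proof (intro conjI ballI impI)
    fix a i assume a: "a \<in> I \<rightarrow> carrier R" "lc I a (\<lambda>i. g (b i)) = \<zero>\<^bsub>M\<^esub>" "i \<in> I"
    have "g (lc I a b) = g \<zero>\<^bsub>M\<^esub>" using lin[OF a(1)] a(2) g0 by simp
    then have "lc I a b = \<zero>\<^bsub>M\<^esub>" using inj lc_closed[OF a(1) bD(2)] by (auto dest: inj_onD)
    then show "a i = \<zero>" using bD(3) a by blast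
  qed (use bD gb in auto)
  moreover have "g ` V = spn I (\<lambda>i. g (b i))"
    unfolding b(3) spn_def box_def image_image by (rule image_cong) (auto simp: lin)
  ultimately show ?thesis using free_subsI b(2) by simp
qed

end

section \<open>Submodules through two points\<close>

context chain_module
begin

text \<open>The family consisting of x alone is independent; in coordinates, x has a unit entry
  (\<open>unimod_iff\<close>). These vectors are the generators of points.\<close>

definition unimod :: "'c \<Rightarrow> bool" where
  "unimod x \<longleftrightarrow> x \<in> carrier M \<and> (\<forall>c\<in>carrier R. c \<odot>\<^bsub>M\<^esub> x = \<zero>\<^bsub>M\<^esub> \<longrightarrow> c = \<zero>)"

definition indep2 :: "'c \<Rightarrow> 'c \<Rightarrow> bool" where
  "indep2 x y \<longleftrightarrow> x \<in> carrier M \<and> y \<in> carrier M \<and>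
    (\<forall>a\<in>carrier R. \<forall>c\<in>carrier R. a \<odot>\<^bsub>M\<^esub> x \<oplus>\<^bsub>M\<^esub> c \<odot>\<^bsub>M\<^esub> y = \<zero>\<^bsub>M\<^esub> \<longrightarrow> a = \<zero> \<and> c = \<zero>)"

definition line :: "'c \<Rightarrow> 'c set" where
  "line x = (\<lambda>c. c \<odot>\<^bsub>M\<^esub> x) ` carrier R"

lemma unimodD:
  assumes "unimod x" shows "x \<in> carrier M" "\<lbrakk>c \<in> carrier R; c \<odot>\<^bsub>M\<^esub> x = \<zero>\<^bsub>M\<^esub>\<rbrakk> \<Longrightarrow> c = \<zero>"
  using assms unfolding unimod_def by blast+

lemma indep2D:
  assumes "indep2 x y" shows "x \<in> carrier M" "y \<in> carrier M"
    "\<lbrakk>a \<in> carrier R; c \<in> carrier R; a \<odot>\<^bsub>M\<^esub> x \<oplus>\<^bsub>M\<^esub> c \<odot>\<^bsub>M\<^esub> y = \<zero>\<^bsub>M\<^esub>\<rbrakk> \<Longrightarrow> a = \<zero>"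
    "\<lbrakk>a \<in> carrier R; c \<in> carrier R; a \<odot>\<^bsub>M\<^esub> x \<oplus>\<^bsub>M\<^esub> c \<odot>\<^bsub>M\<^esub> y = \<zero>\<^bsub>M\<^esub>\<rbrakk> \<Longrightarrow> c = \<zero>"
  using assms unfolding indep2_def by blast+

lemma indep2I:
  assumes "x \<in> carrier M" "y \<in> carrier M"
    "\<And>a c. \<lbrakk>a \<in> carrier R; c \<in> carrier R; a \<odot>\<^bsub>M\<^esub> x \<oplus>\<^bsub>M\<^esub> c \<odot>\<^bsub>M\<^esub> y = \<zero>\<^bsub>M\<^esub>\<rbrakk> \<Longrightarrow> a = \<zero> \<and> c = \<zero>"
  shows "indep2 x y"
  using assms unfolding indep2_def by blast

lemma lc_one:
  assumes "a j \<in> carrier R" "b j \<in> carrier M" shows "lc {j} a b = a j \<odot>\<^bsub>M\<^esub> b j"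
  using lc_insert[of "{}" j a b] assms by simp

lemma lc_two:
  assumes "i \<noteq> j" "a i \<in> carrier R" "a j \<in> carrier R" "b i \<in> carrier M" "b j \<in> carrier M"
  shows "lc {i, j} a b = a i \<odot>\<^bsub>M\<^esub> b i \<oplus>\<^bsub>M\<^esub> a j \<odot>\<^bsub>M\<^esub> b j"
  using lc_insert[of "{j}" i a b] lc_one[of a j b] assms by simp

lemma lc_three:
  assumes "i \<noteq> j" "i \<noteq> k" "j \<noteq> k" "a i \<in> carrier R" "a j \<in> carrier R" "a k \<in> carrier R"
    "b i \<in> carrier M" "b j \<in> carrier M" "b k \<in> carrier M"
  shows "lc {i, j, k} a b = a i \<odot>\<^bsub>M\<^esub> b i \<oplus>\<^bsub>M\<^esub> (a j \<odot>\<^bsub>M\<^esub> b j \<oplus>\<^bsub>M\<^esub> a k \<odot>\<^bsub>M\<^esub> b k)"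
  using lc_insert[of "{j, k}" i a b] lc_two[of j k a b] assms by simp

lemma unimod_iff_indep:
  assumes "b j = x" shows "unimod x \<longleftrightarrow> indep {j} b"
proof
  assume "unimod x"
  then show "indep {j} b"
    unfolding indep_def using assms unimodD lc_one[of _ j b] by auto
next
  assume "indep {j} b"
  note bD = indepD[OF this]
  have x: "x \<in> carrier M" using bD(2) assms by simp
  moreover have "c = \<zero>" if "c \<in> carrier R" "c \<odot>\<^bsub>M\<^esub> x = \<zero>\<^bsub>M\<^esub>" for c
    using bD(3)[of "\<lambda>_. c" j] lc_one[of "\<lambda>_. c" j b] that x assms by simp
  ultimately show "unimod x" by (simp add: unimod_def)
qed

lemma indep2_iff_indep:
  assumes "b i = x" "b j = y" "i \<noteq> j" shows "indep2 x y \<longleftrightarrow> indep {i, j} b"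
proof
  assume "indep2 x y"
  note xy = indep2D[OF this]
  show "indep {i, j} b"
    unfolding indep_def
  proof (intro conjI ballI impI)
    fix a k assume a: "a \<in> {i, j} \<rightarrow> carrier R" "lc {i, j} a b = \<zero>\<^bsub>M\<^esub>" "k \<in> {i, j}"
    then have "a i \<odot>\<^bsub>M\<^esub> x \<oplus>\<^bsub>M\<^esub> a j \<odot>\<^bsub>M\<^esub> y = \<zero>\<^bsub>M\<^esub>"
      using lc_two[of i j a b] assms xy(1,2) by simp
    then have "a i = \<zero>" "a j = \<zero>" using xy(3,4)[of "a i" "a j"] a(1) by auto
    then show "a k = \<zero>" using a(3) by blast
  qed (use xy assms in auto)
next
  assume "indep {i, j} b"
  note bD = indepD[OF this]
  have xy: "x \<in> carrier M" "y \<in> carrier M" using bD(2) assms by auto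
  have "a = \<zero> \<and> c = \<zero>" if "a \<in> carrier R" "c \<in> carrier R" "a \<odot>\<^bsub>M\<^esub> x \<oplus>\<^bsub>M\<^esub> c \<odot>\<^bsub>M\<^esub> y = \<zero>\<^bsub>M\<^esub>" for a c
  proof -
    define f where "f k = (if k = i then a else c)" for k
    have "lc {i, j} f b = \<zero>\<^bsub>M\<^esub>"
      using lc_two[of i j f b] that assms xy by (simp add: f_def)
    moreover have "f \<in> {i, j} \<rightarrow> carrier R" using that by (simp add: f_def)
    ultimately have "f i = \<zero>" "f j = \<zero>" using bD(3)[of f] by blast+
    then show ?thesis using assms(3) by (simp add: f_def)
  qed
  then show "indep2 x y" using xy by (intro indep2I)
qed

lemma indep2_sym: "indep2 x y \<Longrightarrow> indep2 y x"
  unfolding indep2_def by (metis M.a_comm smult_closed)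

lemma indep2_unimod: assumes "indep2 x y" shows "unimod x" "unimod y"
proof -
  have "unimod x" if "indep2 x y" for x y
  proof -
    have i: "indep {0, 1} (\<lambda>i::nat. if i = 0 then x else y)"
      using that indep2_iff_indep[of "\<lambda>i::nat. if i = 0 then x else y" 0 x 1 y] by simp
    show ?thesis
      using indep_subset[OF i, of "{0}"]
        unimod_iff_indep[of "\<lambda>i::nat. if i = 0 then x else y" 0 x] by simp
  qed
  from this[OF assms] this[OF indep2_sym[OF assms]] show "unimod x" "unimod y" .
qed

lemma line_eq_spn:
  assumes "x \<in> carrier M" shows "line x = spn {j} (\<lambda>_. x)"
proof
  show "line x \<subseteq> spn {j} (\<lambda>_. x)"
  proof
    fix y assume "y \<in> line x"
    then obtain c where c: "c \<in> carrier R" "y = c \<odot>\<^bsub>M\<^esub> x" by (auto simp: line_def)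
    then have "y = lc {j} (\<lambda>_. c) (\<lambda>_. x)" using lc_one[of "\<lambda>_. c" j "\<lambda>_. x"] assms by simp
    then show "y \<in> spn {j} (\<lambda>_. x)" using spn_mem[of "\<lambda>_. c" "{j}"] c by simp
  qed
  show "spn {j} (\<lambda>_. x) \<subseteq> line x"
  proof
    fix y assume "y \<in> spn {j} (\<lambda>_. x)"
    then obtain a where "a \<in> {j} \<rightarrow> carrier R" "y = lc {j} a (\<lambda>_. x)" by (elim spnE)
    then show "y \<in> line x" using lc_one[of a j "\<lambda>_. x"] assms by (auto simp: line_def)
  qed
qed

lemma line_free_sub: "unimod x \<Longrightarrow> line x \<in> free_subs 1"
  using line_eq_spn[of x 0] unimodD(1) unimod_iff_indep[of "\<lambda>_. x" 0 x]
    free_subsI[of "{0}" "\<lambda>_. x" 1] by simp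

lemma points_eq: "free_subs 1 = line ` Collect unimod"
proof
  show "free_subs 1 \<subseteq> line ` Collect unimod"
  proof
    fix L assume "L \<in> free_subs 1"
    then obtain b where b: "indep {0} b" "spn {0} b = L"
      using free_subs_basis[of L 1 "{0}"] by auto
    have u: "unimod (b 0)" using unimod_iff_indep[of b 0 "b 0"] b(1) by simp
    have "spn {0} b = spn {0} (\<lambda>_. b 0)"
      unfolding spn_def box_def
      by (intro image_cong refl lc_cong) (use unimodD(1)[OF u] in auto)
    then have "L = line (b 0)" using line_eq_spn[OF unimodD(1)[OF u], of 0] b(2) by simp
    then show "L \<in> line ` Collect unimod" using u by blast
  qed
qed (use line_free_sub in auto)

lemma pointE:
  assumes "L \<in> free_subs 1" obtains x where "unimod x" "L = line x"
  using assms unfolding points_eq by blast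

lemma mem_line: "x \<in> carrier M \<Longrightarrow> x \<in> line x"
  by (force simp: line_def)

lemma line_subset_iff:
  assumes "submodule V R M" "x \<in> carrier M" shows "line x \<subseteq> V \<longleftrightarrow> x \<in> V"
  using mem_line[OF assms(2)] submoduleE(4)[OF assms(1)] by (auto simp: line_def)

text \<open>Both lines have |R| elements, so inclusion is equality, and the scalar relating x and y
  never has to be examined.\<close>

lemma line_eq_if_mem:
  assumes "unimod x" "unimod y" "y \<in> line x" shows "line y = line x"
proof (rule card_subset_eq)
  show "finite (line x)" by (rule finite_free_subs[OF line_free_sub[OF assms(1)]])
  show "line y \<subseteq> line x"
    using line_subset_iff[OF free_subs_submodule[OF line_free_sub[OF assms(1)]]] unimodD(1) assms by blast
  show "card (line y) = card (line x)"
    using card_free_subs[OF line_free_sub[OF assms(1)]] card_free_subs[OF line_free_sub[OF assms(2)]] by simp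
qed

lemma add_mem_iff:
  assumes V: "submodule V R M" and "x \<in> V" "z \<in> carrier M"
  shows "x \<oplus>\<^bsub>M\<^esub> z \<in> V \<longleftrightarrow> z \<in> V"
proof
  note Vs = submoduleE[OF V]
  assume "x \<oplus>\<^bsub>M\<^esub> z \<in> V"
  then have "\<ominus>\<^bsub>M\<^esub> x \<oplus>\<^bsub>M\<^esub> (x \<oplus>\<^bsub>M\<^esub> z) \<in> V" using Vs(3,5) assms(2) by blast
  moreover have "x \<in> carrier M" using assms(2) Vs(1) by blast
  ultimately show "z \<in> V" using assms(3) by (simp add: M.r_neg1)
qed (use submoduleE(5)[OF V] assms in blast)

text \<open>Counting by vectors instead of points admits arguments such as \<pi>^k y, which generate
  no point for k > 0; the level of two points is expressed by them.\<close>

definition common :: "nat \<Rightarrow> 'c \<Rightarrow> 'c \<Rightarrow> nat" where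
  "common n x z = card {V \<in> free_subs n. x \<in> V \<and> z \<in> V}"

text \<open>A submodule that contains x contains \<alpha> x + z exactly if it contains z, so the
  second vector matters only modulo x.\<close>

lemma common_shift:
  assumes "x \<in> carrier M" "z \<in> carrier M" "\<alpha> \<in> carrier R"
  shows "common n x (\<alpha> \<odot>\<^bsub>M\<^esub> x \<oplus>\<^bsub>M\<^esub> z) = common n x z"
proof -
  have "\<alpha> \<odot>\<^bsub>M\<^esub> x \<oplus>\<^bsub>M\<^esub> z \<in> V \<longleftrightarrow> z \<in> V" if "V \<in> free_subs n" "x \<in> V" for V
    using add_mem_iff[OF free_subs_submodule[OF that(1)] _ assms(2)]
      submoduleE(4)[OF free_subs_submodule[OF that(1)]] assms(3) that(2) by blast
  then have "{V \<in> free_subs n. x \<in> V \<and> \<alpha> \<odot>\<^bsub>M\<^esub> x \<oplus>\<^bsub>M\<^esub> z \<in> V} = {V \<in> free_subs n. x \<in> V \<and> z \<in> V}"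
    by blast
  then show ?thesis by (simp add: common_def)
qed

end

context free_chain_module
begin

section \<open>The number of submodules through two vectors depends only on their level\<close>

lemma rank_le:
  assumes "V \<in> free_subs n" shows "n \<le> d"
proof -
  have "card V \<le> card (carrier M)"
    by (rule card_mono[OF finite_free_subs[OF carrier_free] free_subs_carrier[OF assms]])
  then show ?thesis
    using card_free_subs[OF assms] card_free_subs[OF carrier_free] card_carrier_gt_1 by simp
qed

lemma extend_to_full_basis:
  assumes "indep I b" "I \<subseteq> {..<d}"
  shows "\<exists>e. (\<forall>i\<in>I. e i = b i) \<and> indep {..<d} e"
proof (rule extend_to_basis[OF carrier_free assms(1) indepD(2)[OF assms(1)] finite_lessThan assms(2) card_lessThan])
  fix e assume "\<And>i. i \<in> I \<Longrightarrow> e i = b i" "indep {..<d} e"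
  then show ?thesis by blast
qed

text \<open>Taking images under g embeds one family of submodules into the other. Equality is later
  obtained by exchanging the two bases from which the automorphism is built.\<close>

lemma common_auto_le:
  assumes g: "linear_auto g" and "x \<in> carrier M" "z \<in> carrier M"
  shows "common n x z \<le> common n (g x) (g z)"
proof -
  have inj: "inj_on g (carrier M)" using g by (simp add: linear_auto_def bij_betw_def)
  show ?thesis
    unfolding common_def
  proof (rule card_inj_on_le)
    show "inj_on ((`) g) {V \<in> free_subs n. x \<in> V \<and> z \<in> V}"
    proof (rule inj_onI)
      fix V W assume "V \<in> {V \<in> free_subs n. x \<in> V \<and> z \<in> V}" "W \<in> {V \<in> free_subs n. x \<in> V \<and> z \<in> V}"
        and eq: "g ` V = g ` W"
      then have "V \<subseteq> carrier M" "W \<subseteq> carrier M" using free_subs_carrier[of _ n] by simp_all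
      then show "V = W" using inj_on_image_eq_iff[OF inj] eq by blast
    qed
    show "(`) g ` {V \<in> free_subs n. x \<in> V \<and> z \<in> V} \<subseteq> {V \<in> free_subs n. g x \<in> V \<and> g z \<in> V}"
      using linear_auto_free_sub[OF g] by auto
    show "finite {V \<in> free_subs n. g x \<in> V \<and> g z \<in> V}"
      using finite_free_subs_set by simp
  qed
qed

lemma common_le_of_bases:
  assumes b: "indep {..<m} b" and b': "indep {..<m} b'" and m: "m \<le> d"
    and a: "a \<in> {..<m} \<rightarrow> carrier R" "a' \<in> {..<m} \<rightarrow> carrier R"
  shows "common n (lc {..<m} a b) (lc {..<m} a' b) \<le> common n (lc {..<m} a b') (lc {..<m} a' b')"
proof -
  note bD = indepD[OF b] and bD' = indepD[OF b']
  have J: "{..<m} \<subseteq> {..<d}" using m by auto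
  obtain e where e: "\<And>i. i \<in> {..<m} \<Longrightarrow> e i = b i" "indep {..<d} e"
    using extend_to_full_basis[OF b J] by metis
  obtain e' where e': "\<And>i. i \<in> {..<m} \<Longrightarrow> e' i = b' i" "indep {..<d} e'"
    using extend_to_full_basis[OF b' J] by metis
  obtain g where g: "linear_auto g" "\<And>i. i \<in> {..<d} \<Longrightarrow> g (e i) = e' i"
    using linear_auto_between_bases[OF e(2) e'(2)] by auto
  have gb: "g (b i) = b' i" if "i \<in> {..<m}" for i
    using g(2)[of i] e(1)[OF that] e'(1)[OF that] that m by auto
  have img: "g (lc {..<m} c b) = lc {..<m} c b'" if "c \<in> {..<m} \<rightarrow> carrier R" for c
  proof -
    have "g (lc {..<m} c b) = lc {..<m} c (\<lambda>i. g (b i))"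
      using g(1) that bD(1,2) unfolding linear_auto_def by blast
    also have "\<dots> = lc {..<m} c b'" by (rule lc_cong) (use gb that bD' in auto)
    finally show ?thesis .
  qed
  show ?thesis
    using common_auto_le[OF g(1) lc_closed[OF a(1) bD(2)] lc_closed[OF a(2) bD(2)]]
    by (simp add: img a)
qed

text \<open>An automorphism carries x, y to x', y' once both pairs are completed to bases. Only the
  scalar c remains, and it will be \<pi>^k.\<close>

lemma common_pair_eq:
  assumes xy: "indep2 x y" and xy': "indep2 x' y'" and c: "c \<in> carrier R" and d: "2 \<le> d"
  shows "common n x (c \<odot>\<^bsub>M\<^esub> y) = common n x' (c \<odot>\<^bsub>M\<^esub> y')"
proof -
  have le: "common n x (c \<odot>\<^bsub>M\<^esub> y) \<le> common n x' (c \<odot>\<^bsub>M\<^esub> y')"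
    if xy: "indep2 x y" and xy': "indep2 x' y'" for x y x' y'
  proof -
    define b where "b i = (if i = (0::nat) then x else y)" for i
    define b' where "b' i = (if i = (0::nat) then x' else y')" for i
    have two: "{..<2} = {0, 1::nat}" by auto
    have b: "indep {..<2} b" "indep {..<2} b'"
      unfolding two using indep2_iff_indep[of b 0 x 1 y] indep2_iff_indep[of b' 0 x' 1 y'] xy xy'
      by (simp_all add: b_def b'_def)
    define a1 where "a1 i = (if i = (0::nat) then \<one> else \<zero>)" for i
    define a2 where "a2 i = (if i = (0::nat) then \<zero> else c)" for i
    have "lc {..<2} a1 b = x" "lc {..<2} a2 b = c \<odot>\<^bsub>M\<^esub> y"
      "lc {..<2} a1 b' = x'" "lc {..<2} a2 b' = c \<odot>\<^bsub>M\<^esub> y'"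
      unfolding two using indep2D(1,2)[OF xy] indep2D(1,2)[OF xy'] c
      by (simp_all add: lc_two a1_def a2_def b_def b'_def)
    moreover have "a1 \<in> {..<2} \<rightarrow> carrier R" "a2 \<in> {..<2} \<rightarrow> carrier R"
      using c by (auto simp: a1_def a2_def)
    ultimately show ?thesis using common_le_of_bases[OF b d, of a1 a2] by simp
  qed
  show ?thesis using le[OF xy xy'] le[OF xy' xy] by simp
qed

lemma common_self_eq:
  assumes "unimod x" "unimod x'" "1 \<le> d"
  shows "common n x x = common n x' x'"
proof -
  have le: "common n x x \<le> common n x' x'" if x: "unimod x" "unimod x'" for x x'
  proof -
    have one: "{..<1} = {0::nat}" by auto
    have b: "indep {..<1} (\<lambda>_. x)" "indep {..<1} (\<lambda>_. x')"
      unfolding one using unimod_iff_indep[of "\<lambda>_. x" 0 x] unimod_iff_indep[of "\<lambda>_. x'" 0 x'] x by simp_all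
    have "lc {..<1} (\<lambda>_. \<one>) (\<lambda>_. x) = x" "lc {..<1} (\<lambda>_. \<one>) (\<lambda>_. x') = x'"
      unfolding one using unimodD(1)[OF x(1)] unimodD(1)[OF x(2)] by (simp_all add: lc_one)
    then show ?thesis
      using common_le_of_bases[OF b assms(3), of "\<lambda>_. \<one>" "\<lambda>_. \<one>"] by simp
  qed
  show ?thesis using le[OF assms(1,2)] le[OF assms(2,1)] by simp
qed

text \<open>Complete x to a basis and take the common power \<pi>^k out of the coordinates of z away
  from x. The cofactor y keeps a unit coordinate there, hence is independent of x.\<close>

lemma level_decomposition:
  assumes x: "unimod x" and z: "z \<in> carrier M" and d: "2 \<le> d"
  obtains k \<alpha> y where "k \<le> r" "\<alpha> \<in> carrier R" "indep2 x y" "z = \<alpha> \<odot>\<^bsub>M\<^esub> x \<oplus>\<^bsub>M\<^esub> \<pi> [^] k \<odot>\<^bsub>M\<^esub> y"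
proof -
  have i: "indep {0} (\<lambda>_. x)" using unimod_iff_indep[of "\<lambda>_. x" 0 x] x by simp
  have "{0} \<subseteq> {..<d}" using d by simp
  then obtain b where b: "b 0 = x" "indep {..<d} b"
    using extend_to_full_basis[OF i] by auto
  define J where "J = {1..<d}"
  have J: "insert 0 J = {..<d}" "0 \<notin> J" "finite J" "J \<noteq> {}" using d by (auto simp: J_def)
  have bi: "indep (insert 0 J) b" using b(2) J(1) by simp
  note bD = indepD[OF bi]
  have bJ: "b \<in> J \<rightarrow> carrier M" and xM: "x \<in> carrier M" using bD(2) b(1) by auto
  obtain \<zeta> where \<zeta>: "\<zeta> \<in> insert 0 J \<rightarrow> carrier R" "z = lc (insert 0 J) \<zeta> b"
    using coordinates[OF bi _ z] J by auto
  have zJ: "\<zeta> \<in> J \<rightarrow> carrier R" "\<zeta> 0 \<in> carrier R" using \<zeta>(1) by auto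
  obtain k \<xi> where k: "k \<le> r" "\<xi> \<in> J \<rightarrow> carrier R" "\<And>i. i \<in> J \<Longrightarrow> \<zeta> i = \<pi> [^] k \<otimes> \<xi> i"
      "\<exists>i\<in>J. \<xi> i \<in> Units R"
    using common_valuation[OF J(4) zJ(1)] by blast
  define y where "y = lc J \<xi> b"
  have yM: "y \<in> carrier M" unfolding y_def using k(2) bJ by simp
  have "lc J \<zeta> b = lc J (\<lambda>i. \<pi> [^] k \<otimes> \<xi> i) b"
    by (rule lc_cong) (use k bJ in auto)
  also have "\<dots> = \<pi> [^] k \<odot>\<^bsub>M\<^esub> y" unfolding y_def by (rule lc_smult) (use J k bJ in auto)
  finally have zd: "z = \<zeta> 0 \<odot>\<^bsub>M\<^esub> x \<oplus>\<^bsub>M\<^esub> \<pi> [^] k \<odot>\<^bsub>M\<^esub> y"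
    using lc_insert[OF J(3,2) \<zeta>(1) bD(2)] \<zeta>(2) b(1) by simp
  have "a = \<zero> \<and> c = \<zero>"
    if ac: "a \<in> carrier R" "c \<in> carrier R" "a \<odot>\<^bsub>M\<^esub> x \<oplus>\<^bsub>M\<^esub> c \<odot>\<^bsub>M\<^esub> y = \<zero>\<^bsub>M\<^esub>" for a c
  proof -
    define f where "f i = (if i = 0 then a else c \<otimes> \<xi> i)" for i
    have f: "f \<in> insert 0 J \<rightarrow> carrier R" using ac k(2) by (auto simp: f_def Pi_def)
    have "lc J f b = lc J (\<lambda>i. c \<otimes> \<xi> i) b"
      by (rule lc_cong) (use ac k bJ J(2) in \<open>auto simp: f_def Pi_def\<close>)
    also have "\<dots> = c \<odot>\<^bsub>M\<^esub> y" unfolding y_def by (rule lc_smult) (use ac J k bJ in auto)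
    finally have "lc (insert 0 J) f b = \<zero>\<^bsub>M\<^esub>"
      using lc_insert[OF J(3,2) f bD(2)] ac(3) b(1) by (simp add: f_def)
    then have f0: "f i = \<zero>" if "i \<in> insert 0 J" for i using bD(3)[OF f] that by blast
    obtain i where i: "i \<in> J" "\<xi> i \<in> Units R" using k(4) by blast
    have "i \<noteq> 0" using i(1) J(2) by metis
    then have "c \<otimes> \<xi> i = \<zero>" using f0[of i] i by (simp add: f_def)
    then have "c = \<zero>" using unit_mult_eq_zero_iff[OF i(2) ac(2)] by simp
    then show ?thesis using f0[of 0] by (simp add: f_def)
  qed
  then have "indep2 x y" using xM yM unfolding indep2_def by blast
  then show thesis using that k(1) zJ(2) zd by blast
qed

text \<open>Multiplication by \<pi>^(r-j) removes the part in \<pi>^j M and leaves \<pi>^(r-j+k) y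
  in the line of x, which forces that scalar to vanish. Hence k depends on the two vectors only,
  although \<alpha> and y are not unique.\<close>

lemma level_mem_iff:
  assumes xy: "indep2 x y" and a: "\<alpha> \<in> carrier R" and k: "k \<le> r" and j: "j \<le> r"
  shows "\<alpha> \<odot>\<^bsub>M\<^esub> x \<oplus>\<^bsub>M\<^esub> \<pi> [^] k \<odot>\<^bsub>M\<^esub> y \<in> psum j {0} (\<lambda>_. x) (carrier M) \<longleftrightarrow> j \<le> k"
proof
  note M = indep2D(1,2)[OF xy]
  assume "\<alpha> \<odot>\<^bsub>M\<^esub> x \<oplus>\<^bsub>M\<^esub> \<pi> [^] k \<odot>\<^bsub>M\<^esub> y \<in> psum j {0} (\<lambda>_. x) (carrier M)"
  then obtain \<beta> m where \<beta>: "\<beta> \<in> carrier R" "m \<in> carrier M"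
      "\<alpha> \<odot>\<^bsub>M\<^esub> x \<oplus>\<^bsub>M\<^esub> \<pi> [^] k \<odot>\<^bsub>M\<^esub> y = \<beta> \<odot>\<^bsub>M\<^esub> x \<oplus>\<^bsub>M\<^esub> \<pi> [^] j \<odot>\<^bsub>M\<^esub> m"
    unfolding line_eq_spn[OF M(1), of 0, symmetric] psum_def line_def pmult_def by blast
  define p where "p = \<pi> [^] (r - j)"
  have p: "p \<in> carrier R" "p \<otimes> \<pi> [^] j = \<zero>" "p \<otimes> \<pi> [^] k = \<pi> [^] (r - j + k)"
    using j pi_pow_r by (simp_all add: p_def nat_pow_mult)
  have "p \<odot>\<^bsub>M\<^esub> (\<alpha> \<odot>\<^bsub>M\<^esub> x \<oplus>\<^bsub>M\<^esub> \<pi> [^] k \<odot>\<^bsub>M\<^esub> y) = p \<odot>\<^bsub>M\<^esub> (\<beta> \<odot>\<^bsub>M\<^esub> x \<oplus>\<^bsub>M\<^esub> \<pi> [^] j \<odot>\<^bsub>M\<^esub> m)"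
    using \<beta>(3) by simp
  then have eq: "(p \<otimes> \<alpha>) \<odot>\<^bsub>M\<^esub> x \<oplus>\<^bsub>M\<^esub> \<pi> [^] (r - j + k) \<odot>\<^bsub>M\<^esub> y = (p \<otimes> \<beta>) \<odot>\<^bsub>M\<^esub> x"
    using p M a \<beta>(1,2) by (simp add: smult_r_distr smult_assoc1[symmetric])
  have "(p \<otimes> \<alpha> \<ominus> p \<otimes> \<beta>) \<odot>\<^bsub>M\<^esub> x \<oplus>\<^bsub>M\<^esub> \<pi> [^] (r - j + k) \<odot>\<^bsub>M\<^esub> y
      = \<ominus>\<^bsub>M\<^esub> ((p \<otimes> \<beta>) \<odot>\<^bsub>M\<^esub> x) \<oplus>\<^bsub>M\<^esub> ((p \<otimes> \<alpha>) \<odot>\<^bsub>M\<^esub> x \<oplus>\<^bsub>M\<^esub> \<pi> [^] (r - j + k) \<odot>\<^bsub>M\<^esub> y)"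
    using p M a \<beta> by (simp add: a_minus_def smult_l_distr smult_l_minus M.a_ac)
  also have "\<dots> = \<zero>\<^bsub>M\<^esub>" unfolding eq using p M \<beta> by (simp add: M.l_neg)
  finally have "\<pi> [^] (r - j + k) = \<zero>"
    using indep2D(4)[OF xy, of "p \<otimes> \<alpha> \<ominus> p \<otimes> \<beta>" "\<pi> [^] (r - j + k)"] p a \<beta> by simp
  then show "j \<le> k" unfolding pi_pow_eq_zero_iff using j by simp
next
  note M = indep2D(1,2)[OF xy]
  assume jk: "j \<le> k"
  have "\<pi> [^] k = \<pi> [^] j \<otimes> \<pi> [^] (k - j)" using jk by (simp add: nat_pow_mult)
  then have "\<pi> [^] k \<odot>\<^bsub>M\<^esub> y = \<pi> [^] j \<odot>\<^bsub>M\<^esub> (\<pi> [^] (k - j) \<odot>\<^bsub>M\<^esub> y)" using M by (simp add: smult_assoc1)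
  then have "\<pi> [^] k \<odot>\<^bsub>M\<^esub> y \<in> pmult j (carrier M)" using M by (auto simp: pmult_def)
  moreover have "\<alpha> \<odot>\<^bsub>M\<^esub> x \<in> spn {0} (\<lambda>_. x)"
    unfolding line_eq_spn[OF M(1), of 0, symmetric] line_def using a by blast
  ultimately show "\<alpha> \<odot>\<^bsub>M\<^esub> x \<oplus>\<^bsub>M\<^esub> \<pi> [^] k \<odot>\<^bsub>M\<^esub> y \<in> psum j {0} (\<lambda>_. x) (carrier M)"
    by (rule psumI[rotated])
qed

text \<open>Free submodules are direct summands, hence pure.\<close>

lemma pmult_inter:
  assumes V: "V \<in> free_subs n" and m: "m \<in> carrier M" and mem: "\<pi> [^] k \<odot>\<^bsub>M\<^esub> m \<in> V"
  shows "\<pi> [^] k \<odot>\<^bsub>M\<^esub> m \<in> pmult k V"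
proof -
  define I J where "I = {..<n}" and "J = {..<d}"
  have IJ: "I \<subseteq> J" "finite I" "finite J" using rank_le[OF V] by (auto simp: I_def J_def)
  obtain b0 where b0: "indep I b0" "b0 \<in> I \<rightarrow> V" "spn I b0 = V"
    using free_subs_basis[OF V, of I] by (auto simp: I_def)
  obtain b where b: "\<And>i. i \<in> I \<Longrightarrow> b i = b0 i" "indep J b"
    using extend_to_full_basis[OF b0(1), folded J_def, OF IJ(1)] by blast
  note bD = indepD[OF b(2)]
  have bI: "b \<in> I \<rightarrow> carrier M" using bD(2) IJ by auto
  have bV: "spn I b = V"
  proof (rule spn_eq_free_sub[OF V indep_subset[OF b(2) IJ(1)]])
    show "b \<in> I \<rightarrow> V" using b(1) b0(2) by auto
  qed (simp add: I_def)
  obtain a where a: "a \<in> J \<rightarrow> carrier R" "m = lc J a b"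
    using coordinates[OF b(2) _ m] by (auto simp: J_def)
  define pa where "pa i = \<pi> [^] k \<otimes> a i" for i
  have pa: "pa \<in> J \<rightarrow> carrier R" using a(1) by (auto simp: pa_def Pi_def)
  have e: "\<pi> [^] k \<odot>\<^bsub>M\<^esub> m = lc J pa b"
    unfolding a(2) pa_def by (rule lc_smult[symmetric]) (use bD a in auto)
  obtain c where c: "c \<in> I \<rightarrow> carrier R" "\<pi> [^] k \<odot>\<^bsub>M\<^esub> m = lc I c b"
    using mem bV spnE by blast
  define c0 where "c0 i = (if i \<in> I then c i else \<zero>)" for i
  have c0: "c0 \<in> J \<rightarrow> carrier R" using c(1) by (auto simp: c0_def)
  have "lc J c0 b = lc I c0 b" by (rule lc_neutral) (use bD c0 IJ in \<open>auto simp: c0_def\<close>)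
  also have "\<dots> = lc I c b" by (rule lc_cong) (use c bI in \<open>auto simp: c0_def\<close>)
  finally have "lc J pa b = lc J c0 b" using c(2) e by simp
  then have "pa i = c0 i" if "i \<in> J" for i using indep_unique[OF b(2) pa c0 _ that] by simp
  \<comment> \<open>The coordinates of \<pi>^k m outside I vanish, so m can be replaced by its
    component in V.\<close>
  then have z: "pa i = \<zero>" if "i \<in> J - I" for i using that by (simp add: c0_def)
  have aI: "a \<in> I \<rightarrow> carrier R" using a(1) IJ by auto
  have "lc J pa b = lc I pa b" by (rule lc_neutral[OF IJ(3,1) pa bD(2) z])
  also have "\<dots> = \<pi> [^] k \<odot>\<^bsub>M\<^esub> lc I a b"
    unfolding pa_def by (rule lc_smult) (use IJ aI bI in auto)
  finally show ?thesis
    using e spn_mem[OF aI, of b] bV by (auto simp: pmult_def)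
qed

text \<open>The modular law combined with purity: for x in V, the element of \<pi>^k M that occurs
  lies in V and hence in \<pi>^k V.\<close>

lemma psum_inter:
  assumes V: "V \<in> free_subs n" and x: "x \<in> V"
  shows "psum k {0} (\<lambda>_. x) (carrier M) \<inter> V = psum k {0} (\<lambda>_. x) V"
proof -
  note Vs = submoduleE[OF free_subs_submodule[OF V]]
  have xM: "x \<in> carrier M" using x Vs(1) by blast
  have sp: "spn {0} (\<lambda>_. x) \<subseteq> V" by (rule spn_subset[OF free_subs_submodule[OF V]]) (use x in auto)
  show ?thesis
  proof (intro equalityI subsetI)
    fix z assume z: "z \<in> psum k {0} (\<lambda>_. x) (carrier M) \<inter> V"
    then obtain y m where ym: "y \<in> spn {0} (\<lambda>_. x)" "m \<in> carrier M" "z = y \<oplus>\<^bsub>M\<^esub> \<pi> [^] k \<odot>\<^bsub>M\<^esub> m"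
      unfolding psum_def pmult_def by blast
    have "\<pi> [^] k \<odot>\<^bsub>M\<^esub> m \<in> V"
      using add_mem_iff[OF free_subs_submodule[OF V], of y "\<pi> [^] k \<odot>\<^bsub>M\<^esub> m"] ym z sp by auto
    then show "z \<in> psum k {0} (\<lambda>_. x) V"
      unfolding ym(3) using psumI[OF ym(1) pmult_inter[OF V ym(2)]] by blast
  next
    fix z assume "z \<in> psum k {0} (\<lambda>_. x) V"
    then obtain y w where yw: "y \<in> spn {0} (\<lambda>_. x)" "w \<in> pmult k V" "z = y \<oplus>\<^bsub>M\<^esub> w" by (elim psumE)
    have "w \<in> pmult k (carrier M)" using yw(2) Vs(1) by (auto simp: pmult_def)
    moreover have "w \<in> V" using yw(2) pmult_subset[OF V] by blast
    ultimately show "z \<in> psum k {0} (\<lambda>_. x) (carrier M) \<inter> V"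
      unfolding yw(3) using psumI[OF yw(1)] Vs(5) yw(1) sp by auto
  qed
qed

lemma card_point_psum:
  assumes V: "V \<in> free_subs n" and x: "unimod x" "x \<in> V" and n: "1 \<le> n"
  shows "card (psum k {0} (\<lambda>_. x) V) = psum_count (card T) r k 1 n"
proof -
  have one: "{..<1} = {0::nat}" by auto
  have "indep {..<1} (\<lambda>_. x)" unfolding one using unimod_iff_indep[of "\<lambda>_. x" 0 x] x by simp
  from card_psum[OF V this _ n, of k] show ?thesis unfolding one using x by simp
qed

text \<open>Pairs (z, V) with x, z in V and z in <x> + \<pi>^k M are counted by z on the left and by
  V on the right, where \<open>psum_inter\<close> moves the count inside V.\<close>

lemma sum_common:
  assumes x: "unimod x" and n: "1 \<le> n"
  shows "(\<Sum>z\<in>psum k {0} (\<lambda>_. x) (carrier M). common n x z) = common n x x * psum_count (card T) r k 1 n"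
proof -
  define Z where "Z = psum k {0} (\<lambda>_. x) (carrier M)"
  define D where "D = {V \<in> free_subs n. x \<in> V}"
  have fD: "finite D" using finite_free_subs_set by (simp add: D_def)
  have i: "indep {0} (\<lambda>_. x)" using unimod_iff_indep[of "\<lambda>_. x" 0 x] x by simp
  have "Z \<subseteq> carrier M"
    unfolding Z_def by (rule psum_subset[OF carrier_free i]) (use unimodD(1)[OF x] in auto)
  then have fZ: "finite Z" using finite_free_subs[OF carrier_free] finite_subset by blast
  have "common n x z = (\<Sum>V\<in>D. if z \<in> V then 1 else 0)" for z
  proof -
    have "{V \<in> free_subs n. x \<in> V \<and> z \<in> V} = {V \<in> D. z \<in> V}" by (auto simp: D_def)
    then show ?thesis using fD by (simp add: common_def sum.If_cases Int_def)
  qed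
  then have "(\<Sum>z\<in>Z. common n x z) = (\<Sum>V\<in>D. \<Sum>z\<in>Z. if z \<in> V then 1 else 0)"
    by (simp add: sum.swap[of _ D])
  also have "\<dots> = (\<Sum>V\<in>D. psum_count (card T) r k 1 n)"
  proof (rule sum.cong)
    fix V assume "V \<in> D"
    then have V: "V \<in> free_subs n" "x \<in> V" by (auto simp: D_def)
    have "(\<Sum>z\<in>Z. if z \<in> V then 1 else 0) = card (Z \<inter> V)"
      using fZ by (simp add: sum.If_cases)
    then show "(\<Sum>z\<in>Z. if z \<in> V then 1 else 0) = psum_count (card T) r k 1 n"
      using psum_inter[OF V, of k] card_point_psum[OF V(1) x V(2) n] by (simp add: Z_def)
  qed simp
  finally show ?thesis unfolding Z_def[symmetric] by (simp add: D_def common_def)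
qed

text \<open>Double counting of incident pairs; by transitivity on points the number of submodules
  through a point is constant.\<close>

lemma common_self:
  assumes x: "unimod x" and n: "1 \<le> n" "n \<le> d"
  shows "common n x x = point_degree (card T) r d n"
proof -
  define P where "P = free_subs 1"
  define Q where "Q = free_subs n"
  have fin: "finite P" "finite Q" by (simp_all add: P_def Q_def finite_free_subs_set)
  have "(\<Sum>L\<in>P. \<Sum>V\<in>Q. if L \<subseteq> V then 1 else 0) = (\<Sum>L\<in>P. common n x x)"
  proof (rule sum.cong)
    fix L assume "L \<in> P"
    then obtain y where y: "unimod y" "L = line y" unfolding P_def by (elim pointE)
    have "{V \<in> Q. L \<subseteq> V} = {V \<in> Q. y \<in> V \<and> y \<in> V}"
      unfolding y(2) using line_subset_iff[OF free_subs_submodule unimodD(1)[OF y(1)]]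
      by (auto simp: Q_def)
    then have "(\<Sum>V\<in>Q. if L \<subseteq> V then 1 else 0) = common n y y"
      using fin by (simp add: sum.If_cases Int_def common_def Q_def)
    then show "(\<Sum>V\<in>Q. if L \<subseteq> V then 1 else 0) = common n x x"
      using common_self_eq[OF y(1) x] n by simp
  qed simp
  moreover have "(\<Sum>V\<in>Q. \<Sum>L\<in>P. if L \<subseteq> V then 1 else 0) = (\<Sum>V\<in>Q. sub_count (card T) r 1 n)"
  proof (rule sum.cong)
    fix V assume "V \<in> Q"
    then show "(\<Sum>L\<in>P. if L \<subseteq> V then 1 else 0) = sub_count (card T) r 1 n"
      using fin card_free_subs_below(2)[of V n 1] n
      by (simp add: sum.If_cases Int_def P_def Q_def)
  qed simp
  ultimately have "card P * common n x x = card Q * sub_count (card T) r 1 n"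
    by (simp add: sum.swap[of _ Q])
  moreover have "card P = sub_count (card T) r 1 d" "card Q = sub_count (card T) r n d"
    using card_free_subs_set n by (simp_all add: P_def Q_def)
  moreover have "card P > 0" using fin line_free_sub[OF x] by (auto simp: P_def card_gt_0_iff)
  ultimately show ?thesis unfolding point_degree_def by (metis nonzero_mult_div_cancel_left not_gr0)
qed

text \<open>The sums over <x> + \<pi>^k M and <x> + \<pi>^(k+1) M differ by the vectors of level
  exactly k. All of these have the same count, so it is found by dividing by their number. For k = r
  the question reduces to a single point.\<close>

lemma common_count:
  assumes xy: "indep2 x y" and a: "\<alpha> \<in> carrier R" and k: "k \<le> r"
    and n: "1 \<le> n" "n \<le> d" and d: "2 \<le> d"
  shows "common n x (\<alpha> \<odot>\<^bsub>M\<^esub> x \<oplus>\<^bsub>M\<^esub> \<pi> [^] k \<odot>\<^bsub>M\<^esub> y) = pair_count (card T) r d n k"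
proof (cases "k = r")
  case True
  note M = indep2D(1,2)[OF xy]
  have zc: "\<zero> \<in> carrier R" and oc: "\<one> \<in> carrier R" by simp_all
  \<comment> \<open>Here \<pi>^r y = 0, and a submodule through x contains \<alpha> x, 0 and x
    alike.\<close>
  have "common n x (\<alpha> \<odot>\<^bsub>M\<^esub> x \<oplus>\<^bsub>M\<^esub> \<pi> [^] k \<odot>\<^bsub>M\<^esub> y) = common n x \<zero>\<^bsub>M\<^esub>"
    unfolding True pi_pow_r common_shift[OF M(1) smult_closed[OF zc M(2)] a] using M by simp
  also have "\<dots> = common n x x"
    using common_shift[OF M(1) M.zero_closed oc, of n] M by simp
  finally show ?thesis
    using common_self[OF indep2_unimod(1)[OF xy] n] True by (simp add: pair_count_def)
next
  case False
  then have k: "k < r" using k by simp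
  note M = indep2D(1,2)[OF xy]
  have x: "unimod x" by (rule indep2_unimod(1)[OF xy])
  define c where "c = common n x (\<pi> [^] k \<odot>\<^bsub>M\<^esub> y)"
  define Z where "Z j = psum j {0} (\<lambda>_. x) (carrier M)" for j
  have i: "indep {0} (\<lambda>_. x)" using unimod_iff_indep[of "\<lambda>_. x" 0 x] x by simp
  have ZM: "Z j \<subseteq> carrier M" for j
    unfolding Z_def by (rule psum_subset[OF carrier_free i]) (use M in auto)
  have fZ: "finite (Z j)" for j
    using ZM finite_free_subs[OF carrier_free] finite_subset by blast
  have sub: "Z (Suc k) \<subseteq> Z k"
  proof
    fix z assume z: "z \<in> Z (Suc k)"
    then obtain j \<beta> w where w: "j \<le> r" "\<beta> \<in> carrier R" "indep2 x w" "z = \<beta> \<odot>\<^bsub>M\<^esub> x \<oplus>\<^bsub>M\<^esub> \<pi> [^] j \<odot>\<^bsub>M\<^esub> w"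
      using level_decomposition[OF x _ d] ZM by blast
    then show "z \<in> Z k"
      using z level_mem_iff[OF w(3,2,1), of "Suc k"] level_mem_iff[OF w(3,2,1), of k] k by (simp add: Z_def)
  qed
  have const: "common n x z = c" if z: "z \<in> Z k - Z (Suc k)" for z
  proof -
    have "z \<in> carrier M" using ZM z by blast
    then obtain j \<beta> w where w: "j \<le> r" "\<beta> \<in> carrier R" "indep2 x w" "z = \<beta> \<odot>\<^bsub>M\<^esub> x \<oplus>\<^bsub>M\<^esub> \<pi> [^] j \<odot>\<^bsub>M\<^esub> w"
      using level_decomposition[OF x _ d] by blast
    then have "j = k"
      using z level_mem_iff[OF w(3,2,1), of "Suc k"] level_mem_iff[OF w(3,2,1), of k] k by (simp add: Z_def)
    then show ?thesis
      unfolding w(4) c_def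
      using common_shift[OF M(1) _ w(2)] indep2D(2)[OF w(3)] common_pair_eq[OF w(3) xy _ d] by simp
  qed
  have card_Z: "card (Z j) = psum_count (card T) r j 1 d" for j
    unfolding Z_def using card_point_psum[OF carrier_free x M(1)] d by simp
  have S: "(\<Sum>z\<in>Z j. common n x z) = point_degree (card T) r d n * psum_count (card T) r j 1 n" for j
    unfolding Z_def using sum_common[OF x n(1)] common_self[OF x n] by simp
  have "(\<Sum>z\<in>Z k - Z (Suc k). common n x z) = (\<Sum>z\<in>Z k. common n x z) - (\<Sum>z\<in>Z (Suc k). common n x z)"
    by (rule sum_diff_nat[OF fZ sub])
  then have "card (Z k - Z (Suc k)) * c =
      point_degree (card T) r d n * (psum_count (card T) r k 1 n - psum_count (card T) r (Suc k) 1 n)"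
    using const unfolding S by (simp add: diff_mult_distrib2)
  moreover have "card (Z k - Z (Suc k)) = psum_count (card T) r k 1 d - psum_count (card T) r (Suc k) 1 d"
    using card_Diff_subset[OF fZ sub] card_Z by simp
  moreover have "psum_count (card T) r k 1 d - psum_count (card T) r (Suc k) 1 d > 0"
    using psum_count_Suc_less[OF card_T k d] by simp
  ultimately have "c = pair_count (card T) r d n k"
    unfolding pair_count_def using False by (metis nonzero_mult_div_cancel_left not_gr0)
  then show ?thesis unfolding c_def using common_shift[OF M(1) _ a] M by simp
qed

end

section \<open>Recovering the characteristic from the incidence relation\<close>

text \<open>z lies in the intersection of all members of Q through x and y. Only inclusions between
  vertices occur, so isomorphisms preserve the relation; \<open>coll_iff\<close> identifies it with
  membership in the span.\<close>

definition coll :: "'v set set \<Rightarrow> 'v set \<Rightarrow> 'v set \<Rightarrow> 'v set \<Rightarrow> bool" where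
  "coll Q x y z \<longleftrightarrow> (\<forall>V\<in>Q. x \<subseteq> V \<and> y \<subseteq> V \<longrightarrow> z \<subseteq> V)"

text \<open>Maximality of the span: whenever x and y lie in the span of two points, this is already
  the span of x and y. If x and y agree modulo \<pi>, a strictly larger span exists.\<close>

definition distant :: "'v set set \<Rightarrow> 'v set set \<Rightarrow> 'v set \<Rightarrow> 'v set \<Rightarrow> bool" where
  "distant P Q x y \<longleftrightarrow>
    (\<forall>z\<in>P. \<forall>w\<in>P. coll Q z w x \<and> coll Q z w y \<longrightarrow> coll Q x y z \<and> coll Q x y w)"

text \<open>Composing the perspectivities with centres \<open>C\<close> and \<open>C'\<close> between the lines \<open>ES\<close> and \<open>EU\<close> is
  the translation \<open>x \<mapsto> x + 1\<close> of \<open>ES\<close> in suitable coordinates. The points \<open>f i\<close> and \<open>g i\<close> are its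
  orbit; it returns to the starting point \<open>S\<close> after \<open>m\<close> steps.\<close>

definition translation_config ::
  "'v set set \<Rightarrow> 'v set set \<Rightarrow> nat \<Rightarrow> 'v set \<Rightarrow> 'v set \<Rightarrow> 'v set \<Rightarrow> 'v set \<Rightarrow> 'v set \<Rightarrow>
    (nat \<Rightarrow> 'v set) \<Rightarrow> (nat \<Rightarrow> 'v set) \<Rightarrow> bool" where
  "translation_config P Q m E S U C C' f g \<longleftrightarrow>
    {E, S, U, C, C'} \<subseteq> P \<and>
    distant P Q S U \<and> (\<forall>w\<in>P. coll Q S U w \<longrightarrow> distant P Q w E) \<and>
    coll Q S U C \<and> distant P Q C S \<and> distant P Q C U \<and>
    coll Q E C C' \<and> distant P Q C' E \<and> distant P Q C' C \<and>
    f 0 = S \<and> f m = S \<and>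
    (\<forall>i\<le>m. f i \<in> P \<and> coll Q E S (f i)) \<and>
    (\<forall>i<m. g i \<in> P \<and> coll Q E U (g i) \<and> coll Q C (f i) (g i) \<and> coll Q C' (g i) (f (Suc i)))"

context chain_module
begin

section \<open>Spans of two vectors, and coordinates in a frame of three\<close>

definition span2 :: "'c \<Rightarrow> 'c \<Rightarrow> 'c set" where
  "span2 x y = {a \<odot>\<^bsub>M\<^esub> x \<oplus>\<^bsub>M\<^esub> c \<odot>\<^bsub>M\<^esub> y | a c. a \<in> carrier R \<and> c \<in> carrier R}"

lemma span2I: "a \<in> carrier R \<Longrightarrow> c \<in> carrier R \<Longrightarrow> a \<odot>\<^bsub>M\<^esub> x \<oplus>\<^bsub>M\<^esub> c \<odot>\<^bsub>M\<^esub> y \<in> span2 x y"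
  unfolding span2_def by blast

lemma span2E:
  assumes "z \<in> span2 x y"
  obtains a c where "a \<in> carrier R" "c \<in> carrier R" "z = a \<odot>\<^bsub>M\<^esub> x \<oplus>\<^bsub>M\<^esub> c \<odot>\<^bsub>M\<^esub> y"
  using assms unfolding span2_def by blast

lemma span2_image: "span2 x y = (\<lambda>(a, c). a \<odot>\<^bsub>M\<^esub> x \<oplus>\<^bsub>M\<^esub> c \<odot>\<^bsub>M\<^esub> y) ` (carrier R \<times> carrier R)"
  unfolding span2_def by auto

lemma finite_span2: "finite (span2 x y)" and card_span2_le: "card (span2 x y) \<le> card (carrier R) ^ 2"
proof -
  show "finite (span2 x y)" unfolding span2_image using finite_carrier by simp
  have "card (span2 x y) \<le> card (carrier R \<times> carrier R)"
    unfolding span2_image by (rule card_image_le) (use finite_carrier in simp)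
  then show "card (span2 x y) \<le> card (carrier R) ^ 2"
    by (simp add: card_cartesian_product power2_eq_square)
qed

lemma span2_eq_spn:
  assumes "b i = x" "b j = y" "i \<noteq> j" "x \<in> carrier M" "y \<in> carrier M"
  shows "span2 x y = spn {i, j} b"
proof (intro equalityI subsetI)
  fix z assume "z \<in> span2 x y"
  then obtain a c where ac: "a \<in> carrier R" "c \<in> carrier R" "z = a \<odot>\<^bsub>M\<^esub> x \<oplus>\<^bsub>M\<^esub> c \<odot>\<^bsub>M\<^esub> y" by (elim span2E)
  define f where "f k = (if k = i then a else c)" for k
  have "lc {i, j} f b = z" using lc_two[of i j f b] assms ac by (simp add: f_def)
  moreover have "f \<in> {i, j} \<rightarrow> carrier R" using ac by (simp add: f_def)
  ultimately show "z \<in> spn {i, j} b" using spn_mem by blast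
next
  fix z assume "z \<in> spn {i, j} b"
  then obtain a where a: "a \<in> {i, j} \<rightarrow> carrier R" "z = lc {i, j} a b" by (elim spnE)
  have "z = a i \<odot>\<^bsub>M\<^esub> x \<oplus>\<^bsub>M\<^esub> a j \<odot>\<^bsub>M\<^esub> y" using lc_two[of i j a b] assms a by simp
  then show "z \<in> span2 x y" using span2I a(1) by simp
qed

lemma submodule_span2:
  assumes "x \<in> carrier M" "y \<in> carrier M" shows "submodule (span2 x y) R M"
proof -
  define b where "b i = (if i = (0::nat) then x else y)" for i
  have "span2 x y = spn {0, 1} b" by (rule span2_eq_spn) (use assms in \<open>auto simp: b_def\<close>)
  moreover have "submodule (spn {0, 1} b) R M"
    by (rule submodule_spn) (use assms in \<open>auto simp: b_def\<close>)
  ultimately show ?thesis by simp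
qed

lemma card_span2:
  assumes "indep2 x y" shows "card (span2 x y) = card (carrier R) ^ 2"
proof -
  define b where "b i = (if i = (0::nat) then x else y)" for i
  have "span2 x y = spn {0, 1} b"
    by (rule span2_eq_spn) (use indep2D(1,2)[OF assms] in \<open>auto simp: b_def\<close>)
  moreover have "indep {0, 1} b" using indep2_iff_indep[of b 0 x 1 y] assms by (simp add: b_def)
  ultimately show ?thesis using card_spn[of "{0, 1}" b] by (simp add: numeral_2_eq_2)
qed

lemma left_mem_span2: "x \<in> carrier M \<Longrightarrow> y \<in> carrier M \<Longrightarrow> x \<in> span2 x y"
  using span2I[of \<one> \<zero> x y] by simp

lemma right_mem_span2: "x \<in> carrier M \<Longrightarrow> y \<in> carrier M \<Longrightarrow> y \<in> span2 x y"
  using span2I[of \<zero> \<one> x y] by simp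

lemma span2_subset:
  assumes V: "submodule V R M" and "x \<in> V" "y \<in> V" shows "span2 x y \<subseteq> V"
  using submoduleE(4,5)[OF V] assms(2,3) by (auto elim!: span2E)

lemma spn_coord_zero:
  assumes b: "indep J b" and S: "S \<subseteq> J" and z: "\<zeta> \<in> J \<rightarrow> carrier R" "lc J \<zeta> b = lc S c b"
    and c: "c \<in> S \<rightarrow> carrier R"
  shows "i \<in> S \<Longrightarrow> \<zeta> i = c i" "i \<in> J - S \<Longrightarrow> \<zeta> i = \<zero>"
proof -
  note bD = indepD[OF b]
  have bS: "b \<in> S \<rightarrow> carrier M" using bD(2) S by auto
  define c0 where "c0 i = (if i \<in> S then c i else \<zero>)" for i
  have c0: "c0 \<in> J \<rightarrow> carrier R" using c by (auto simp: c0_def)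
  have "lc J c0 b = lc S c0 b" by (rule lc_neutral) (use bD c0 S in \<open>auto simp: c0_def\<close>)
  also have "\<dots> = lc S c b" by (rule lc_cong) (use c bS in \<open>auto simp: c0_def\<close>)
  finally have "lc J \<zeta> b = lc J c0 b" using z(2) by simp
  then have eq: "\<zeta> i = c0 i" if "i \<in> J" for i using indep_unique[OF b z(1) c0 _ that] by simp
  show "i \<in> S \<Longrightarrow> \<zeta> i = c i" using eq[of i] S by (auto simp: c0_def)
  show "i \<in> J - S \<Longrightarrow> \<zeta> i = \<zero>" using eq[of i] by (simp add: c0_def)
qed

lemma line_unit_mult:
  assumes u: "u \<in> Units R" and x: "x \<in> carrier M" shows "line (u \<odot>\<^bsub>M\<^esub> x) = line x"
proof (intro equalityI subsetI)
  have uc: "u \<in> carrier R" "inv u \<in> carrier R" "inv u \<otimes> u = \<one>" using u Units_closed[OF u] by auto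
  fix z assume "z \<in> line (u \<odot>\<^bsub>M\<^esub> x)"
  then obtain c where "c \<in> carrier R" "z = c \<odot>\<^bsub>M\<^esub> (u \<odot>\<^bsub>M\<^esub> x)" by (auto simp: line_def)
  then have "z = (c \<otimes> u) \<odot>\<^bsub>M\<^esub> x" "c \<otimes> u \<in> carrier R" using uc x by (simp_all add: smult_assoc1)
  then show "z \<in> line x" by (auto simp: line_def)
next
  have uc: "u \<in> carrier R" "inv u \<in> carrier R" "inv u \<otimes> u = \<one>" using u Units_closed[OF u] by auto
  fix z assume "z \<in> line x"
  then obtain c where c: "c \<in> carrier R" "z = c \<odot>\<^bsub>M\<^esub> x" by (auto simp: line_def)
  have "c \<otimes> inv u \<otimes> u = c" using uc c by (simp add: m_assoc)
  then have "z = (c \<otimes> inv u) \<odot>\<^bsub>M\<^esub> (u \<odot>\<^bsub>M\<^esub> x)" using uc c x by (simp add: smult_assoc1[symmetric])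
  then show "z \<in> line (u \<odot>\<^bsub>M\<^esub> x)" using uc c by (auto simp: line_def)
qed

text \<open>For \<beta> in (\<pi>), multiplication by \<pi>^(r-1) would turn the first vector into a
  multiple of x, a nontrivial relation.\<close>

lemma unit_coeff:
  assumes xy: "x \<in> carrier M" "y \<in> carrier M" "\<alpha> \<in> carrier R" "\<beta> \<in> carrier R"
    and i: "indep2 (\<alpha> \<odot>\<^bsub>M\<^esub> x \<oplus>\<^bsub>M\<^esub> \<beta> \<odot>\<^bsub>M\<^esub> y) x"
  shows "\<beta> \<in> Units R"
proof (rule ccontr)
  assume "\<beta> \<notin> Units R"
  then obtain t where t: "t \<in> carrier R" "\<beta> = \<pi> \<otimes> t" using unit_or_pideal[OF xy(4)] by (auto elim!: pidealE)
  define p where "p = \<pi> [^] (r - 1)"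
  have p: "p \<in> carrier R" "p \<otimes> \<pi> = \<zero>"
    unfolding p_def using r_pos nat_pow_Suc[of \<pi> "r - 1"] pi_pow_r by auto
  have "p \<otimes> \<beta> = \<zero>" unfolding t(2) using p t by (simp add: m_assoc[symmetric])
  then have "p \<odot>\<^bsub>M\<^esub> (\<alpha> \<odot>\<^bsub>M\<^esub> x \<oplus>\<^bsub>M\<^esub> \<beta> \<odot>\<^bsub>M\<^esub> y) = (p \<otimes> \<alpha>) \<odot>\<^bsub>M\<^esub> x"
    using p xy by (simp add: smult_r_distr smult_assoc1[symmetric])
  then have "p \<odot>\<^bsub>M\<^esub> (\<alpha> \<odot>\<^bsub>M\<^esub> x \<oplus>\<^bsub>M\<^esub> \<beta> \<odot>\<^bsub>M\<^esub> y) \<oplus>\<^bsub>M\<^esub> (\<ominus> (p \<otimes> \<alpha>)) \<odot>\<^bsub>M\<^esub> x = \<zero>\<^bsub>M\<^esub>"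
    using p xy by (simp add: smult_l_minus M.r_neg)
  then have "p = \<zero>" using indep2D(3)[OF i, of p "\<ominus> (p \<otimes> \<alpha>)"] p xy by simp
  then show False using pi_pow_pred by (simp add: p_def)
qed

text \<open>Homogeneous coordinates [a : b : c] with respect to the frame x, y, z.\<close>

definition tri :: "'c \<Rightarrow> 'c \<Rightarrow> 'c \<Rightarrow> 'a \<Rightarrow> 'a \<Rightarrow> 'a \<Rightarrow> 'c" where
  "tri x y z a b c = a \<odot>\<^bsub>M\<^esub> x \<oplus>\<^bsub>M\<^esub> (b \<odot>\<^bsub>M\<^esub> y \<oplus>\<^bsub>M\<^esub> c \<odot>\<^bsub>M\<^esub> z)"

definition indep3 :: "'c \<Rightarrow> 'c \<Rightarrow> 'c \<Rightarrow> bool" where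
  "indep3 x y z \<longleftrightarrow> x \<in> carrier M \<and> y \<in> carrier M \<and> z \<in> carrier M \<and>
    (\<forall>a\<in>carrier R. \<forall>b\<in>carrier R. \<forall>c\<in>carrier R. tri x y z a b c = \<zero>\<^bsub>M\<^esub> \<longrightarrow> a = \<zero> \<and> b = \<zero> \<and> c = \<zero>)"

lemma indep3D:
  assumes "indep3 x y z"
  shows "x \<in> carrier M" "y \<in> carrier M" "z \<in> carrier M"
    "\<lbrakk>a \<in> carrier R; b \<in> carrier R; c \<in> carrier R; tri x y z a b c = \<zero>\<^bsub>M\<^esub>\<rbrakk> \<Longrightarrow> a = \<zero>"
    "\<lbrakk>a \<in> carrier R; b \<in> carrier R; c \<in> carrier R; tri x y z a b c = \<zero>\<^bsub>M\<^esub>\<rbrakk> \<Longrightarrow> b = \<zero>"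
    "\<lbrakk>a \<in> carrier R; b \<in> carrier R; c \<in> carrier R; tri x y z a b c = \<zero>\<^bsub>M\<^esub>\<rbrakk> \<Longrightarrow> c = \<zero>"
  using assms unfolding indep3_def by blast+

context
  fixes x y z assumes i3: "indep3 x y z"
begin

lemma tri_closed:
  "\<lbrakk>a \<in> carrier R; b \<in> carrier R; c \<in> carrier R\<rbrakk> \<Longrightarrow> tri x y z a b c \<in> carrier M"
  unfolding tri_def using indep3D(1-3)[OF i3] by simp

lemma tri_add:
  assumes "a \<in> carrier R" "b \<in> carrier R" "c \<in> carrier R" "a' \<in> carrier R" "b' \<in> carrier R" "c' \<in> carrier R"
  shows "tri x y z a b c \<oplus>\<^bsub>M\<^esub> tri x y z a' b' c' = tri x y z (a \<oplus> a') (b \<oplus> b') (c \<oplus> c')"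
  unfolding tri_def using indep3D(1-3)[OF i3] assms by (simp add: smult_l_distr M.a_ac)

lemma tri_smult:
  assumes "a \<in> carrier R" "b \<in> carrier R" "c \<in> carrier R" "t \<in> carrier R"
  shows "t \<odot>\<^bsub>M\<^esub> tri x y z a b c = tri x y z (t \<otimes> a) (t \<otimes> b) (t \<otimes> c)"
  unfolding tri_def using indep3D(1-3)[OF i3] assms by (simp add: smult_r_distr smult_assoc1)

lemma tri_eqD:
  assumes "a \<in> carrier R" "b \<in> carrier R" "c \<in> carrier R" "a' \<in> carrier R" "b' \<in> carrier R" "c' \<in> carrier R"
    and eq: "tri x y z a b c = tri x y z a' b' c'"
  shows "a = a'" "b = b'" "c = c'"
proof -
  have "(\<ominus> \<one>) \<odot>\<^bsub>M\<^esub> tri x y z a' b' c' = \<ominus>\<^bsub>M\<^esub> tri x y z a' b' c'"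
    using tri_closed assms by (simp add: smult_l_minus)
  then have "tri x y z (a \<oplus> \<ominus> \<one> \<otimes> a') (b \<oplus> \<ominus> \<one> \<otimes> b') (c \<oplus> \<ominus> \<one> \<otimes> c') = \<zero>\<^bsub>M\<^esub>"
    using tri_add[of a b c "\<ominus> \<one> \<otimes> a'" "\<ominus> \<one> \<otimes> b'" "\<ominus> \<one> \<otimes> c'"] tri_smult[of a' b' c' "\<ominus> \<one>"]
      tri_closed[of a' b' c'] assms by (simp add: M.r_neg)
  then have "a \<oplus> \<ominus> \<one> \<otimes> a' = \<zero>" "b \<oplus> \<ominus> \<one> \<otimes> b' = \<zero>" "c \<oplus> \<ominus> \<one> \<otimes> c' = \<zero>"
    using indep3D(4-6)[OF i3, of "a \<oplus> \<ominus> \<one> \<otimes> a'" "b \<oplus> \<ominus> \<one> \<otimes> b'" "c \<oplus> \<ominus> \<one> \<otimes> c'"] assms by simp_all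
  then show "a = a'" "b = b'" "c = c'"
    using assms by (simp_all add: l_minus a_minus_def[symmetric])
qed

lemma tri_zero: "tri x y z \<zero> \<zero> \<zero> = \<zero>\<^bsub>M\<^esub>"
  unfolding tri_def using indep3D(1-3)[OF i3] by simp

lemma tri_unimod:
  assumes "a \<in> carrier R" "b \<in> carrier R" "c \<in> carrier R" and one: "a = \<one> \<or> b = \<one> \<or> c = \<one>"
  shows "unimod (tri x y z a b c)"
  unfolding unimod_def
proof (intro conjI ballI impI)
  fix t assume t: "t \<in> carrier R" "t \<odot>\<^bsub>M\<^esub> tri x y z a b c = \<zero>\<^bsub>M\<^esub>"
  then have "tri x y z (t \<otimes> a) (t \<otimes> b) (t \<otimes> c) = \<zero>\<^bsub>M\<^esub>" using tri_smult assms by simp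
  then have "t \<otimes> a = \<zero>" "t \<otimes> b = \<zero>" "t \<otimes> c = \<zero>"
    using indep3D(4-6)[OF i3, of "t \<otimes> a" "t \<otimes> b" "t \<otimes> c"] assms t by simp_all
  then show "t = \<zero>" using one t by auto
qed (use tri_closed assms in simp)

lemma tri_indep2:
  assumes "a \<in> carrier R" "b \<in> carrier R" "c \<in> carrier R" "a' \<in> carrier R" "b' \<in> carrier R" "c' \<in> carrier R"
    and "\<And>s t. \<lbrakk>s \<in> carrier R; t \<in> carrier R; s \<otimes> a \<oplus> t \<otimes> a' = \<zero>; s \<otimes> b \<oplus> t \<otimes> b' = \<zero>;
      s \<otimes> c \<oplus> t \<otimes> c' = \<zero>\<rbrakk> \<Longrightarrow> s = \<zero> \<and> t = \<zero>"
  shows "indep2 (tri x y z a b c) (tri x y z a' b' c')"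
proof -
  have "s = \<zero> \<and> t = \<zero>" if st: "s \<in> carrier R" "t \<in> carrier R"
    "s \<odot>\<^bsub>M\<^esub> tri x y z a b c \<oplus>\<^bsub>M\<^esub> t \<odot>\<^bsub>M\<^esub> tri x y z a' b' c' = \<zero>\<^bsub>M\<^esub>" for s t
  proof -
    from st have "tri x y z (s \<otimes> a \<oplus> t \<otimes> a') (s \<otimes> b \<oplus> t \<otimes> b') (s \<otimes> c \<oplus> t \<otimes> c') = \<zero>\<^bsub>M\<^esub>"
      using tri_smult tri_add assms(1-6) by simp
    then have "s \<otimes> a \<oplus> t \<otimes> a' = \<zero>" "s \<otimes> b \<oplus> t \<otimes> b' = \<zero>" "s \<otimes> c \<oplus> t \<otimes> c' = \<zero>"
      using indep3D(4-6)[OF i3, of "s \<otimes> a \<oplus> t \<otimes> a'" "s \<otimes> b \<oplus> t \<otimes> b'" "s \<otimes> c \<oplus> t \<otimes> c'"] assms(1-6) st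
      by simp_all
    then show ?thesis using assms(7) st by blast
  qed
  then show ?thesis by (intro indep2I tri_closed assms(1-6))
qed

end

end

context free_chain_module
begin

text \<open>Write \<open>y = \<alpha> x + \<pi>\<^sup>k w\<close> and extend \<open>x, w\<close> to a basis. Coordinate submodules cut out \<open>\<langle>x, w\<rangle>\<close>, and
  replacing \<open>w\<close> by \<open>w + \<pi>\<^sup>r\<^sup>-\<^sup>k b 2\<close> then forces the coefficient of \<open>w\<close> into \<open>(\<pi>\<^sup>k)\<close>.\<close>

lemma mem_span2_of_coll:
  assumes x: "unimod x" and y: "y \<in> carrier M" and z: "z \<in> carrier M"
    and n: "2 \<le> n" "n < d"
    and all: "\<And>V. \<lbrakk>V \<in> free_subs n; x \<in> V; y \<in> V\<rbrakk> \<Longrightarrow> z \<in> V"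
  shows "z \<in> span2 x y"
proof -
  obtain k \<alpha> w where k: "k \<le> r" "\<alpha> \<in> carrier R" "indep2 x w" "y = \<alpha> \<odot>\<^bsub>M\<^esub> x \<oplus>\<^bsub>M\<^esub> \<pi> [^] k \<odot>\<^bsub>M\<^esub> w"
    using level_decomposition[OF x y] n by auto
  note xw = indep2D(1,2)[OF k(3)]
  \<comment> \<open>\<alpha> x lies in V anyway, so \<pi>^k w can stand in for y.\<close>
  have all': "z \<in> V" if V: "V \<in> free_subs n" "x \<in> V" "\<pi> [^] k \<odot>\<^bsub>M\<^esub> w \<in> V" for V
  proof (rule all[OF V(1,2)])
    show "y \<in> V" unfolding k(4) using submoduleE(4,5)[OF free_subs_submodule[OF V(1)]] V(2,3) k(2) by blast
  qed
  define J where "J = {..<d}"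
  define b0 where "b0 i = (if i = (0::nat) then x else w)" for i
  have i0: "indep {0, 1} b0" using indep2_iff_indep[of b0 0 x 1 w] k(3) by (simp add: b0_def)
  have sub: "{0, 1} \<subseteq> J" using n by (auto simp: J_def)
  obtain b where b01: "\<forall>i\<in>{0, 1}. b i = b0 i" and bJ: "indep J b"
    using extend_to_full_basis[OF i0, folded J_def, OF sub] by blast
  have b: "b 0 = x" "b 1 = w" using b01 by (auto simp: b0_def)
  note bD = indepD[OF bJ]
  obtain \<zeta> where \<zeta>: "\<zeta> \<in> J \<rightarrow> carrier R" "z = lc J \<zeta> b"
    using coordinates[OF bJ _ z] by (auto simp: J_def)
  have z2: "\<zeta> i = \<zero>" if i: "i \<in> J - {0, 1}" for i
  proof -
    \<comment> \<open>Because n < d there are n basis indices that include 0 and 1 and omit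
      i.\<close>
    have "card ({2..<d} - {i}) = d - 3" using i n by (simp add: J_def card_Diff_singleton)
    then have "n - 2 \<le> card ({2..<d} - {i})" using n by simp
    then obtain S0 where S0: "S0 \<subseteq> {2..<d} - {i}" "card S0 = n - 2" "finite S0"
      using obtain_subset_with_card_n by metis
    define S where "S = {0, 1} \<union> S0"
    have S: "S \<subseteq> J" "i \<notin> S" "finite S" using S0 i sub by (auto simp: S_def J_def)
    have "card S = card {0::nat, 1} + card S0" unfolding S_def
      by (rule card_Un_disjoint) (use S0 in auto)
    then have cS: "card S = n" using S0 n by simp
    have bS: "b \<in> S \<rightarrow> carrier M" using bD(2) S by auto
    have V: "spn S b \<in> free_subs n" by (rule free_subsI[OF indep_subset[OF bJ S(1)] cS])
    have "x \<in> spn S b" "w \<in> spn S b"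
      using basis_mem_spn[OF S(3) bS, of 0] basis_mem_spn[OF S(3) bS, of 1] b by (auto simp: S_def)
    then have "z \<in> spn S b" using all'[OF V] submoduleE(4)[OF free_subs_submodule[OF V]] by simp
    then obtain c where c: "c \<in> S \<rightarrow> carrier R" "z = lc S c b" by (elim spnE)
    have "lc J \<zeta> b = lc S c b" using \<zeta>(2) c(2) by simp
    from spn_coord_zero(2)[OF bJ S(1) \<zeta>(1) this c(1), of i] show ?thesis using i S by auto
  qed
  have \<zeta>01: "\<zeta> 0 \<in> carrier R" "\<zeta> 1 \<in> carrier R" using \<zeta>(1) sub by auto
  have "lc J \<zeta> b = lc {0, 1} \<zeta> b"
    by (rule lc_neutral) (use bD sub \<zeta>(1) z2 in auto)
  then have zz: "z = \<zeta> 0 \<odot>\<^bsub>M\<^esub> x \<oplus>\<^bsub>M\<^esub> \<zeta> 1 \<odot>\<^bsub>M\<^esub> w"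
    using \<zeta>(2) lc_two[of 0 1 \<zeta> b] \<zeta>01 xw b by simp
  \<comment> \<open>Index 2 is kept out of S, since w is about to be moved in the direction
    \<open>b 2\<close>.\<close>
  have "n - 2 \<le> card {3..<d}" using n by simp
  then obtain S0 where S0: "S0 \<subseteq> {3..<d}" "card S0 = n - 2" "finite S0"
    using obtain_subset_with_card_n by metis
  define S1 where "S1 = {0} \<union> S0"
  define S where "S = insert 1 S1"
  have "2 \<in> J" using n by (simp add: J_def)
  then have S: "S1 \<subseteq> J" "S \<subseteq> J" "insert 2 S \<subseteq> J" "2 \<notin> S" "1 \<notin> S1" "2 \<notin> S1" "finite S1" "finite S"
    using S0 sub by (auto simp: S_def S1_def J_def)
  have "S = {0, 1} \<union> S0" by (auto simp: S_def S1_def)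
  then have "card S = card {0::nat, 1} + card S0"
    by (simp only:) (rule card_Un_disjoint, use S0 in auto)
  then have cS: "card S = n" using S0 n by simp
  have bM: "b i \<in> carrier M" if "i \<in> J" for i using bD(2) that by auto
  \<comment> \<open>As \<pi>^k p = 0, replacing w by w + p \<open>b 2\<close> leaves \<pi>^k w
    unchanged, so the perturbed submodule still contains x and y.\<close>
  define p where "p = \<pi> [^] (r - k)"
  have p: "p \<in> carrier R" "\<pi> [^] k \<otimes> p = \<zero>"
    using k(1) pi_pow_r by (simp_all add: p_def nat_pow_mult)
  define b' where "b' = b(1 := w \<oplus>\<^bsub>M\<^esub> p \<odot>\<^bsub>M\<^esub> b 2)"
  have b2: "b 2 \<in> carrier M" using bM \<open>2 \<in> J\<close> by blast
  have b'M: "b' \<in> S \<rightarrow> carrier M" using bM S xw b2 p by (auto simp: b'_def)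
  have shift: "lc S c b' = lc (insert 2 S) (c(2 := c 1 \<otimes> p)) b" if c: "c \<in> S \<rightarrow> carrier R" for c
  proof -
    have c1: "c 1 \<in> carrier R" and cS1: "c \<in> S1 \<rightarrow> carrier R" using c by (auto simp: S_def)
    have bS1: "b \<in> S1 \<rightarrow> carrier M" and bS: "b \<in> S \<rightarrow> carrier M" using bM S(1,2) by auto
    have l1: "lc S1 c b' = lc S1 c b"
      by (rule lc_cong) (use cS1 bS1 S in \<open>auto simp: b'_def\<close>)
    have "lc S c b' = c 1 \<odot>\<^bsub>M\<^esub> b' 1 \<oplus>\<^bsub>M\<^esub> lc S1 c b'"
      unfolding S_def by (rule lc_insert) (use S(7,5) c b'M in \<open>auto simp: S_def\<close>)
    also have "\<dots> = (c 1 \<otimes> p) \<odot>\<^bsub>M\<^esub> b 2 \<oplus>\<^bsub>M\<^esub> (c 1 \<odot>\<^bsub>M\<^esub> w \<oplus>\<^bsub>M\<^esub> lc S1 c b)"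
      unfolding l1 using c1 p xw b2 lc_closed[OF cS1 bS1]
      by (simp add: b'_def smult_r_distr smult_assoc1 M.a_ac)
    also have "c 1 \<odot>\<^bsub>M\<^esub> w \<oplus>\<^bsub>M\<^esub> lc S1 c b = lc S c b"
      unfolding S_def b(2)[symmetric]
      by (rule lc_insert[symmetric]) (use S(7,5) c bS in \<open>auto simp: S_def\<close>)
    also have "lc S c b = lc S (c(2 := c 1 \<otimes> p)) b"
      by (rule lc_cong) (use S c c1 p bS in auto)
    also have "(c 1 \<otimes> p) \<odot>\<^bsub>M\<^esub> b 2 \<oplus>\<^bsub>M\<^esub> lc S (c(2 := c 1 \<otimes> p)) b = lc (insert 2 S) (c(2 := c 1 \<otimes> p)) b"
      using lc_insert[of S 2 "c(2 := c 1 \<otimes> p)" b] S c c1 p bS b2 by simp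
    finally show ?thesis .
  qed
  have shift_closed: "c(2 := c 1 \<otimes> p) \<in> insert 2 S \<rightarrow> carrier R" if "c \<in> S \<rightarrow> carrier R" for c
    using that p by (auto simp: S_def)
  have "indep S b'"
    unfolding indep_def
  proof (intro conjI ballI impI)
    fix c i assume c: "c \<in> S \<rightarrow> carrier R" "lc S c b' = \<zero>\<^bsub>M\<^esub>" "i \<in> S"
    have "(c(2 := c 1 \<otimes> p)) i = \<zero>"
      using indepD(3)[OF indep_subset[OF bJ S(3)] shift_closed[OF c(1)], of i] shift[OF c(1)] c(2,3) by simp
    then show "c i = \<zero>" using c(3) S(4) by (auto split: if_splits)
  qed (use S b'M in auto)
  then have V: "spn S b' \<in> free_subs n" using free_subsI cS by blast
  note Vs = submoduleE[OF free_subs_submodule[OF V]]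
  have "b' 0 \<in> spn S b'" "b' 1 \<in> spn S b'"
    using basis_mem_spn[OF S(8) b'M] by (auto simp: S_def S1_def)
  then have m: "x \<in> spn S b'" "w \<oplus>\<^bsub>M\<^esub> p \<odot>\<^bsub>M\<^esub> b 2 \<in> spn S b'" using b by (auto simp: b'_def)
  have "\<pi> [^] k \<odot>\<^bsub>M\<^esub> (w \<oplus>\<^bsub>M\<^esub> p \<odot>\<^bsub>M\<^esub> b 2) = \<pi> [^] k \<odot>\<^bsub>M\<^esub> w"
    using p b2 xw by (simp add: smult_r_distr smult_assoc1[symmetric])
  then have "\<pi> [^] k \<odot>\<^bsub>M\<^esub> w \<in> spn S b'" using Vs(4)[OF _ m(2), of "\<pi> [^] k"] by simp
  then have "z \<in> spn S b'" using all'[OF V m(1)] by blast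
  then obtain c where c: "c \<in> S \<rightarrow> carrier R" "z = lc S c b'" by (elim spnE)
  have eq: "lc J \<zeta> b = lc (insert 2 S) (c(2 := c 1 \<otimes> p)) b" using \<zeta>(2) c(2) shift[OF c(1)] by simp
  have "\<zeta> 1 = c 1" "\<zeta> 2 = c 1 \<otimes> p"
    using spn_coord_zero(1)[OF bJ S(3) \<zeta>(1) eq shift_closed[OF c(1)], of 1]
      spn_coord_zero(1)[OF bJ S(3) \<zeta>(1) eq shift_closed[OF c(1)], of 2] by (auto simp: S_def)
  \<comment> \<open>The coefficient of z at index 2 is 0 by the coordinate submodules above, while
    in the perturbed submodule it is p times the coefficient of w.\<close>
  then have "\<pi> [^] (r - k) \<otimes> \<zeta> 1 = \<zero>" using z2[of 2] \<open>2 \<in> J\<close> p(1) \<zeta>01 by (simp add: m_comm p_def)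
  then have "\<zeta> 1 \<in> pideal k" using pow_annihilator[OF \<zeta>01(2), of "r - k"] k(1) by simp
  then obtain t where t: "t \<in> carrier R" "\<zeta> 1 = \<pi> [^] k \<otimes> t" by (elim pidealE)
  have "z = \<zeta> 0 \<odot>\<^bsub>M\<^esub> x \<oplus>\<^bsub>M\<^esub> t \<odot>\<^bsub>M\<^esub> (\<pi> [^] k \<odot>\<^bsub>M\<^esub> w)"
    unfolding zz t(2) using t(1) xw \<zeta>01 by (simp add: m_comm smult_assoc1)
  moreover have sm: "submodule (span2 x y) R M" by (rule submodule_span2[OF xw(1) y])
  moreover have "\<pi> [^] k \<odot>\<^bsub>M\<^esub> w \<in> span2 x y"
    using add_mem_iff[OF sm, of "\<alpha> \<odot>\<^bsub>M\<^esub> x" "\<pi> [^] k \<odot>\<^bsub>M\<^esub> w"] k(2,4) xw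
      left_mem_span2[OF xw(1) y] right_mem_span2[OF xw(1) y] submoduleE(4)[OF sm] by simp
  ultimately show ?thesis
    using submoduleE(4,5)[OF sm] left_mem_span2[OF xw(1) y] \<zeta>01(1) t(1) by simp
qed

lemma coll_iff:
  assumes x: "unimod x" and y: "unimod y" and z: "unimod z" and n: "2 \<le> n" "n < d"
  shows "coll (free_subs n) (line x) (line y) (line z) \<longleftrightarrow> z \<in> span2 x y"
proof -
  note M = unimodD(1)[OF x] unimodD(1)[OF y] unimodD(1)[OF z]
  have "coll (free_subs n) (line x) (line y) (line z)
      \<longleftrightarrow> (\<forall>V\<in>free_subs n. x \<in> V \<and> y \<in> V \<longrightarrow> z \<in> V)"
    unfolding coll_def using line_subset_iff[OF free_subs_submodule] M by simp
  also have "\<dots> \<longleftrightarrow> z \<in> span2 x y"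
    using mem_span2_of_coll[OF x M(2,3) n] span2_subset[OF free_subs_submodule] by blast
  finally show ?thesis .
qed

text \<open>For y = \<alpha> x + \<pi>^k w, maximality applied to x and w puts w into the span of x
  and y, which makes \<pi>^k a unit, so k = 0. Conversely the span of an independent pair has |R|^2
  elements, the largest size possible for two generators.\<close>

lemma distant_iff:
  assumes x: "unimod x" and y: "unimod y" and n: "2 \<le> n" "n < d"
  shows "distant (free_subs 1) (free_subs n) (line x) (line y) \<longleftrightarrow> indep2 x y"
proof
  note M = unimodD(1)[OF x] unimodD(1)[OF y]
  assume dist: "distant (free_subs 1) (free_subs n) (line x) (line y)"
  obtain k \<alpha> w where k: "k \<le> r" "\<alpha> \<in> carrier R" "indep2 x w" "y = \<alpha> \<odot>\<^bsub>M\<^esub> x \<oplus>\<^bsub>M\<^esub> \<pi> [^] k \<odot>\<^bsub>M\<^esub> w"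
    using level_decomposition[OF x M(2)] n by auto
  note w = indep2_unimod(2)[OF k(3)] indep2D(2)[OF k(3)]
  have "x \<in> span2 x w" "y \<in> span2 x w"
    unfolding k(4) using left_mem_span2[OF M(1) w(2)] span2I[OF k(2), of "\<pi> [^] k" x w] by simp_all
  then have "w \<in> span2 x y"
    using dist coll_iff[OF x w(1) x n] coll_iff[OF x w(1) y n] coll_iff[OF x y w(1) n]
      line_free_sub[OF x] line_free_sub[OF w(1)] unfolding distant_def by blast
  then obtain a c where ac: "a \<in> carrier R" "c \<in> carrier R" "w = a \<odot>\<^bsub>M\<^esub> x \<oplus>\<^bsub>M\<^esub> c \<odot>\<^bsub>M\<^esub> y" by (elim span2E)
  have "(a \<oplus> c \<otimes> \<alpha>) \<odot>\<^bsub>M\<^esub> x \<oplus>\<^bsub>M\<^esub> (c \<otimes> \<pi> [^] k) \<odot>\<^bsub>M\<^esub> w = a \<odot>\<^bsub>M\<^esub> x \<oplus>\<^bsub>M\<^esub> c \<odot>\<^bsub>M\<^esub> y"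
    unfolding k(4) using ac(1,2) k(2) M(1) w(2)
    by (simp add: smult_r_distr smult_l_distr smult_assoc1 M.a_assoc)
  then have eq: "(a \<oplus> c \<otimes> \<alpha>) \<odot>\<^bsub>M\<^esub> x \<oplus>\<^bsub>M\<^esub> (c \<otimes> \<pi> [^] k) \<odot>\<^bsub>M\<^esub> w = w" using ac(3) by simp
  have "(a \<oplus> c \<otimes> \<alpha>) \<odot>\<^bsub>M\<^esub> x \<oplus>\<^bsub>M\<^esub> (c \<otimes> \<pi> [^] k \<oplus> \<ominus> \<one>) \<odot>\<^bsub>M\<^esub> w
      = ((a \<oplus> c \<otimes> \<alpha>) \<odot>\<^bsub>M\<^esub> x \<oplus>\<^bsub>M\<^esub> (c \<otimes> \<pi> [^] k) \<odot>\<^bsub>M\<^esub> w) \<oplus>\<^bsub>M\<^esub> \<ominus>\<^bsub>M\<^esub> w"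
    using ac(1,2) k(2) M(1) w(2) by (simp add: smult_l_distr[of "c \<otimes> \<pi> [^] k"] smult_l_minus M.a_assoc)
  also have "\<dots> = \<zero>\<^bsub>M\<^esub>" unfolding eq using w(2) by (rule M.r_neg)
  finally have "c \<otimes> \<pi> [^] k \<oplus> \<ominus> \<one> = \<zero>"
    using indep2D(4)[OF k(3), of "a \<oplus> c \<otimes> \<alpha>" "c \<otimes> \<pi> [^] k \<oplus> \<ominus> \<one>"] ac(1,2) k(2) by simp
  then have one: "\<pi> [^] k \<otimes> c = \<one>" using ac by (simp add: a_minus_def[symmetric] m_comm)
  have "k = 0"
  proof (rule ccontr)
    assume "k \<noteq> 0"
    then have "\<one> \<in> pideal 1" using pidealI[OF ac(2), of k] one pideal_antimono[of 1 k] by auto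
    then show False using unit_not_pideal[of \<one>] by simp
  qed
  then have y': "y = \<alpha> \<odot>\<^bsub>M\<^esub> x \<oplus>\<^bsub>M\<^esub> w" using k(4) w by simp
  have "a = \<zero> \<and> c = \<zero>" if ac: "a \<in> carrier R" "c \<in> carrier R" "a \<odot>\<^bsub>M\<^esub> x \<oplus>\<^bsub>M\<^esub> c \<odot>\<^bsub>M\<^esub> y = \<zero>\<^bsub>M\<^esub>" for a c
  proof -
    have "(a \<oplus> c \<otimes> \<alpha>) \<odot>\<^bsub>M\<^esub> x \<oplus>\<^bsub>M\<^esub> c \<odot>\<^bsub>M\<^esub> w = \<zero>\<^bsub>M\<^esub>"
      using ac k(2) M w unfolding y' by (simp add: smult_r_distr smult_l_distr smult_assoc1 M.a_assoc)
    then have "c = \<zero>" "a \<oplus> c \<otimes> \<alpha> = \<zero>"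
      using indep2D(3,4)[OF k(3), of "a \<oplus> c \<otimes> \<alpha>" c] ac k(2) by simp_all
    then show ?thesis using ac k(2) by simp
  qed
  then show "indep2 x y" by (intro indep2I M)
next
  note M = unimodD(1)[OF x] unimodD(1)[OF y]
  assume xy: "indep2 x y"
  show "distant (free_subs 1) (free_subs n) (line x) (line y)"
    unfolding distant_def
  proof (intro ballI impI)
    fix A B assume "A \<in> free_subs 1" "B \<in> free_subs 1"
    then obtain z w where z: "unimod z" "A = line z" and w: "unimod w" "B = line w" by (meson pointE)
    note zw = unimodD(1)[OF z(1)] unimodD(1)[OF w(1)]
    assume "coll (free_subs n) A B (line x) \<and> coll (free_subs n) A B (line y)"
    then have "x \<in> span2 z w" "y \<in> span2 z w"
      unfolding z(2) w(2) using coll_iff[OF z(1) w(1) x n] coll_iff[OF z(1) w(1) y n] by simp_all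
    then have sub: "span2 x y \<subseteq> span2 z w" by (rule span2_subset[OF submodule_span2[OF zw]])
    have "span2 x y = span2 z w"
      by (rule card_seteq[OF finite_span2 sub]) (use card_span2[OF xy] card_span2_le in simp)
    then have "z \<in> span2 x y" "w \<in> span2 x y" using left_mem_span2[OF zw] right_mem_span2[OF zw] by simp_all
    then show "coll (free_subs n) (line x) (line y) A \<and> coll (free_subs n) (line x) (line y) B"
      unfolding z(2) w(2) using coll_iff[OF x y z(1) n] coll_iff[OF x y w(1) n] by simp
  qed
qed

end

text \<open>Inside \<open>chain_module\<close> the unqualified names of these laws refer to the module.\<close>

lemma (in chain_ring) base_comm: "\<lbrakk>x \<in> carrier R; y \<in> carrier R\<rbrakk> \<Longrightarrow> x \<oplus> y = y \<oplus> x"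
  by (rule a_comm)

lemma (in chain_ring) base_neg:
  assumes "x \<in> carrier R" shows "\<ominus> x \<oplus> x = \<zero>" "x \<oplus> \<ominus> x = \<zero>"
  using assms by (simp_all add: l_neg r_neg)

context chain_module
begin

section \<open>The translation configuration over a chain ring\<close>

lemma unit_uminus:
  assumes "u \<in> Units R" shows "\<ominus> u \<in> Units R"
proof (rule ccontr)
  have u: "u \<in> carrier R" using assms by (rule Units_closed)
  assume "\<ominus> u \<notin> Units R"
  then have "\<ominus> (\<ominus> u) \<in> pideal 1" using unit_or_pideal[of "\<ominus> u"] u pideal_minus by blast
  then show False using unit_not_pideal[OF assms] u by simp
qed

lemma sum_zero_minus:
  assumes "a \<in> carrier R" "b \<in> carrier R" "\<zero> = a \<oplus> b" shows "b = \<ominus> a"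
proof -
  have "b = \<ominus> a \<oplus> (a \<oplus> b)" using assms(1,2) by algebra
  then show ?thesis unfolding assms(3)[symmetric] using assms(1) by simp
qed

lemma indep3_of_indep:
  assumes "indep {i, j, k} b" "i \<noteq> j" "i \<noteq> k" "j \<noteq> k"
  shows "indep3 (b i) (b j) (b k)"
proof -
  note bD = indepD[OF assms(1)]
  have M: "b i \<in> carrier M" "b j \<in> carrier M" "b k \<in> carrier M" using bD(2) by auto
  have "a = \<zero> \<and> b' = \<zero> \<and> c = \<zero>"
    if abc: "a \<in> carrier R" "b' \<in> carrier R" "c \<in> carrier R" "tri (b i) (b j) (b k) a b' c = \<zero>\<^bsub>M\<^esub>" for a b' c
  proof -
    define f where "f l = (if l = i then a else if l = j then b' else c)" for l
    have f: "f i = a" "f j = b'" "f k = c" using assms by (simp_all add: f_def)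
    have fc: "f \<in> {i, j, k} \<rightarrow> carrier R" using abc f by simp
    have "lc {i, j, k} f b = \<zero>\<^bsub>M\<^esub>"
      using lc_three[OF assms(2-4), of f b] abc f M by (simp add: tri_def)
    then have "f i = \<zero>" "f j = \<zero>" "f k = \<zero>" using bD(3)[OF fc] by blast+
    then show ?thesis using f by simp
  qed
  then show ?thesis using M unfolding indep3_def by blast
qed

end

context free_chain_module
begin

text \<open>The line through E and S consists of E, as point at infinity, the affine points
  [s : 0 : 1] with origin S, and further points that agree with E modulo \<pi>. Since [s : 1 : 0] =
  [s : 0 : 1] - C and [s + 1 : 0 : 1] = C' + [s : 1 : 0], the two perspectivities add 1 to s, and
  the orbit of S closes because m times 1 is 0.\<close>

lemma translation_config_exists:
  assumes n: "2 \<le> n" "n < d" and m: "[m] \<cdot> \<one> = \<zero>"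
  obtains E S U C C' f g where "translation_config (free_subs 1) (free_subs n) m E S U C C' f g"
proof -
  obtain b where b: "indep {..<d} b"
    by (rule free_subs_basis[OF carrier_free finite_lessThan card_lessThan])
  have "indep {0, 1, 2} b" by (rule indep_subset[OF b]) (use n in auto)
  then have i3: "indep3 (b 0) (b 1) (b 2)" by (rule indep3_of_indep) auto
  define t where "t = tri (b 0) (b 1) (b 2)"
  note tri = tri_closed[OF i3, folded t_def] tri_add[OF i3, folded t_def] tri_smult[OF i3, folded t_def]
  note tri_unimod = tri_unimod[OF i3, folded t_def] and tri_indep2 = tri_indep2[OF i3, folded t_def]
  define s where "s i = [i] \<cdot> \<one>" for i :: nat
  have s: "s 0 = \<zero>" "s m = \<zero>" "\<And>i. s i \<in> carrier R" "\<And>i. s (Suc i) = s i \<oplus> \<one>"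
    using m by (simp_all add: s_def)
  let ?E = "t \<one> \<zero> \<zero>" and ?U = "t \<zero> \<one> \<zero>" and ?S = "t \<zero> \<zero> \<one>"
    and ?C = "t \<zero> (\<ominus> \<one>) \<one>" and ?C' = "t \<one> (\<ominus> \<one>) \<one>"
  let ?f = "\<lambda>i. t (s i) \<zero> \<one>" and ?g = "\<lambda>i. t (s i) \<one> \<zero>"
  have u: "unimod ?E" "unimod ?U" "unimod ?S" "unimod ?C" "unimod ?C'"
    "\<And>i. unimod (?f i)" "\<And>i. unimod (?g i)"
    by (rule tri_unimod; simp add: s(3))+
  note colli = coll_iff[OF _ _ _ n] and disti = distant_iff[OF _ _ n]
  have nn: "\<ominus> \<one> \<oplus> \<one> = \<zero>" "\<one> \<oplus> \<ominus> \<one> = \<zero>" by (simp_all add: base_neg)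
  have SU: "indep2 ?S ?U" by (rule tri_indep2) simp_all
  \<comment> \<open>Points of the line through S and U have first coordinate 0, so a relation with E
    splits into one for w alone and one for E alone.\<close>
  have wE: "indep2 w ?E" if w: "unimod w" "w \<in> span2 ?S ?U" for w
  proof -
    obtain a c where ac: "a \<in> carrier R" "c \<in> carrier R" "w = a \<odot>\<^bsub>M\<^esub> ?S \<oplus>\<^bsub>M\<^esub> c \<odot>\<^bsub>M\<^esub> ?U"
      using w(2) by (elim span2E)
    then have w': "w = t \<zero> c a" using tri by simp
    show ?thesis
      unfolding w'
    proof (rule tri_indep2)
      fix s' t' assume st: "s' \<in> carrier R" "t' \<in> carrier R" "s' \<otimes> \<zero> \<oplus> t' \<otimes> \<one> = \<zero>"
        "s' \<otimes> c \<oplus> t' \<otimes> \<zero> = \<zero>" "s' \<otimes> a \<oplus> t' \<otimes> \<zero> = \<zero>"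
      have "s' \<odot>\<^bsub>M\<^esub> w = t \<zero> \<zero> \<zero>" unfolding w' using st ac tri by simp
      also have "\<dots> = \<zero>\<^bsub>M\<^esub>" using tri_zero[OF i3] by (simp add: t_def)
      finally have "s' = \<zero>" using unimodD(2)[OF w(1) st(1)] by simp
      moreover have "t' = \<zero>" using st(1-3) by simp
      ultimately show "s' = \<zero> \<and> t' = \<zero>" by simp
    qed (use ac in simp_all)
  qed
  have CS: "indep2 ?C ?S" by (rule tri_indep2) (simp_all add: r_minus)
  have CU: "indep2 ?C ?U" by (rule tri_indep2) (simp_all add: r_minus)
  have C'E: "indep2 ?C' ?E" by (rule tri_indep2) (simp_all add: r_minus)
  have C'C: "indep2 ?C' ?C"
  proof (rule tri_indep2)
    fix s t assume "s \<in> carrier R" "t \<in> carrier R" "s \<otimes> \<one> \<oplus> t \<otimes> \<zero> = \<zero>" "s \<otimes> \<one> \<oplus> t \<otimes> \<one> = \<zero>"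
    then show "s = \<zero> \<and> t = \<zero>" by simp
  qed simp_all
  have C: "?C \<in> span2 ?S ?U" using span2I[of \<one> "\<ominus> \<one>" ?S ?U] tri by simp
  have C': "?C' \<in> span2 ?E ?C" using span2I[of \<one> \<one> ?E ?C] tri by simp
  have f: "?f i \<in> span2 ?E ?S" for i using span2I[of "s i" \<one> ?E ?S] tri s(3) by simp
  have g: "?g i \<in> span2 ?E ?U" for i using span2I[of "s i" \<one> ?E ?U] tri s(3) by simp
  have Cf: "?g i \<in> span2 ?C (?f i)" for i
    using span2I[of "\<ominus> \<one>" \<one> ?C "?f i"] tri s(3) by (simp add: l_minus r_minus nn)
  have Cg: "?f (Suc i) \<in> span2 ?C' (?g i)" for i
    using span2I[of \<one> \<one> ?C' "?g i"] tri s(3,4) by (simp add: nn base_comm)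
  have wE': "distant (free_subs 1) (free_subs n) w (line ?E)"
      if "w \<in> free_subs 1" "coll (free_subs n) (line ?S) (line ?U) w" for w
    using that pointE[OF that(1)] colli[OF u(3,2)] wE disti[OF _ u(1)] by metis
  have "translation_config (free_subs 1) (free_subs n) m (line ?E) (line ?S) (line ?U) (line ?C)
      (line ?C') (\<lambda>i. line (?f i)) (\<lambda>i. line (?g i))"
    unfolding translation_config_def
    using u colli disti SU CS CU C'E C'C C C' f g Cf Cg line_free_sub s(1,2) wE' by simp
  then show thesis by (rule that)
qed

text \<open>Distance speaks about points, but in a relation the part b y + c z need not be
  unimodular. Taking out a power \<pi>^k leaves a point v of the line through y and z, and in
  \<pi>^k v + a x = 0 independence of v and x makes both scalars vanish.\<close>

lemma indep3_of_distant:
  assumes n: "2 \<le> n" "n < d" and x: "unimod x" and yz: "indep2 y z"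
    and w: "\<And>w. w \<in> free_subs 1 \<Longrightarrow> coll (free_subs n) (line y) (line z) w \<Longrightarrow>
      distant (free_subs 1) (free_subs n) w (line x)"
  shows "indep3 x y z"
proof -
  note M = unimodD(1)[OF x] indep2D(1,2)[OF yz]
  have "a = \<zero> \<and> b = \<zero> \<and> c = \<zero>"
    if abc: "a \<in> carrier R" "b \<in> carrier R" "c \<in> carrier R" "tri x y z a b c = \<zero>\<^bsub>M\<^esub>" for a b c
  proof -
    define \<zeta> where "\<zeta> i = (if i = (0::nat) then b else c)" for i
    obtain k \<xi> where k: "k \<le> r" "\<xi> \<in> {0, 1} \<rightarrow> carrier R" "\<And>i. i \<in> {0, 1} \<Longrightarrow> \<zeta> i = \<pi> [^] k \<otimes> \<xi> i"
      "\<exists>i\<in>{0, 1}. \<xi> i \<in> Units R"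
      by (rule common_valuation[of "{0, 1}" \<zeta>]) (use abc in \<open>auto simp: \<zeta>_def\<close>)
    have xi: "\<xi> 0 \<in> carrier R" "\<xi> 1 \<in> carrier R" "b = \<pi> [^] k \<otimes> \<xi> 0" "c = \<pi> [^] k \<otimes> \<xi> 1"
      using k(2) k(3)[of 0] k(3)[of 1] by (auto simp: \<zeta>_def)
    define v where "v = \<xi> 0 \<odot>\<^bsub>M\<^esub> y \<oplus>\<^bsub>M\<^esub> \<xi> 1 \<odot>\<^bsub>M\<^esub> z"
    have vM: "v \<in> carrier M" using xi M by (simp add: v_def)
    have v: "unimod v"
      unfolding unimod_def
    proof (intro conjI ballI impI vM)
      fix e assume e: "e \<in> carrier R" "e \<odot>\<^bsub>M\<^esub> v = \<zero>\<^bsub>M\<^esub>"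
      then have "(e \<otimes> \<xi> 0) \<odot>\<^bsub>M\<^esub> y \<oplus>\<^bsub>M\<^esub> (e \<otimes> \<xi> 1) \<odot>\<^bsub>M\<^esub> z = \<zero>\<^bsub>M\<^esub>"
        using xi M by (simp add: v_def smult_r_distr smult_assoc1)
      then have "e \<otimes> \<xi> 0 = \<zero>" "e \<otimes> \<xi> 1 = \<zero>"
        using indep2D(3,4)[OF yz, of "e \<otimes> \<xi> 0" "e \<otimes> \<xi> 1"] xi e by simp_all
      then show "e = \<zero>" using k(4) unit_mult_eq_zero_iff[OF _ e(1)] by auto
    qed
    have "v \<in> span2 y z" unfolding v_def using span2I xi by simp
    then have "indep2 v x"
      using w[OF line_free_sub[OF v]] coll_iff[OF indep2_unimod[OF yz] v n] distant_iff[OF v x n] by simp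
    moreover have "\<pi> [^] k \<odot>\<^bsub>M\<^esub> v \<oplus>\<^bsub>M\<^esub> a \<odot>\<^bsub>M\<^esub> x = \<zero>\<^bsub>M\<^esub>"
      using abc(4) xi M abc(1) unfolding tri_def v_def
      by (simp add: smult_r_distr smult_assoc1 M.a_ac)
    ultimately have "\<pi> [^] k = \<zero>" "a = \<zero>"
      using indep2D(3,4)[of v x "\<pi> [^] k" a] abc(1) by simp_all
    then show ?thesis using xi by simp
  qed
  then show ?thesis using M unfolding indep3_def by blast
qed

lemma indep3_scale:
  assumes i3: "indep3 x y z" and u: "u \<in> Units R" "v \<in> Units R" "w \<in> Units R"
  shows "indep3 (u \<odot>\<^bsub>M\<^esub> x) (v \<odot>\<^bsub>M\<^esub> y) (w \<odot>\<^bsub>M\<^esub> z)"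
proof -
  note M = indep3D(1-3)[OF i3] and c = Units_closed[OF u(1)] Units_closed[OF u(2)] Units_closed[OF u(3)]
  have "a = \<zero> \<and> b = \<zero> \<and> e = \<zero>"
    if abc: "a \<in> carrier R" "b \<in> carrier R" "e \<in> carrier R"
      "tri (u \<odot>\<^bsub>M\<^esub> x) (v \<odot>\<^bsub>M\<^esub> y) (w \<odot>\<^bsub>M\<^esub> z) a b e = \<zero>\<^bsub>M\<^esub>" for a b e
  proof -
    have "tri x y z (a \<otimes> u) (b \<otimes> v) (e \<otimes> w) = \<zero>\<^bsub>M\<^esub>"
      using abc M c by (simp add: tri_def smult_assoc1)
    then have "a \<otimes> u = \<zero>" "b \<otimes> v = \<zero>" "e \<otimes> w = \<zero>"
      using indep3D(4-6)[OF i3, of "a \<otimes> u" "b \<otimes> v" "e \<otimes> w"] abc c by simp_all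
    then show ?thesis
      using unit_mult_eq_zero_iff[OF u(1) abc(1)] unit_mult_eq_zero_iff[OF u(2) abc(2)]
        unit_mult_eq_zero_iff[OF u(3) abc(3)] by simp
  qed
  moreover have "u \<odot>\<^bsub>M\<^esub> x \<in> carrier M" "v \<odot>\<^bsub>M\<^esub> y \<in> carrier M" "w \<odot>\<^bsub>M\<^esub> z \<in> carrier M" using M c by simp_all
  ultimately show ?thesis unfolding indep3_def by blast
qed

text \<open>Generators are rescaled until C and C' are [0 : -1 : 1] and [1 : -1 : 1]. Incidence then
  forces f i = [i : 0 : 1], with i read as a multiple of 1, so the return to S says that m times 1
  is 0.\<close>

lemma translation_config_imp:
  assumes n: "2 \<le> n" "n < d" and cl: "translation_config (free_subs 1) (free_subs n) m E0 S0 U0 C0 C0' f g"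
  shows "[m] \<cdot> \<one> = \<zero>"
proof -
  note colli = coll_iff[OF _ _ _ n] and disti = distant_iff[OF _ _ n]
  have P: "E0 \<in> free_subs 1" "S0 \<in> free_subs 1" "U0 \<in> free_subs 1"
      "C0 \<in> free_subs 1" "C0' \<in> free_subs 1"
    and SU0: "distant (free_subs 1) (free_subs n) S0 U0"
    and wE: "\<forall>w\<in>free_subs 1. coll (free_subs n) S0 U0 w \<longrightarrow> distant (free_subs 1) (free_subs n) w E0"
    and C0: "coll (free_subs n) S0 U0 C0" "distant (free_subs 1) (free_subs n) C0 S0"
      "distant (free_subs 1) (free_subs n) C0 U0"
    and C0': "coll (free_subs n) E0 C0 C0'" "distant (free_subs 1) (free_subs n) C0' E0"
      "distant (free_subs 1) (free_subs n) C0' C0"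
    and f0: "f 0 = S0" and fm: "f m = S0"
    and f: "\<forall>i\<le>m. f i \<in> free_subs 1 \<and> coll (free_subs n) E0 S0 (f i)"
    and g: "\<forall>i<m. g i \<in> free_subs 1 \<and> coll (free_subs n) E0 U0 (g i) \<and>
      coll (free_subs n) C0 (f i) (g i) \<and> coll (free_subs n) C0' (g i) (f (Suc i))"
    using cl unfolding translation_config_def by simp_all
  obtain x where x: "unimod x" "E0 = line x" using P(1) by (elim pointE)
  obtain y where y: "unimod y" "U0 = line y" using P(3) by (elim pointE)
  obtain z where z: "unimod z" "S0 = line z" using P(2) by (elim pointE)
  obtain c where c: "unimod c" "C0 = line c" using P(4) by (elim pointE)
  obtain c' where c': "unimod c'" "C0' = line c'" using P(5) by (elim pointE)
  note M = unimodD(1)[OF x(1)] unimodD(1)[OF y(1)] unimodD(1)[OF z(1)]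
  have zy: "indep2 z y" using SU0 disti[OF z(1) y(1)] by (simp add: y z)
  have xzy: "indep3 x z y"
    by (rule indep3_of_distant[OF n x(1) zy]) (use wE in \<open>simp add: x y z\<close>)
  have "c \<in> span2 z y" using C0(1) colli[OF z(1) y(1) c(1)] by (simp add: c y z)
  then obtain \<alpha> \<beta> where ab: "\<alpha> \<in> carrier R" "\<beta> \<in> carrier R" "c = \<alpha> \<odot>\<^bsub>M\<^esub> z \<oplus>\<^bsub>M\<^esub> \<beta> \<odot>\<^bsub>M\<^esub> y"
    by (elim span2E)
  have "indep2 c z" "indep2 c y"
    using C0(2,3) disti[OF c(1) z(1)] disti[OF c(1) y(1)] by (simp_all add: c y z)
  \<comment> \<open>Distance of C from S and from U makes both of its coordinates on their line
    units.\<close>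
  then have \<beta>: "\<beta> \<in> Units R" and \<alpha>: "\<alpha> \<in> Units R"
    using unit_coeff[of z y \<alpha> \<beta>] unit_coeff[of y z \<beta> \<alpha>] M ab M.a_comm by auto
  have "c' \<in> span2 x c" using C0'(1) colli[OF x(1) c(1) c'(1)] by (simp add: c c' x)
  then obtain \<nu> \<mu> where lm: "\<nu> \<in> carrier R" "\<mu> \<in> carrier R" "c' = \<nu> \<odot>\<^bsub>M\<^esub> x \<oplus>\<^bsub>M\<^esub> \<mu> \<odot>\<^bsub>M\<^esub> c"
    by (elim span2E)
  note cM = unimodD(1)[OF c(1)]
  have "indep2 c' x" "indep2 c' c"
    using C0'(2,3) disti[OF c'(1) x(1)] disti[OF c'(1) c(1)] by (simp_all add: c c' x)
  then have \<mu>: "\<mu> \<in> Units R" and \<nu>: "\<nu> \<in> Units R"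
    using unit_coeff[of x c \<nu> \<mu>] unit_coeff[of c x \<mu> \<nu>] M cM lm M.a_comm by auto
  \<comment> \<open>The scaling is chosen so that c = e3 - e2 and c' is a unit multiple of e1 +
    c.\<close>
  define e1 where "e1 = (inv \<mu> \<otimes> \<nu>) \<odot>\<^bsub>M\<^esub> x"
  define e2 where "e2 = (\<ominus> \<beta>) \<odot>\<^bsub>M\<^esub> y"
  define e3 where "e3 = \<alpha> \<odot>\<^bsub>M\<^esub> z"
  have nb: "\<ominus> \<beta> \<in> Units R" using \<beta> by (rule unit_uminus)
  have ml: "inv \<mu> \<otimes> \<nu> \<in> Units R" using \<mu> \<nu> by simp
  have "indep3 e1 e3 e2" unfolding e1_def e2_def e3_def by (rule indep3_scale[OF xzy ml \<alpha> nb])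
  then have i3: "indep3 e1 e2 e3"
    unfolding indep3_def tri_def by (metis M.a_comm smult_closed)
  define t where "t = tri e1 e2 e3"
  note tri = tri_closed[OF i3, folded t_def] tri_add[OF i3, folded t_def] tri_smult[OF i3, folded t_def]
  note tri_unimod = tri_unimod[OF i3, folded t_def] and tri_eqD = tri_eqD[OF i3, folded t_def]
  have lines: "line e1 = line x" "line e2 = line y" "line e3 = line z"
    unfolding e1_def e2_def e3_def using line_unit_mult[OF ml M(1)] line_unit_mult[OF nb M(2)]
      line_unit_mult[OF \<alpha> M(3)] by simp_all
  note eM = indep3D(1-3)[OF i3]
  have te: "t \<one> \<zero> \<zero> = e1" "t \<zero> \<one> \<zero> = e2" "t \<zero> \<zero> \<one> = e3"
    unfolding t_def tri_def using eM by simp_all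
  have u: "unimod e1" "unimod e2" "unimod e3"
    using tri_unimod[of \<one> \<zero> \<zero>] tri_unimod[of \<zero> \<one> \<zero>] tri_unimod[of \<zero> \<zero> \<one>] te by simp_all
  have "t \<zero> (\<ominus> \<one>) \<one> = e3 \<oplus>\<^bsub>M\<^esub> (\<ominus> \<one>) \<odot>\<^bsub>M\<^esub> e2"
    unfolding t_def tri_def using eM by (simp add: M.a_comm)
  also have "(\<ominus> \<one>) \<odot>\<^bsub>M\<^esub> e2 = \<beta> \<odot>\<^bsub>M\<^esub> y"
    unfolding e2_def using M ab by (simp add: smult_assoc1[symmetric] l_minus r_minus)
  finally have tc: "t \<zero> (\<ominus> \<one>) \<one> = c" using ab(3) by (simp add: e3_def)
  have iM: "inv \<mu> \<in> carrier R" "inv \<mu> \<otimes> \<mu> = \<one>" using \<mu> by simp_all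
  have "inv \<mu> \<odot>\<^bsub>M\<^esub> c' = e1 \<oplus>\<^bsub>M\<^esub> c"
    unfolding lm(3) e1_def using M cM lm(1,2) iM by (simp add: smult_r_distr smult_assoc1[symmetric])
  also have "\<dots> = t \<one> (\<ominus> \<one>) \<one>"
    unfolding te(1)[symmetric] tc[symmetric] using tri by simp
  finally have tc': "t \<one> (\<ominus> \<one>) \<one> = inv \<mu> \<odot>\<^bsub>M\<^esub> c'" by simp
  have lc': "line (t \<one> (\<ominus> \<one>) \<one>) = line c'"
    unfolding tc' using line_unit_mult[of "inv \<mu>" c'] \<mu> unimodD(1)[OF c'(1)] by simp
  have uc': "unimod (t \<one> (\<ominus> \<one>) \<one>)" by (rule tri_unimod) simp_all
  define s where "s i = [i] \<cdot> \<one>" for i :: nat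
  have s: "s 0 = \<zero>" "\<And>i. s i \<in> carrier R" "\<And>i. s (Suc i) = s i \<oplus> \<one>"
    by (simp_all add: s_def)
  have fi: "i \<le> m \<Longrightarrow> f i = line (t (s i) \<zero> \<one>)" for i
  proof (induction i)
    case 0
    show ?case using f0 te lines z by (simp add: s)
  next
    case (Suc i)
    then have i: "i < m" and IH: "f i = line (t (s i) \<zero> \<one>)" by auto
    have uF: "unimod (t (s i) \<zero> \<one>)" and uG: "unimod (t (s i) \<one> \<zero>)" and uF': "unimod (t (s (Suc i)) \<zero> \<one>)"
      using tri_unimod s by simp_all
    obtain v where v: "unimod v" "g i = line v" using g i pointE by metis
    have "v \<in> span2 e1 e2" "v \<in> span2 c (t (s i) \<zero> \<one>)"
      using g i colli[OF u(1,2) v(1)] colli[OF c(1) uF v(1)] IH v(2) x y c lines by auto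
    then obtain a b a' b' where v2: "a \<in> carrier R" "b \<in> carrier R" "v = a \<odot>\<^bsub>M\<^esub> e1 \<oplus>\<^bsub>M\<^esub> b \<odot>\<^bsub>M\<^esub> e2"
      "a' \<in> carrier R" "b' \<in> carrier R" "v = a' \<odot>\<^bsub>M\<^esub> c \<oplus>\<^bsub>M\<^esub> b' \<odot>\<^bsub>M\<^esub> t (s i) \<zero> \<one>"
      by (meson span2E)
    \<comment> \<open>v is expressed on each of the two lines that meet in \<open>g i\<close>;
      comparing coordinates gives v as b' times [s i : 1 : 0].\<close>
    have v3: "v = t a b \<zero>" using v2(1-3) unfolding te[symmetric] by (simp add: tri)
    have v4: "v = t (b' \<otimes> s i) (\<ominus> a') (a' \<oplus> b')"
      using v2(4-6) s(2) unfolding tc[symmetric] by (simp add: tri r_minus)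
    have "\<zero> = a' \<oplus> b'" "a = b' \<otimes> s i" "b = \<ominus> a'"
      using tri_eqD[of a b \<zero> "b' \<otimes> s i" "\<ominus> a'" "a' \<oplus> b'"] v2 s(2) v3 v4 by simp_all
    then have "b' = b" using v2 sum_zero_minus by simp
    then have "v = b' \<odot>\<^bsub>M\<^esub> t (s i) \<one> \<zero>"
      using v3 \<open>a = _\<close> \<open>b = _\<close> v2 s(2) by (simp add: tri)
    then have "v \<in> line (t (s i) \<one> \<zero>)" using v2 by (auto simp: line_def)
    then have gi: "g i = line (t (s i) \<one> \<zero>)" using line_eq_if_mem[OF uG v(1)] v(2) by simp
    obtain w where w: "unimod w" "f (Suc i) = line w" using f i pointE by (metis Suc_leI)
    have "coll (free_subs n) E0 S0 (f (Suc i))" "coll (free_subs n) C0' (g i) (f (Suc i))"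
      using f g i by simp_all
    then have "w \<in> span2 e1 e3" "w \<in> span2 (t \<one> (\<ominus> \<one>) \<one>) (t (s i) \<one> \<zero>)"
      using colli[OF u(1,3) w(1)] colli[OF uc' uG w(1)] gi w(2) x z c' lines lc' by auto
    then obtain a b a' b' where w2: "a \<in> carrier R" "b \<in> carrier R" "w = a \<odot>\<^bsub>M\<^esub> e1 \<oplus>\<^bsub>M\<^esub> b \<odot>\<^bsub>M\<^esub> e3"
      "a' \<in> carrier R" "b' \<in> carrier R" "w = a' \<odot>\<^bsub>M\<^esub> t \<one> (\<ominus> \<one>) \<one> \<oplus>\<^bsub>M\<^esub> b' \<odot>\<^bsub>M\<^esub> t (s i) \<one> \<zero>"
      by (meson span2E)
    \<comment> \<open>On the line through E and S the second coordinate is 0, which forces b' = a'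
      and raises the first coordinate by 1.\<close>
    have w3: "w = t a \<zero> b" using w2(1-3) unfolding te[symmetric] by (simp add: tri)
    have w4: "w = t (a' \<oplus> b' \<otimes> s i) (\<ominus> a' \<oplus> b') a'"
      using w2(4-6) s(2) by (simp add: tri r_minus)
    have "\<zero> = \<ominus> a' \<oplus> b'" "a = a' \<oplus> b' \<otimes> s i" "b = a'"
      using tri_eqD[of a \<zero> b "a' \<oplus> b' \<otimes> s i" "\<ominus> a' \<oplus> b'" a'] w2 s(2) w3 w4 by simp_all
    then have "b' = a'" using w2 sum_zero_minus[of "\<ominus> a'" b'] by simp
    then have "w = a' \<odot>\<^bsub>M\<^esub> t (s (Suc i)) \<zero> \<one>"
      using w3 \<open>a = _\<close> \<open>b = _\<close> w2 s(2,3) by (simp add: tri r_distr base_comm)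
    then have "w \<in> line (t (s (Suc i)) \<zero> \<one>)" using w2 by (auto simp: line_def)
    then show ?case using line_eq_if_mem[OF uF' w(1)] w(2) by simp
  qed
  have "line (t (s m) \<zero> \<one>) = line e3" using fi[of m] fm lines z by simp
  then have "t (s m) \<zero> \<one> \<in> line e3" using mem_line[of "t (s m) \<zero> \<one>"] tri s(2) by simp
  then obtain a where a: "a \<in> carrier R" "t (s m) \<zero> \<one> = a \<odot>\<^bsub>M\<^esub> t \<zero> \<zero> \<one>"
    unfolding te by (auto simp: line_def)
  then have "t (s m) \<zero> \<one> = t \<zero> \<zero> a" by (simp add: tri)
  then have "s m = \<zero>" using tri_eqD(1)[of "s m" \<zero> \<one> \<zero> \<zero> a] s a by simp
  then show ?thesis by (simp add: s_def)
qed

end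

section \<open>Coordinates\<close>

lemma coord_module_simps:
  "carrier (coord_module R d) = {..<d} \<rightarrow>\<^sub>E carrier R"
  "x \<oplus>\<^bsub>coord_module R d\<^esub> y = (\<lambda>i\<in>{..<d}. x i \<oplus>\<^bsub>R\<^esub> y i)"
  "c \<odot>\<^bsub>coord_module R d\<^esub> x = (\<lambda>i\<in>{..<d}. c \<otimes>\<^bsub>R\<^esub> x i)"
  "\<zero>\<^bsub>coord_module R d\<^esub> = (\<lambda>i\<in>{..<d}. \<zero>\<^bsub>R\<^esub>)"
  by (simp_all add: coord_module_def)

locale coord_chain_module = chain_ring R T \<pi> r
  for R (structure) and T \<pi> r + fixes d :: nat

sublocale coord_chain_module \<subseteq> chain_module R T \<pi> r "coord_module R d"
  by (intro chain_module.intro chain_ring_axioms module_coord_module is_cring)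

context coord_chain_module
begin

abbreviation "M \<equiv> coord_module R d"

section \<open>The standard basis of the coordinate module\<close>

definition unit_vector :: "nat \<Rightarrow> nat \<Rightarrow> 'a" where
  "unit_vector j = (\<lambda>i\<in>{..<d}. if i = j then \<one> else \<zero>)"

lemma vec_closed: "x \<in> carrier M \<Longrightarrow> i < d \<Longrightarrow> x i \<in> carrier R"
  by (auto simp: coord_module_simps)

lemma vec_ext: "\<lbrakk>x \<in> carrier M; y \<in> carrier M; \<And>i. i < d \<Longrightarrow> x i = y i\<rbrakk> \<Longrightarrow> x = y"
  unfolding coord_module_simps by (rule PiE_ext) auto

lemma unit_vector_closed: "unit_vector j \<in> carrier M"
  by (auto simp: unit_vector_def coord_module_simps)

lemma lc_unit_vectors_aux:
  assumes a: "a \<in> {..<d} \<rightarrow> carrier R"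
  shows "m \<le> d \<Longrightarrow> lc {..<m} a unit_vector = (\<lambda>i\<in>{..<d}. if i < m then a i else \<zero>)"
proof (induction m)
  case 0
  show ?case by (simp add: coord_module_simps)
next
  case (Suc m)
  have "lc (insert m {..<m}) a unit_vector = a m \<odot>\<^bsub>M\<^esub> unit_vector m \<oplus>\<^bsub>M\<^esub> lc {..<m} a unit_vector"
    by (rule lc_insert) (use a Suc(2) unit_vector_closed in auto)
  also have "\<dots> = a m \<odot>\<^bsub>M\<^esub> unit_vector m \<oplus>\<^bsub>M\<^esub> (\<lambda>i\<in>{..<d}. if i < m then a i else \<zero>)"
    by (subst Suc.IH) (use Suc(2) in auto)
  also have "\<dots> = (\<lambda>i\<in>{..<d}. if i < Suc m then a i else \<zero>)"
    using a Suc(2) by (auto simp: coord_module_simps unit_vector_def fun_eq_iff less_Suc_eq Pi_def)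
  finally show ?case by (simp add: lessThan_Suc)
qed

lemma lc_unit_vectors:
  assumes a: "a \<in> {..<d} \<rightarrow> carrier R" shows "lc {..<d} a unit_vector = restrict a {..<d}"
  using lc_unit_vectors_aux[OF a, of d] by (simp add: fun_eq_iff restrict_def)

lemma indep_unit_vectors: "indep {..<d} unit_vector"
  unfolding indep_def
proof (intro conjI ballI impI)
  fix a i assume a: "a \<in> {..<d} \<rightarrow> carrier R" "lc {..<d} a unit_vector = \<zero>\<^bsub>M\<^esub>" "i \<in> {..<d}"
  then have "restrict a {..<d} i = (\<lambda>i\<in>{..<d}. \<zero>) i"
    by (simp only: lc_unit_vectors coord_module_simps)
  then show "a i = \<zero>" using a(3) by simp
qed (use unit_vector_closed in auto)

lemma carrier_free_sub: "carrier M \<in> free_subs d"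
proof -
  have "spn {..<d} unit_vector = carrier M"
  proof (intro equalityI subsetI)
    fix x assume x: "x \<in> carrier M"
    then have a: "x \<in> {..<d} \<rightarrow> carrier R" by (auto simp: coord_module_simps)
    have "lc {..<d} x unit_vector = x"
      unfolding lc_unit_vectors[OF a] using x by (simp add: coord_module_simps PiE_restrict)
    then show "x \<in> spn {..<d} unit_vector" using spn_mem[OF a, of unit_vector] by simp
  next
    fix x assume "x \<in> spn {..<d} unit_vector"
    then show "x \<in> carrier M"
      using submoduleE(1)[OF submodule_spn[of "{..<d}" unit_vector]] unit_vector_closed by blast
  qed
  then show ?thesis using free_subsI[OF indep_unit_vectors, of d] by simp
qed

end

sublocale coord_chain_module \<subseteq> free_chain_module R T \<pi> r "coord_module R d" d
  by unfold_locales (rule carrier_free_sub)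

context coord_chain_module
begin

text \<open>Unique coordinates for every vector amount to spanning together with
  independence.\<close>

lemma free_submodules_eq: "free_submodules R M k = free_subs k"
proof (intro equalityI subsetI)
  fix V assume "V \<in> free_submodules R M k"
  then obtain b where V: "submodule V R M" and b: "b \<in> {..<k} \<rightarrow> V"
    and ex: "\<And>v. v \<in> V \<Longrightarrow> \<exists>!a. a \<in> {..<k} \<rightarrow>\<^sub>E carrier R \<and> v = lc {..<k} a b"
    by (auto simp: free_submodules_def module_basis_def lc_def)
  note Vs = submoduleE[OF V]
  have bM: "b \<in> {..<k} \<rightarrow> carrier M" using b Vs(1) by blast
  have "indep {..<k} b"
    unfolding indep_def
  proof (intro conjI ballI impI)
    fix a i assume a: "a \<in> {..<k} \<rightarrow> carrier R" "lc {..<k} a b = \<zero>\<^bsub>M\<^esub>" "i \<in> {..<k}"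
    have z: "\<zero>\<^bsub>M\<^esub> \<in> V" using lc_mem_submodule[OF V, of "{}" a b] by simp
    have "lc {..<k} (restrict a {..<k}) b = lc {..<k} a b" by (rule lc_cong) (use a bM in auto)
    then have 1: "restrict a {..<k} \<in> {..<k} \<rightarrow>\<^sub>E carrier R \<and> \<zero>\<^bsub>M\<^esub> = lc {..<k} (restrict a {..<k}) b"
      using a by auto
    have "lc {..<k} (\<lambda>i\<in>{..<k}. \<zero>) b = \<zero>\<^bsub>M\<^esub>" by (rule lc_zero) (use bM in auto)
    then have 2: "(\<lambda>i\<in>{..<k}. \<zero>) \<in> {..<k} \<rightarrow>\<^sub>E carrier R \<and> \<zero>\<^bsub>M\<^esub> = lc {..<k} (\<lambda>i\<in>{..<k}. \<zero>) b"
      by auto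
    \<comment> \<open>Uniqueness of the coordinates of the zero vector is independence.\<close>
    have "restrict a {..<k} = (\<lambda>i\<in>{..<k}. \<zero>)" using ex[OF z] 1 2 by blast
    then show "a i = \<zero>" using a(3) by (metis restrict_apply')
  qed (use bM in auto)
  moreover have "V = spn {..<k} b"
  proof (intro equalityI subsetI)
    fix v assume "v \<in> V"
    then obtain a where "a \<in> {..<k} \<rightarrow>\<^sub>E carrier R" "v = lc {..<k} a b" using ex by blast
    then show "v \<in> spn {..<k} b" using spn_mem[of a "{..<k}" b] by auto
  next
    fix v assume "v \<in> spn {..<k} b"
    then show "v \<in> V" using spn_subset[OF V _ b] by auto
  qed
  ultimately show "V \<in> free_subs k" using free_subsI[of "{..<k}" b k] by simp
next
  fix V assume V: "V \<in> free_subs k"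
  obtain b where b: "indep {..<k} b" "b \<in> {..<k} \<rightarrow> V" "spn {..<k} b = V"
    by (rule free_subs_basis[OF V finite_lessThan card_lessThan])
  note bD = indepD[OF b(1)]
  have ex: "\<exists>!a. a \<in> {..<k} \<rightarrow>\<^sub>E carrier R \<and> v = lc {..<k} a b" if v: "v \<in> V" for v
  proof (rule ex_ex1I)
    have "v \<in> spn {..<k} b" using v b(3) by simp
    then obtain a where a: "a \<in> {..<k} \<rightarrow> carrier R" "v = lc {..<k} a b" by (elim spnE)
    have "lc {..<k} (restrict a {..<k}) b = lc {..<k} a b" by (rule lc_cong) (use a bD in auto)
    then show "\<exists>a. a \<in> {..<k} \<rightarrow>\<^sub>E carrier R \<and> v = lc {..<k} a b"
      using a by (intro exI[of _ "restrict a {..<k}"]) auto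
  next
    fix a a' assume a: "a \<in> {..<k} \<rightarrow>\<^sub>E carrier R \<and> v = lc {..<k} a b"
      "a' \<in> {..<k} \<rightarrow>\<^sub>E carrier R \<and> v = lc {..<k} a' b"
    have "a i = a' i" if "i \<in> {..<k}" for i
      by (rule indep_unique[OF b(1) _ _ _ that]) (use a in auto)
    then show "a = a'" using a by (intro PiE_ext[of a "{..<k}" _ a']) auto
  qed
  have "module_basis R M V k b"
    unfolding module_basis_def lc_def[symmetric] by (intro conjI ballI b(2) ex)
  then show "V \<in> free_submodules R M k"
    unfolding free_submodules_def using free_subs_submodule[OF V] by (intro CollectI conjI exI)
qed

text \<open>If every coordinate is a nonunit, \<pi>^(r-1) annihilates x; a unit coordinate, on the
  other hand, detects every scalar.\<close>

lemma unimod_iff: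
  assumes x: "x \<in> carrier M" shows "unimod x \<longleftrightarrow> (\<exists>i<d. x i \<in> Units R)"
proof
  assume u: "unimod x"
  show "\<exists>i<d. x i \<in> Units R"
  proof (rule ccontr)
    assume "\<not> ?thesis"
    then have p: "x i \<in> pideal 1" if "i < d" for i using unit_or_pideal vec_closed[OF x] that by blast
    have "\<pi> [^] (r - 1) \<otimes> x i = \<zero>" if "i < d" for i
      using pow_pideal[OF p[OF that], of "r - 1"] pideal_r[of "r - 1 + 1"] r_pos by simp
    then have "\<pi> [^] (r - 1) \<odot>\<^bsub>M\<^esub> x = \<zero>\<^bsub>M\<^esub>" by (auto simp: coord_module_simps)
    then show False using unimodD(2)[OF u] pi_pow_pred pi_pow_closed by blast
  qed
next
  assume "\<exists>i<d. x i \<in> Units R"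
  then obtain i where i: "i < d" "x i \<in> Units R" by blast
  show "unimod x"
    unfolding unimod_def
  proof (intro conjI ballI impI x)
    fix c assume c: "c \<in> carrier R" "c \<odot>\<^bsub>M\<^esub> x = \<zero>\<^bsub>M\<^esub>"
    then have "(c \<odot>\<^bsub>M\<^esub> x) i = \<zero>\<^bsub>M\<^esub> i" by simp
    then have "c \<otimes> x i = \<zero>" using i by (simp add: coord_module_simps)
    then show "c = \<zero>" using unit_mult_eq_zero_iff[OF i(2) c(1)] by simp
  qed
qed

text \<open>A bijection of rings acts on these representatives of the points coordinatewise.\<close>

definition normal_vectors :: "(nat \<Rightarrow> 'a) set" where
  "normal_vectors = {u \<in> carrier M. \<exists>i<d. u i = \<one> \<and> (\<forall>j<i. u j \<in> pideal 1)}"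

lemma normal_unimod: "u \<in> normal_vectors \<Longrightarrow> unimod u"
  unfolding normal_vectors_def using unimod_iff[of u] Units_one_closed by auto

lemma psum_point_iff:
  assumes u: "u \<in> carrier M"
  shows "w \<in> psum k {0} (\<lambda>_. u) (carrier M) \<longleftrightarrow>
    (\<exists>\<alpha>\<in>carrier R. \<exists>m\<in>carrier M. w = \<alpha> \<odot>\<^bsub>M\<^esub> u \<oplus>\<^bsub>M\<^esub> \<pi> [^] k \<odot>\<^bsub>M\<^esub> m)"
  unfolding psum_def line_eq_spn[OF u, of 0, symmetric] line_def pmult_def by blast

text \<open>For k > 0, reducing w = \<alpha> u + \<pi>^k m modulo \<pi> shows that u and w have
  their first unit at the same index. Both are 1 there, so \<alpha> is 1 modulo \<pi>^k and the
  vectors agree modulo \<pi>^k. Thus normalisation removes the scalar from the level.\<close>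

lemma normal_level_iff:
  assumes u: "u \<in> normal_vectors" and w: "w \<in> normal_vectors"
  shows "w \<in> psum k {0} (\<lambda>_. u) (carrier M) \<longleftrightarrow> k = 0 \<or> (\<forall>i<d. w i \<ominus> u i \<in> pideal k)"
proof
  obtain i where i: "i < d" "u i = \<one>" "\<And>j. j < i \<Longrightarrow> u j \<in> pideal 1" and uM: "u \<in> carrier M"
    using u by (auto simp: normal_vectors_def)
  obtain i' where i': "i' < d" "w i' = \<one>" "\<And>j. j < i' \<Longrightarrow> w j \<in> pideal 1" and wM: "w \<in> carrier M"
    using w by (auto simp: normal_vectors_def)
  have one: "\<one> \<notin> pideal 1" by (rule unit_not_pideal) simp
  assume "w \<in> psum k {0} (\<lambda>_. u) (carrier M)"
  then obtain \<alpha> m where am: "\<alpha> \<in> carrier R" "m \<in> carrier M" "w = \<alpha> \<odot>\<^bsub>M\<^esub> u \<oplus>\<^bsub>M\<^esub> \<pi> [^] k \<odot>\<^bsub>M\<^esub> m"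
    using psum_point_iff[OF uM] by blast
  then have wj: "w j = \<alpha> \<otimes> u j \<oplus> \<pi> [^] k \<otimes> m j" if "j < d" for j
    using that by (simp add: coord_module_simps)
  have cl: "u j \<in> carrier R" "m j \<in> carrier R" if "j < d" for j using vec_closed uM am(2) that by blast+
  show "k = 0 \<or> (\<forall>i<d. w i \<ominus> u i \<in> pideal k)"
  proof (cases "k = 0")
    case False
    have pk: "\<pi> [^] k \<otimes> m j \<in> pideal 1" if "j < d" for j
      using pidealI[OF cl(2)[OF that], of k] pideal_antimono[of 1 k] False by auto
    \<comment> \<open>Before the pivot of u the coordinates of w are multiples of \<pi>, hence not
      1.\<close>
    have "\<not> i' < i"
    proof
      assume "i' < i"
      then have "w i' \<in> pideal 1"
        using wj[OF i'(1)] pideal_add pk[OF i'(1)] pideal_mult[OF am(1) i(3)] by auto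
      then show False using one i'(2) by simp
    qed
    \<comment> \<open>Otherwise \<alpha> would be a multiple of \<pi>, and with it every coordinate
      of w.\<close>
    moreover have "\<not> i < i'"
    proof
      assume "i < i'"
      then have "w i \<ominus> \<pi> [^] k \<otimes> m i \<in> pideal 1" using i'(3) pk[OF i(1)] pideal_diff by blast
      moreover have "w i \<ominus> \<pi> [^] k \<otimes> m i = \<alpha>"
        unfolding wj[OF i(1)] i(2) using am(1) cl(2)[OF i(1)] pi_pow_closed[of k] by algebra
      ultimately have "\<alpha> \<in> pideal 1" by simp
      then have "w i' \<in> pideal 1"
        using wj[OF i'(1)] pideal_add pk[OF i'(1)] pideal_mult2[OF cl(1)[OF i'(1)]] by auto
      then show False using one i'(2) by simp
    qed
    ultimately have "i = i'" by simp
    then have e: "\<one> = \<alpha> \<oplus> \<pi> [^] k \<otimes> m i" using wj[OF i(1)] am(1) i(2) i'(2) by (metis r_one)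
    have "\<alpha> \<ominus> \<one> = \<ominus> (\<pi> [^] k \<otimes> m i)"
      by (subst e) (use am(1) cl(2)[OF i(1)] pi_pow_closed[of k] in algebra)
    then have a1: "\<alpha> \<ominus> \<one> \<in> pideal k" using pideal_minus[OF pidealI[OF cl(2)[OF i(1)]]] by simp
    have "w j \<ominus> u j \<in> pideal k" if j: "j < d" for j
    proof -
      have "w j \<ominus> u j = (\<alpha> \<ominus> \<one>) \<otimes> u j \<oplus> \<pi> [^] k \<otimes> m j"
        unfolding wj[OF j] using am(1) cl[OF j] pi_pow_closed[of k] by algebra
      then show ?thesis
        using pideal_add[OF pideal_mult2[OF cl(1)[OF j] a1] pidealI[OF cl(2)[OF j]]] by simp
    qed
    then show ?thesis by blast
  qed simp
next
  have uM: "u \<in> carrier M" and wM: "w \<in> carrier M" using u w by (auto simp: normal_vectors_def)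
  assume "k = 0 \<or> (\<forall>i<d. w i \<ominus> u i \<in> pideal k)"
  then show "w \<in> psum k {0} (\<lambda>_. u) (carrier M)"
  proof
    assume k: "k = 0"
    have "w = \<zero> \<odot>\<^bsub>M\<^esub> u \<oplus>\<^bsub>M\<^esub> \<pi> [^] k \<odot>\<^bsub>M\<^esub> w" using k uM wM by simp
    moreover have "\<zero> \<in> carrier R" by simp
    ultimately show ?thesis using psum_point_iff[OF uM] wM by blast
  next
    assume p: "\<forall>i<d. w i \<ominus> u i \<in> pideal k"
    then have "\<forall>i\<in>{..<d}. \<exists>y. y \<in> carrier R \<and> w i \<ominus> u i = \<pi> [^] k \<otimes> y"
      by (auto elim!: pidealE)
    then obtain y where y: "\<And>i. i < d \<Longrightarrow> y i \<in> carrier R \<and> w i \<ominus> u i = \<pi> [^] k \<otimes> y i"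
      using bchoice[of "{..<d}" "\<lambda>i y. y \<in> carrier R \<and> w i \<ominus> u i = \<pi> [^] k \<otimes> y"] by auto
    define m where "m = restrict y {..<d}"
    have mM: "m \<in> carrier M" using y by (auto simp: m_def coord_module_simps)
    have "w = \<one> \<odot>\<^bsub>M\<^esub> u \<oplus>\<^bsub>M\<^esub> \<pi> [^] k \<odot>\<^bsub>M\<^esub> m"
    proof (rule vec_ext)
      fix i assume i: "i < d"
      have c: "w i \<in> carrier R" "u i \<in> carrier R" using vec_closed uM wM i by blast+
      have "w i = u i \<oplus> (w i \<ominus> u i)" using c by algebra
      also have "\<dots> = u i \<oplus> \<pi> [^] k \<otimes> m i" using y[OF i] i by (simp add: m_def)
      finally show "w i = (\<one> \<odot>\<^bsub>M\<^esub> u \<oplus>\<^bsub>M\<^esub> \<pi> [^] k \<odot>\<^bsub>M\<^esub> m) i"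
        using i c by (simp add: coord_module_simps)
    qed (use uM wM mM in simp_all)
    moreover have "\<one> \<in> carrier R" by simp
    ultimately show ?thesis using psum_point_iff[OF uM] mM by blast
  qed
qed

text \<open>A generator is normalised by the inverse of its first unit coordinate. Two normalised
  generators of one point agree modulo \<pi>^r = 0.\<close>

lemma bij_normal_points: "bij_betw line normal_vectors (free_subs 1)"
proof (rule bij_betw_imageI)
  show "inj_on line normal_vectors"
  proof (rule inj_onI)
    fix u w assume uw: "u \<in> normal_vectors" "w \<in> normal_vectors" "line u = line w"
    then have M: "u \<in> carrier M" "w \<in> carrier M" by (auto simp: normal_vectors_def)
    then have "w \<in> line u" using mem_line uw(3) by simp
    then obtain \<alpha> where a: "\<alpha> \<in> carrier R" "w = \<alpha> \<odot>\<^bsub>M\<^esub> u" by (auto simp: line_def)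
    then have "w = \<alpha> \<odot>\<^bsub>M\<^esub> u \<oplus>\<^bsub>M\<^esub> \<pi> [^] r \<odot>\<^bsub>M\<^esub> \<zero>\<^bsub>M\<^esub>" using M by simp
    then have "w \<in> psum r {0} (\<lambda>_. u) (carrier M)" using psum_point_iff[OF M(1)] a(1) M.zero_closed by blast
    then have "\<forall>i<d. w i \<ominus> u i \<in> pideal r" using normal_level_iff[OF uw(1,2)] r_pos by auto
    then have "w i = u i" if "i < d" for i using pideal_r[of r] vec_closed M that by auto
    then show "u = w" using vec_ext[OF M] by simp
  qed
  show "line ` normal_vectors = free_subs 1"
  proof (intro equalityI subsetI)
    fix L assume "L \<in> line ` normal_vectors"
    then show "L \<in> free_subs 1" using line_free_sub normal_unimod by blast
  next
    fix L assume "L \<in> free_subs 1"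
    then obtain x where x: "unimod x" "L = line x" by (elim pointE)
    note xM = unimodD(1)[OF x(1)]
    define P where "P i \<longleftrightarrow> i < d \<and> x i \<in> Units R" for i
    define i where "i = (LEAST i. P i)"
    have "\<exists>i. P i" using unimod_iff[OF xM] x(1) by (auto simp: P_def)
    then have "P i" unfolding i_def by (rule LeastI_ex)
    then have i: "i < d" "x i \<in> Units R" by (simp_all add: P_def)
    have less: "x j \<in> pideal 1" if "j < i" for j
    proof -
      have "\<not> P j" using that unfolding i_def by (rule not_less_Least)
      then show ?thesis using that i(1) unit_or_pideal[OF vec_closed[OF xM, of j]] by (simp add: P_def)
    qed
    have iv: "inv (x i) \<in> Units R" "inv (x i) \<in> carrier R" using i(2) by simp_all
    define u where "u = inv (x i) \<odot>\<^bsub>M\<^esub> x"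
    have "u \<in> carrier M" unfolding u_def using iv xM by simp
    moreover have "u i = \<one>" using i by (simp add: u_def coord_module_simps)
    moreover have "u j \<in> pideal 1" if "j < i" for j
      using pideal_mult[OF iv(2) less[OF that]] that i(1) by (simp add: u_def coord_module_simps)
    ultimately have "u \<in> normal_vectors" using i(1) by (auto simp: normal_vectors_def)
    moreover have "L = line u" unfolding u_def using line_unit_mult[OF iv(1) xM] x(2) by simp
    ultimately show "L \<in> line ` normal_vectors" by blast
  qed
qed

lemma common_lines:
  assumes "unimod u" "unimod w"
  shows "card {V \<in> free_subs n. line u \<subseteq> V \<and> line w \<subseteq> V} = common n u w"
proof -
  have "{V \<in> free_subs n. line u \<subseteq> V \<and> line w \<subseteq> V} = {V \<in> free_subs n. u \<in> V \<and> w \<in> V}"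
    using line_subset_iff[OF free_subs_submodule] unimodD(1) assms by blast
  then show ?thesis by (simp add: common_def)
qed

end

lemma level_preserving_bijection:
  fixes R (structure) and S (structure)
  assumes R: "chain_ring R T \<pi> r" and S: "chain_ring S T' \<pi>' r" and c: "card T = card T'"
    and n: "1 \<le> n" "n \<le> d" "2 \<le> d"
  shows "\<exists>g. bij_betw g (free_submodules R (coord_module R d) 1) (free_submodules S (coord_module S d) 1) \<and>
    (\<forall>L\<in>free_submodules R (coord_module R d) 1. \<forall>L'\<in>free_submodules R (coord_module R d) 1.
      card {V \<in> free_submodules S (coord_module S d) n. g L \<subseteq> V \<and> g L' \<subseteq> V} =
      card {V \<in> free_submodules R (coord_module R d) n. L \<subseteq> V \<and> L' \<subseteq> V})"
proof -
  interpret R: coord_chain_module R T \<pi> r d by (rule coord_chain_module.intro[OF R])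
  interpret S: coord_chain_module S T' \<pi>' r d by (rule coord_chain_module.intro[OF S])
  obtain \<phi> where \<phi>: "bij_betw \<phi> (carrier R) (carrier S)" "\<phi> \<zero>\<^bsub>R\<^esub> = \<zero>\<^bsub>S\<^esub>" "\<phi> \<one>\<^bsub>R\<^esub> = \<one>\<^bsub>S\<^esub>"
    and lev: "\<And>x y k. \<lbrakk>x \<in> carrier R; y \<in> carrier R\<rbrakk> \<Longrightarrow>
      \<phi> x \<ominus>\<^bsub>S\<^esub> \<phi> y \<in> S.pideal k \<longleftrightarrow> x \<ominus>\<^bsub>R\<^esub> y \<in> R.pideal k"
    using chain_ring_bijection[OF R S c] by blast
  have \<phi>c: "\<phi> x \<in> carrier S" if "x \<in> carrier R" for x using \<phi>(1) that by (rule bij_betw_apply)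
  have \<phi>1: "\<phi> x \<in> S.pideal 1 \<longleftrightarrow> x \<in> R.pideal 1" if x: "x \<in> carrier R" for x
  proof -
    have "\<phi> x \<ominus>\<^bsub>S\<^esub> \<zero>\<^bsub>S\<^esub> = \<phi> x" "x \<ominus>\<^bsub>R\<^esub> \<zero>\<^bsub>R\<^esub> = x" using x \<phi>c[OF x] by (simp_all add: a_minus_def)
    then show ?thesis using lev[of x "\<zero>\<^bsub>R\<^esub>" 1] x \<phi>(2) by simp
  qed
  have \<phi>one: "\<phi> x = \<one>\<^bsub>S\<^esub> \<longleftrightarrow> x = \<one>\<^bsub>R\<^esub>" if "x \<in> carrier R" for x
    using bij_betw_imp_inj_on[OF \<phi>(1)] that \<phi>(3) inj_onD[of \<phi> "carrier R" x "\<one>\<^bsub>R\<^esub>"] by auto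
  define \<Phi> where "\<Phi> u = (\<lambda>i\<in>{..<d}. \<phi> (u i))" for u :: "nat \<Rightarrow> 'a"
  have \<Phi>i: "\<Phi> u i = \<phi> (u i)" if "i < d" for u i using that by (simp add: \<Phi>_def)
  have \<Phi>M: "bij_betw \<Phi> (carrier R.M) (carrier S.M)"
  proof (rule bij_betw_byWitness[where f' = "\<lambda>v. \<lambda>i\<in>{..<d}. inv_into (carrier R) \<phi> (v i)"])
    show "\<forall>u\<in>carrier R.M. (\<lambda>i\<in>{..<d}. inv_into (carrier R) \<phi> (\<Phi> u i)) = u"
      using bij_betw_inv_into_left[OF \<phi>(1)]
      by (auto simp: coord_module_simps \<Phi>_def PiE_iff extensional_def fun_eq_iff)
    show "\<forall>v\<in>carrier S.M. \<Phi> (\<lambda>i\<in>{..<d}. inv_into (carrier R) \<phi> (v i)) = v"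
      using bij_betw_inv_into_right[OF \<phi>(1)]
      by (auto simp: coord_module_simps \<Phi>_def PiE_iff extensional_def fun_eq_iff)
    show "\<Phi> ` carrier R.M \<subseteq> carrier S.M"
      by (rule image_subsetI) (simp add: coord_module_simps \<Phi>_def PiE_iff \<phi>c)
    show "(\<lambda>v. \<lambda>i\<in>{..<d}. inv_into (carrier R) \<phi> (v i)) ` carrier S.M \<subseteq> carrier R.M"
      by (rule image_subsetI)
        (simp add: coord_module_simps PiE_iff bij_betw_apply[OF bij_betw_inv_into[OF \<phi>(1)]])
  qed
  have norm: "\<Phi> u \<in> S.normal_vectors \<longleftrightarrow> u \<in> R.normal_vectors" if u: "u \<in> carrier R.M" for u
  proof -
    have uc: "u i \<in> carrier R" if "i < d" for i using R.vec_closed[OF u that] .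
    have "\<Phi> u \<in> carrier S.M" using bij_betw_apply[OF \<Phi>M u] .
    moreover have "(\<Phi> u i = \<one>\<^bsub>S\<^esub> \<and> (\<forall>j<i. \<Phi> u j \<in> S.pideal 1)) \<longleftrightarrow> (u i = \<one>\<^bsub>R\<^esub> \<and> (\<forall>j<i. u j \<in> R.pideal 1))"
      if "i < d" for i
      using that \<Phi>i \<phi>1 \<phi>one uc by (metis less_trans)
    ultimately show ?thesis using u unfolding S.normal_vectors_def R.normal_vectors_def by blast
  qed
  have \<Phi>N: "bij_betw \<Phi> R.normal_vectors S.normal_vectors"
  proof -
    have sub: "R.normal_vectors \<subseteq> carrier R.M" "S.normal_vectors \<subseteq> carrier S.M"
      by (auto simp: R.normal_vectors_def S.normal_vectors_def)
    have "\<Phi> ` R.normal_vectors = S.normal_vectors"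
    proof (intro equalityI subsetI)
      fix v assume "v \<in> \<Phi> ` R.normal_vectors"
      then show "v \<in> S.normal_vectors" using norm sub(1) by blast
    next
      fix v assume v: "v \<in> S.normal_vectors"
      then have "v \<in> \<Phi> ` carrier R.M" using sub(2) bij_betw_imp_surj_on[OF \<Phi>M] by blast
      then show "v \<in> \<Phi> ` R.normal_vectors" using norm v by blast
    qed
    then show ?thesis using bij_betw_imp_inj_on[OF \<Phi>M] sub(1) inj_on_subset by (blast intro: bij_betw_imageI)
  qed
  have lev_iff: "\<Phi> w \<in> S.psum k {0} (\<lambda>_. \<Phi> u) (carrier S.M) \<longleftrightarrow> w \<in> R.psum k {0} (\<lambda>_. u) (carrier R.M)"
    if uw: "u \<in> R.normal_vectors" "w \<in> R.normal_vectors" for u w k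
  proof -
    have "u \<in> carrier R.M" "w \<in> carrier R.M" using uw by (auto simp: R.normal_vectors_def)
    then have "\<Phi> w i \<ominus>\<^bsub>S\<^esub> \<Phi> u i \<in> S.pideal k \<longleftrightarrow> w i \<ominus>\<^bsub>R\<^esub> u i \<in> R.pideal k" if "i < d" for i
      using \<Phi>i[OF that] lev R.vec_closed that by metis
    then show ?thesis
      using R.normal_level_iff[OF uw] S.normal_level_iff[of "\<Phi> u" "\<Phi> w"] bij_betw_apply[OF \<Phi>N] uw by simp
  qed
  have common: "S.common n (\<Phi> u) (\<Phi> w) = R.common n u w"
    if uw: "u \<in> R.normal_vectors" "w \<in> R.normal_vectors" for u w
  proof -
    note U = R.normal_unimod[OF uw(1)] R.normal_unimod[OF uw(2)]
    note U' = S.normal_unimod[OF bij_betw_apply[OF \<Phi>N uw(1)]] S.normal_unimod[OF bij_betw_apply[OF \<Phi>N uw(2)]]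
    obtain k \<alpha> y where k: "k \<le> r" "\<alpha> \<in> carrier R" "R.indep2 u y"
        "w = \<alpha> \<odot>\<^bsub>R.M\<^esub> u \<oplus>\<^bsub>R.M\<^esub> \<pi> [^]\<^bsub>R\<^esub> k \<odot>\<^bsub>R.M\<^esub> y"
      by (rule R.level_decomposition[OF U(1) R.unimodD(1)[OF U(2)] n(3)])
    obtain k' \<alpha>' y' where k': "k' \<le> r" "\<alpha>' \<in> carrier S" "S.indep2 (\<Phi> u) y'"
        "\<Phi> w = \<alpha>' \<odot>\<^bsub>S.M\<^esub> \<Phi> u \<oplus>\<^bsub>S.M\<^esub> \<pi>' [^]\<^bsub>S\<^esub> k' \<odot>\<^bsub>S.M\<^esub> y'"
      by (rule S.level_decomposition[OF U'(1) S.unimodD(1)[OF U'(2)] n(3)])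
    \<comment> \<open>Each level is the largest j for which the membership holds, so the two levels
      agree.\<close>
    have "j \<le> k \<longleftrightarrow> j \<le> k'" if "j \<le> r" for j
      using lev_iff[OF uw, of j] R.level_mem_iff[OF k(3,2,1) that] S.level_mem_iff[OF k'(3,2,1) that] k(4) k'(4)
      by simp
    then have "k = k'" using k(1) k'(1) by (meson le_antisym order_refl)
    then show ?thesis
      using R.common_count[OF k(3,2,1) n] S.common_count[OF k'(3,2,1) n] k(4) k'(4) c by simp
  qed
  define g where "g = S.line \<circ> \<Phi> \<circ> inv_into R.normal_vectors R.line"
  have g_line: "g (R.line u) = S.line (\<Phi> u)" if "u \<in> R.normal_vectors" for u
    using bij_betw_inv_into_left[OF R.bij_normal_points that] by (simp add: g_def)
  have "bij_betw g (R.free_subs 1) (S.free_subs 1)"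
    unfolding g_def comp_assoc
    by (rule bij_betw_trans[OF bij_betw_trans[OF bij_betw_inv_into[OF R.bij_normal_points] \<Phi>N] S.bij_normal_points,
          unfolded comp_assoc])
  moreover have "card {V \<in> S.free_subs n. g L \<subseteq> V \<and> g L' \<subseteq> V} = card {V \<in> R.free_subs n. L \<subseteq> V \<and> L' \<subseteq> V}"
    if LL: "L \<in> R.free_subs 1" "L' \<in> R.free_subs 1" for L L'
  proof -
    have im: "R.free_subs 1 = R.line ` R.normal_vectors"
      using bij_betw_imp_surj_on[OF R.bij_normal_points] by simp
    obtain u w where u: "u \<in> R.normal_vectors" "L = R.line u" and w: "w \<in> R.normal_vectors" "L' = R.line w"
      using LL unfolding im by blast
    show ?thesis
      unfolding u(2) w(2) g_line[OF u(1)] g_line[OF w(1)]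
      using R.common_lines S.common_lines R.normal_unimod S.normal_unimod bij_betw_apply[OF \<Phi>N] u(1) w(1)
        common[OF u(1) w(1)] by simp
  qed
  ultimately show ?thesis unfolding R.free_submodules_eq S.free_submodules_eq by blast
qed

section \<open>Duality between points and hyperplanes\<close>

context chain_ring
begin

section \<open>Finite sums in the base ring\<close>

lemma base_sum_empty: "(\<Oplus>i\<in>{}. f i) = \<zero>"
  by simp

lemma base_sum_insert:
  "\<lbrakk>finite I; j \<notin> I; f \<in> insert j I \<rightarrow> carrier R\<rbrakk> \<Longrightarrow> (\<Oplus>i\<in>insert j I. f i) = f j \<oplus> (\<Oplus>i\<in>I. f i)"
  by (rule finsum_insert) auto

lemma base_sum_closed: "f \<in> I \<rightarrow> carrier R \<Longrightarrow> (\<Oplus>i\<in>I. f i) \<in> carrier R"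
  by (rule finsum_closed)

lemma base_sum_cong:
  "\<lbrakk>g \<in> I \<rightarrow> carrier R; \<And>i. i \<in> I \<Longrightarrow> f i = g i\<rbrakk> \<Longrightarrow> (\<Oplus>i\<in>I. f i) = (\<Oplus>i\<in>I. g i)"
  by (rule finsum_cong') auto

lemma base_sum_single:
  assumes "finite I" "j \<in> I" "f \<in> I \<rightarrow> carrier R" "\<And>i. i \<in> I \<Longrightarrow> i \<noteq> j \<Longrightarrow> f i = \<zero>"
  shows "(\<Oplus>i\<in>I. f i) = f j"
proof -
  have "(\<Oplus>i\<in>I. f i) = (\<Oplus>i\<in>{j}. f i)"
    by (rule add.finprod_mono_neutral_cong_left[symmetric]) (use assms in auto)
  also have "(\<Oplus>i\<in>insert j {}. f i) = f j \<oplus> (\<Oplus>i\<in>{}. f i)"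
    by (rule base_sum_insert) (use assms(2,3) in auto)
  also have "\<dots> = f j" using assms(2,3) by (auto simp: Pi_def)
  finally show ?thesis .
qed

lemma base_sum_addf:
  "\<lbrakk>f \<in> I \<rightarrow> carrier R; g \<in> I \<rightarrow> carrier R\<rbrakk> \<Longrightarrow> (\<Oplus>i\<in>I. f i \<oplus> g i) = (\<Oplus>i\<in>I. f i) \<oplus> (\<Oplus>i\<in>I. g i)"
  by (rule finsum_addf)

lemma base_sum_rdistr:
  "\<lbrakk>finite I; c \<in> carrier R; f \<in> I \<rightarrow> carrier R\<rbrakk> \<Longrightarrow> c \<otimes> (\<Oplus>i\<in>I. f i) = (\<Oplus>i\<in>I. c \<otimes> f i)"
  by (rule finsum_rdistr) auto

end

context coord_chain_module
begin

section \<open>The dot product, hyperplanes and annihilators\<close>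

definition dot :: "(nat \<Rightarrow> 'a) \<Rightarrow> (nat \<Rightarrow> 'a) \<Rightarrow> 'a" where
  "dot u v = (\<Oplus>i\<in>{..<d}. u i \<otimes> v i)"

definition perp :: "(nat \<Rightarrow> 'a) \<Rightarrow> (nat \<Rightarrow> 'a) set" where
  "perp u = {v \<in> carrier M. dot u v = \<zero>}"

text \<open>Taken for a whole submodule, so that the dual of a point does not depend on a
  generator.\<close>

definition ann :: "(nat \<Rightarrow> 'a) set \<Rightarrow> (nat \<Rightarrow> 'a) set" where
  "ann L = {v \<in> carrier M. \<forall>u\<in>L. dot u v = \<zero>}"

lemma dot_terms: "u \<in> carrier M \<Longrightarrow> v \<in> carrier M \<Longrightarrow> (\<lambda>i. u i \<otimes> v i) \<in> {..<d} \<rightarrow> carrier R"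
  by (auto simp: vec_closed)

lemma dot_closed: "u \<in> carrier M \<Longrightarrow> v \<in> carrier M \<Longrightarrow> dot u v \<in> carrier R"
  unfolding dot_def by (rule base_sum_closed[OF dot_terms])

lemma dot_comm: "u \<in> carrier M \<Longrightarrow> v \<in> carrier M \<Longrightarrow> dot u v = dot v u"
  unfolding dot_def by (rule base_sum_cong[OF dot_terms]) (auto simp: vec_closed m_comm)

lemma dot_add:
  assumes "u \<in> carrier M" "v \<in> carrier M" "w \<in> carrier M"
  shows "dot u (v \<oplus>\<^bsub>M\<^esub> w) = dot u v \<oplus> dot u w"
proof -
  have "dot u (v \<oplus>\<^bsub>M\<^esub> w) = (\<Oplus>i\<in>{..<d}. u i \<otimes> v i \<oplus> u i \<otimes> w i)"
    unfolding dot_def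
    by (rule base_sum_cong) (use assms in \<open>auto simp: vec_closed coord_module_simps(2) r_distr\<close>)
  then show ?thesis
    unfolding dot_def using base_sum_addf[OF dot_terms[OF assms(1,2)] dot_terms[OF assms(1,3)]] by simp
qed

lemma dot_smult:
  assumes "u \<in> carrier M" "v \<in> carrier M" "c \<in> carrier R"
  shows "dot u (c \<odot>\<^bsub>M\<^esub> v) = c \<otimes> dot u v"
proof -
  have "dot u (c \<odot>\<^bsub>M\<^esub> v) = (\<Oplus>i\<in>{..<d}. c \<otimes> (u i \<otimes> v i))"
    unfolding dot_def
    by (rule base_sum_cong) (use assms in \<open>auto simp: vec_closed coord_module_simps(3) m_lcomm\<close>)
  then show ?thesis
    unfolding dot_def using base_sum_rdistr[OF _ assms(3) dot_terms[OF assms(1,2)]] by simp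
qed

lemma dot_support:
  assumes "u \<in> carrier M" "v \<in> carrier M" "j < d" "\<And>i. i < d \<Longrightarrow> i \<noteq> j \<Longrightarrow> v i = \<zero>"
  shows "dot u v = u j \<otimes> v j"
  unfolding dot_def
  by (rule base_sum_single) (use assms in \<open>auto simp: vec_closed\<close>)

lemma dot_unit_vector:
  assumes "u \<in> carrier M" "j < d" shows "dot u (unit_vector j) = u j"
  using dot_support[OF assms(1) unit_vector_closed assms(2), of j] vec_closed[OF assms] assms(2)
  by (simp add: unit_vector_def)

lemma lc_coord:
  assumes "finite I" "a \<in> I \<rightarrow> carrier R" "b \<in> I \<rightarrow> carrier M" and l: "l < d"
  shows "lc I a b l = (\<Oplus>j\<in>I. a j \<otimes> b j l)"
  using assms(1-3)
proof (induction I rule: finite_induct)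
  case empty
  show ?case unfolding lc_empty base_sum_empty using l by (simp add: coord_module_simps)
next
  case (insert j I)
  have cl: "a j \<in> carrier R" "b j l \<in> carrier R" using insert l by (auto simp: vec_closed)
  have M: "b j \<in> carrier M" "lc I a b \<in> carrier M" using insert by auto
  have "lc (insert j I) a b l = (a j \<odot>\<^bsub>M\<^esub> b j \<oplus>\<^bsub>M\<^esub> lc I a b) l"
    using lc_insert[of I j a b] insert by simp
  also have "\<dots> = a j \<otimes> b j l \<oplus> lc I a b l" using l by (simp add: coord_module_simps)
  also have "\<dots> = (\<Oplus>j\<in>insert j I. a j \<otimes> b j l)"
  proof -
    have "(\<lambda>j. a j \<otimes> b j l) \<in> insert j I \<rightarrow> carrier R"
      using insert(4,5) l by (auto simp: Pi_def vec_closed)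
    then show ?thesis using base_sum_insert[OF insert(1,2)] insert by simp
  qed
  finally show ?case .
qed

text \<open>Associativity of the matrix product, for passing from the standard basis to another
  one.\<close>

lemma lc_lc:
  assumes J: "finite J" "b \<in> J \<rightarrow> carrier M" and "finite I" "c \<in> I \<rightarrow> carrier R"
    "\<And>i. i \<in> I \<Longrightarrow> A i \<in> J \<rightarrow> carrier R"
  shows "lc I c (\<lambda>i. lc J (A i) b) = lc J (\<lambda>j. \<Oplus>i\<in>I. c i \<otimes> A i j) b"
  using assms(3-)
proof (induction I rule: finite_induct)
  case empty
  show ?case unfolding lc_empty base_sum_empty using lc_zero[OF J] by simp
next
  case (insert k I)
  have c: "c k \<in> carrier R" "c \<in> I \<rightarrow> carrier R" and A: "A k \<in> J \<rightarrow> carrier R" using insert by auto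
  have t: "(\<lambda>i. c i \<otimes> A i j) \<in> insert k I \<rightarrow> carrier R" if "j \<in> J" for j
    using insert(4,5) that by (auto simp: Pi_def)
  have s: "(\<lambda>j. \<Oplus>i\<in>I. c i \<otimes> A i j) \<in> J \<rightarrow> carrier R"
    using t by (intro funcsetI base_sum_closed) auto
  have ck: "(\<lambda>j. c k \<otimes> A k j) \<in> J \<rightarrow> carrier R" using c A by (auto simp: Pi_def)
  have "lc (insert k I) c (\<lambda>i. lc J (A i) b) = c k \<odot>\<^bsub>M\<^esub> lc J (A k) b \<oplus>\<^bsub>M\<^esub> lc I c (\<lambda>i. lc J (A i) b)"
    by (rule lc_insert) (use insert J in \<open>auto simp: Pi_def\<close>)
  also have "\<dots> = lc J (\<lambda>j. c k \<otimes> A k j) b \<oplus>\<^bsub>M\<^esub> lc J (\<lambda>j. \<Oplus>i\<in>I. c i \<otimes> A i j) b"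
    using lc_smult[OF J(1) c(1) A J(2)] insert by simp
  also have "\<dots> = lc J (\<lambda>j. c k \<otimes> A k j \<oplus> (\<Oplus>i\<in>I. c i \<otimes> A i j)) b"
    by (rule lc_add[OF ck s J(2), symmetric])
  also have "\<dots> = lc J (\<lambda>j. \<Oplus>i\<in>insert k I. c i \<otimes> A i j) b"
  proof (rule lc_cong)
    show "c k \<otimes> A k j \<oplus> (\<Oplus>i\<in>I. c i \<otimes> A i j) = (\<Oplus>i\<in>insert k I. c i \<otimes> A i j)" if "j \<in> J" for j
      using base_sum_insert[OF insert(1,2) t[OF that]] by simp
    show "(\<lambda>j. \<Oplus>i\<in>insert k I. c i \<otimes> A i j) \<in> J \<rightarrow> carrier R"
      using t by (intro funcsetI base_sum_closed) auto
  qed (use J in auto)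
  finally show ?case .
qed

lemma submodule_perp:
  assumes u: "u \<in> carrier M" shows "submodule (perp u) R M"
proof (rule submoduleI)
  show "\<zero>\<^bsub>M\<^esub> \<in> perp u"
    using dot_smult[OF u M.zero_closed, of \<zero>] dot_closed[OF u M.zero_closed] by (simp add: perp_def)
  fix a assume a: "a \<in> perp u"
  then have aM: "a \<in> carrier M" "dot u a = \<zero>" by (auto simp: perp_def)
  have "\<ominus>\<^bsub>M\<^esub> a = (\<ominus> \<one>) \<odot>\<^bsub>M\<^esub> a" using aM by (simp add: smult_l_minus)
  then show "\<ominus>\<^bsub>M\<^esub> a \<in> perp u" using dot_smult[OF u aM(1), of "\<ominus> \<one>"] aM by (simp add: perp_def)
  show "c \<odot>\<^bsub>M\<^esub> a \<in> perp u" if "c \<in> carrier R" for c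
    using dot_smult[OF u aM(1) that] aM that by (simp add: perp_def)
  fix b assume "b \<in> perp u"
  then show "a \<oplus>\<^bsub>M\<^esub> b \<in> perp u" using dot_add[OF u aM(1), of b] aM by (simp add: perp_def)
qed (auto simp: perp_def)

text \<open>The vector u_i e_j - u_j e_i, orthogonal to u by commutativity. If u_i is a unit, those
  with j different from i form a basis of the orthogonal complement.\<close>

definition perp_vector :: "(nat \<Rightarrow> 'a) \<Rightarrow> nat \<Rightarrow> nat \<Rightarrow> nat \<Rightarrow> 'a" where
  "perp_vector u i j = u i \<odot>\<^bsub>M\<^esub> unit_vector j \<oplus>\<^bsub>M\<^esub> (\<ominus> u j) \<odot>\<^bsub>M\<^esub> unit_vector i"

lemma perp_vector_closed:
  "\<lbrakk>u \<in> carrier M; i < d; j < d\<rbrakk> \<Longrightarrow> perp_vector u i j \<in> carrier M"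
  unfolding perp_vector_def by (simp add: vec_closed unit_vector_closed)

lemma dot_perp_vector:
  assumes "u \<in> carrier M" "w \<in> carrier M" "i < d" "j < d"
  shows "dot w (perp_vector u i j) = u i \<otimes> w j \<oplus> (\<ominus> u j) \<otimes> w i"
  unfolding perp_vector_def using assms
  by (simp add: dot_add dot_smult dot_unit_vector vec_closed unit_vector_closed)

lemma perp_vector_mem: "\<lbrakk>u \<in> carrier M; i < d; j < d\<rbrakk> \<Longrightarrow> perp_vector u i j \<in> perp u"
  using dot_perp_vector[of u u i j] perp_vector_closed[of u i j] vec_closed[of u] m_comm[of "u j" "u i"]
  by (simp add: perp_def l_minus base_neg)

lemma perp_vector_coord:
  assumes "u \<in> carrier M" "i < d" "j < d" "l < d" "l \<noteq> i"
  shows "perp_vector u i j l = (if l = j then u i else \<zero>)"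
  using assms vec_closed[OF assms(1)]
  by (simp add: perp_vector_def coord_module_simps(2,3) unit_vector_def)

text \<open>Let \<open>u i\<close> be a unit. Coordinate l of a combination is \<open>a l\<close>
  times \<open>u i\<close> for l different from i, so these coordinates can be prescribed in exactly
  one way; orthogonality to u then fixes coordinate i.\<close>

lemma perp_free:
  assumes u: "unimod u" shows "perp u \<in> free_subs (d - 1)"
proof -
  note uM = unimodD(1)[OF u]
  obtain i where i: "i < d" "u i \<in> Units R" using u unimod_iff[OF uM] by blast
  have uc: "u j \<in> carrier R" if "j < d" for j by (rule vec_closed[OF uM that])
  define J where "J = {..<d} - {i}"
  have J: "finite J" "card J = d - 1" "\<And>j. j \<in> J \<Longrightarrow> j < d" "\<And>j. j \<in> J \<Longrightarrow> j \<noteq> i"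
    using i(1) by (auto simp: J_def)
  define w where "w = perp_vector u i"
  have wM: "w \<in> J \<rightarrow> carrier M" and wp: "w \<in> J \<rightarrow> perp u"
    using perp_vector_closed[OF uM i(1)] perp_vector_mem[OF uM i(1)] J(3) by (auto simp: w_def)
  have coord: "lc J a w l = a l \<otimes> u i" if a: "a \<in> J \<rightarrow> carrier R" and l: "l \<in> J" for a l
  proof -
    have al: "a j \<in> carrier R" if "j \<in> J" for j using a that by blast
    have wl: "w j l = (if l = j then u i else \<zero>)" if "j \<in> J" for j
      unfolding w_def using perp_vector_coord[OF uM i(1)] J(3,4) that l by blast
    have "lc J a w l = (\<Oplus>j\<in>J. a j \<otimes> w j l)" by (rule lc_coord[OF J(1) a wM J(3)[OF l]])
    also have "\<dots> = a l \<otimes> w l l"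
      by (rule base_sum_single[OF J(1) l]) (use al wl uc i in auto)
    finally show ?thesis using wl[OF l] by simp
  qed
  have "indep J w"
    unfolding indep_def
  proof (intro conjI ballI impI J(1) wM)
    fix a l assume a: "a \<in> J \<rightarrow> carrier R" "lc J a w = \<zero>\<^bsub>M\<^esub>" "l \<in> J"
    have "a l \<otimes> u i = \<zero>\<^bsub>M\<^esub> l" using coord[OF a(1,3)] a(2) by simp
    also have "\<dots> = \<zero>" using J(3)[OF a(3)] by (simp add: coord_module_simps)
    finally show "a l = \<zero>" using unit_mult_eq_zero_iff[OF i(2), of "a l"] a by blast
  qed
  moreover have "spn J w = perp u"
  proof (intro equalityI)
    show "spn J w \<subseteq> perp u" by (rule spn_subset[OF submodule_perp[OF uM] J(1) wp])
    show "perp u \<subseteq> spn J w"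
    proof
      fix v assume v: "v \<in> perp u"
      have vM: "v \<in> carrier M" using v by (simp add: perp_def)
      have iv: "inv (u i) \<in> carrier R" "inv (u i) \<otimes> u i = \<one>" using i(2) by simp_all
      define a where "a l = inv (u i) \<otimes> v l" for l
      have a: "a \<in> J \<rightarrow> carrier R" using iv vec_closed[OF vM] J(3) by (auto simp: a_def)
      define v' where "v' = lc J a w"
      have v': "v' \<in> perp u" unfolding v'_def by (rule lc_mem_submodule[OF submodule_perp[OF uM] J(1) a wp])
      have v'M: "v' \<in> carrier M" using v' by (simp add: perp_def)
      have eq: "v' l = v l" if "l \<in> J" for l
      proof -
        have c: "v l \<in> carrier R" by (rule vec_closed[OF vM J(3)[OF that]])
        have "inv (u i) \<otimes> v l \<otimes> u i = (inv (u i) \<otimes> u i) \<otimes> v l"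
          using iv(1) c uc[OF i(1)] by (simp add: m_ac)
        then show ?thesis unfolding v'_def coord[OF a that] a_def iv(2) using c by simp
      qed
      \<comment> \<open>The difference is orthogonal to u and supported at i, so its coordinate
        there is killed by the unit \<open>u i\<close>.\<close>
      define z where "z = v \<oplus>\<^bsub>M\<^esub> (\<ominus> \<one>) \<odot>\<^bsub>M\<^esub> v'"
      have zM: "z \<in> carrier M" unfolding z_def using vM v'M by simp
      have zl: "z l = v l \<oplus> \<ominus> v' l" if "l < d" for l
        unfolding z_def using that vec_closed[OF v'M that] by (simp add: coord_module_simps(2,3) l_minus)
      have "dot u z = \<zero>"
        unfolding z_def using v v' uM vM v'M by (simp add: dot_add dot_smult perp_def)
      moreover have "dot u z = u i \<otimes> z i"
        by (rule dot_support[OF uM zM i(1)])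
          (use zl eq vec_closed[OF vM] in \<open>auto simp: J_def base_neg\<close>)
      ultimately have "z i \<otimes> u i = \<zero>" using m_comm vec_closed[OF zM i(1)] uc[OF i(1)] by simp
      then have "z i = \<zero>" using unit_mult_eq_zero_iff[OF i(2) vec_closed[OF zM i(1)]] by simp
      then have "v i \<ominus> v' i = \<zero>" using zl[OF i(1)] by (simp add: a_minus_def)
      then have "v i = v' i" using vec_closed[OF vM i(1)] vec_closed[OF v'M i(1)] by simp
      then have "v l = v' l" if "l < d" for l
        using eq[of l] that by (cases "l = i") (simp_all add: J_def)
      then have "v = v'" by (rule vec_ext[OF vM v'M])
      then show "v \<in> spn J w" unfolding v'_def using spn_mem[OF a] by simp
    qed
  qed
  ultimately show ?thesis using free_subsI J(2) by metis
qed

text \<open>Orthogonality of w to u_i e_j - u_j e_i says u_i w_j = u_j w_i; dividing by a unit u_i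
  exhibits w as a multiple of u.\<close>

lemma perp_eq_imp_line_eq:
  assumes u: "unimod u" and w: "unimod w" and eq: "perp u = perp w"
  shows "line u = line w"
proof -
  note uM = unimodD(1)[OF u] and wM = unimodD(1)[OF w]
  obtain i where i: "i < d" "u i \<in> Units R" using u unimod_iff[OF uM] by blast
  have iv: "inv (u i) \<in> carrier R" "inv (u i) \<otimes> u i = \<one>" "u i \<in> carrier R"
    using i(2) Units_closed[OF i(2)] by simp_all
  have "w = (inv (u i) \<otimes> w i) \<odot>\<^bsub>M\<^esub> u"
  proof (rule vec_ext[OF wM])
    fix j assume j: "j < d"
    have c: "u j \<in> carrier R" "w j \<in> carrier R" "w i \<in> carrier R" using vec_closed uM wM i(1) j by blast+
    have "perp_vector u i j \<in> perp w" using perp_vector_mem[OF uM i(1) j] eq by simp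
    then have "u i \<otimes> w j \<oplus> (\<ominus> u j) \<otimes> w i = \<zero>" using dot_perp_vector[OF uM wM i(1) j] by (simp add: perp_def)
    then have "u i \<otimes> w j \<ominus> u j \<otimes> w i = \<zero>" using c by (simp add: a_minus_def l_minus)
    then have "u i \<otimes> w j = u j \<otimes> w i" using c iv by simp
    then have "inv (u i) \<otimes> (u i \<otimes> w j) = inv (u i) \<otimes> (u j \<otimes> w i)" by simp
    then have "w j = inv (u i) \<otimes> (u j \<otimes> w i)" using iv c by (simp add: m_assoc[symmetric])
    then show "w j = ((inv (u i) \<otimes> w i) \<odot>\<^bsub>M\<^esub> u) j"
      using j c iv by (simp add: coord_module_simps(3) m_ac)
  qed (use uM iv vec_closed[OF wM i(1)] in simp)
  then have "w \<in> line u" using iv(1) vec_closed[OF wM i(1)] by (auto simp: line_def)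
  then show ?thesis using line_eq_if_mem[OF u w] by simp
qed

text \<open>Complete a basis of V by one vector \<open>e 0\<close>. The coordinate functional of
  \<open>e 0\<close> vanishes exactly on V, and its values on the standard basis are the entries of
  u.\<close>

lemma hyperplane_is_perp:
  assumes V: "V \<in> free_subs (d - 1)" and d: "1 \<le> d"
  shows "\<exists>u. unimod u \<and> V = perp u"
proof -
  define J where "J = {..<d}"
  define J0 where "J0 = {1..<d}"
  have J: "finite J" "finite J0" "J0 \<subseteq> J" "card J0 = d - 1" "0 \<in> J" "0 \<notin> J0" "J = insert 0 J0"
    using d by (auto simp: J_def J0_def)
  obtain b where b: "indep J0 b" "b \<in> J0 \<rightarrow> V" "spn J0 b = V" by (rule free_subs_basis[OF V J(2,4)])
  obtain e where e: "\<forall>i\<in>J0. e i = b i" "indep J e"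
    using extend_to_full_basis[OF b(1), folded J_def, OF J(3)] by blast
  note eD = indepD[OF e(2)]
  have V_eq: "V = spn J0 e"
  proof (rule spn_eq_free_sub[OF V indep_subset[OF e(2) J(3)] _ J(4), symmetric])
    show "e \<in> J0 \<rightarrow> V" using e(1) b(2) by auto
  qed
  have "\<forall>i\<in>J. \<exists>a. a \<in> J \<rightarrow> carrier R \<and> unit_vector i = lc J a e"
    using coordinates[OF e(2) _ unit_vector_closed] by (metis J_def card_lessThan)
  then obtain A where A: "\<And>i. i \<in> J \<Longrightarrow> A i \<in> J \<rightarrow> carrier R" "\<And>i. i \<in> J \<Longrightarrow> unit_vector i = lc J (A i) e"
    using bchoice[of J "\<lambda>i a. a \<in> J \<rightarrow> carrier R \<and> unit_vector i = lc J a e"] by blast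
  define u where "u = (\<lambda>i\<in>J. A i 0)"
  have uM: "u \<in> carrier M" using A(1) J(5) by (auto simp: u_def coord_module_simps J_def)
  have expand: "\<exists>\<gamma>\<in>J \<rightarrow> carrier R. v = lc J \<gamma> e \<and> \<gamma> 0 = dot u v" if v: "v \<in> carrier M" for v
  proof -
    have vJ: "v \<in> J \<rightarrow> carrier R" using vec_closed[OF v] by (auto simp: J_def)
    define \<gamma> where "\<gamma> j = (\<Oplus>i\<in>J. v i \<otimes> A i j)" for j
    have g: "\<gamma> \<in> J \<rightarrow> carrier R"
      unfolding \<gamma>_def using vJ A(1) by (intro funcsetI base_sum_closed) (auto simp: Pi_def)
    have "v = lc J v unit_vector"
      unfolding J_def lc_unit_vectors[OF vJ[unfolded J_def]] using v by (simp add: coord_module_simps PiE_restrict)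
    also have "\<dots> = lc J v (\<lambda>i. lc J (A i) e)"
      by (rule lc_cong) (use A vJ eD in \<open>auto simp: Pi_def\<close>)
    also have "\<dots> = lc J \<gamma> e" unfolding \<gamma>_def by (rule lc_lc[OF eD(1,2) J(1) vJ A(1)])
    finally have "v = lc J \<gamma> e" .
    moreover have "\<gamma> 0 = dot v u"
      unfolding \<gamma>_def dot_def J_def[symmetric]
      by (rule base_sum_cong) (use vJ vec_closed[OF uM] in \<open>auto simp: u_def J_def\<close>)
    ultimately show ?thesis using g dot_comm[OF uM v] by auto
  qed
  have "V = perp u"
  proof (intro equalityI subsetI)
    fix v assume v: "v \<in> V"
    then have vM: "v \<in> carrier M" using free_subs_carrier[OF V] by blast
    obtain \<gamma> where \<gamma>: "\<gamma> \<in> J \<rightarrow> carrier R" "v = lc J \<gamma> e" "\<gamma> 0 = dot u v" using expand[OF vM] by blast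
    obtain c where c: "c \<in> J0 \<rightarrow> carrier R" "v = lc J0 c e" using v V_eq spnE by blast
    have "lc J \<gamma> e = lc J0 c e" using \<gamma>(2) c(2) by simp
    from spn_coord_zero(2)[OF e(2) J(3) \<gamma>(1) this c(1), of 0] show "v \<in> perp u"
      using J vM \<gamma>(3) by (simp add: perp_def)
  next
    fix v assume "v \<in> perp u"
    then have v: "v \<in> carrier M" "dot u v = \<zero>" by (auto simp: perp_def)
    obtain \<gamma> where \<gamma>: "\<gamma> \<in> J \<rightarrow> carrier R" "v = lc J \<gamma> e" "\<gamma> 0 = dot u v" using expand[OF v(1)] by blast
    have "lc J \<gamma> e = lc J0 \<gamma> e"
      by (rule lc_neutral[OF J(1,3) \<gamma>(1) eD(2)]) (use \<gamma>(3) v(2) J(7) in auto)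
    moreover have "\<gamma> \<in> J0 \<rightarrow> carrier R" using \<gamma>(1) J(3) by auto
    ultimately show "v \<in> V" unfolding V_eq using \<gamma>(2) spn_mem by metis
  qed
  \<comment> \<open>The functional takes the value 1 at \<open>e 0\<close>, so a scalar that
    annihilates u annihilates 1.\<close>
  moreover have "unimod u"
    unfolding unimod_def
  proof (intro conjI ballI impI uM)
    fix c assume c: "c \<in> carrier R" "c \<odot>\<^bsub>M\<^esub> u = \<zero>\<^bsub>M\<^esub>"
    have e0: "e 0 \<in> carrier M" using eD(2) J(5) by auto
    obtain \<gamma> where \<gamma>: "\<gamma> \<in> J \<rightarrow> carrier R" "e 0 = lc J \<gamma> e" "\<gamma> 0 = dot u (e 0)" using expand[OF e0] by blast
    have "lc J (\<lambda>i. if i = 0 then \<one> else \<zero>) e = e 0"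
      using lc_single[OF eD(1) J(5) _ eD(2), of \<one>] e0 by simp
    then have "\<gamma> 0 = \<one>"
      using indep_unique[OF e(2) \<gamma>(1), of "\<lambda>i. if i = 0 then \<one> else \<zero>" 0] \<gamma>(2) J(5) by auto
    then have "c = c \<otimes> dot (e 0) u" using \<gamma>(3) c dot_comm[OF uM e0] by simp
    also have "\<dots> = dot (e 0) (\<zero> \<odot>\<^bsub>M\<^esub> u)" using dot_smult[OF e0 uM c(1)] c(2) uM by simp
    also have "\<dots> = \<zero>" using dot_smult[OF e0 uM, of \<zero>] dot_closed[OF e0 uM] by simp
    finally show "c = \<zero>" .
  qed
  ultimately show ?thesis by blast
qed

lemma ann_line:
  assumes u: "u \<in> carrier M" shows "ann (line u) = perp u"
proof (intro equalityI subsetI)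
  fix v assume "v \<in> ann (line u)"
  then show "v \<in> perp u" using mem_line[OF u] by (auto simp: ann_def perp_def)
next
  fix v assume v: "v \<in> perp u"
  have "dot (c \<odot>\<^bsub>M\<^esub> u) v = \<zero>" if c: "c \<in> carrier R" for c
  proof -
    have vM: "v \<in> carrier M" using v by (simp add: perp_def)
    have "dot v u = \<zero>" using v dot_comm[OF vM u] by (simp add: perp_def)
    then show ?thesis using dot_comm[OF _ vM, of "c \<odot>\<^bsub>M\<^esub> u"] dot_smult[OF vM u c] u c by simp
  qed
  then show "v \<in> ann (line u)" using v by (auto simp: ann_def perp_def line_def)
qed

lemma bij_ann:
  assumes "1 \<le> d" shows "bij_betw ann (free_subs 1) (free_subs (d - 1))"
proof (rule bij_betw_imageI)
  show "inj_on ann (free_subs 1)"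
  proof (rule inj_onI)
    fix L L' assume L: "L \<in> free_subs 1" "L' \<in> free_subs 1" "ann L = ann L'"
    obtain u w where u: "unimod u" "L = line u" and w: "unimod w" "L' = line w" using L(1,2) by (meson pointE)
    then show "L = L'" using perp_eq_imp_line_eq[OF u(1) w(1)] L(3) ann_line unimodD(1) by simp
  qed
  show "ann ` free_subs 1 = free_subs (d - 1)"
  proof (intro equalityI subsetI)
    fix V assume "V \<in> ann ` free_subs 1"
    then obtain L where L: "L \<in> free_subs 1" "V = ann L" by blast
    obtain u where "unimod u" "L = line u" using L(1) by (elim pointE)
    then have u: "unimod u" "V = ann (line u)" using L(2) by simp_all
    then show "V \<in> free_subs (d - 1)" using perp_free[OF u(1)] ann_line[OF unimodD(1)[OF u(1)]] by simp
  next
    fix V assume "V \<in> free_subs (d - 1)"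
    then obtain u where u: "unimod u" "V = perp u" using hyperplane_is_perp assms by blast
    then have "V = ann (line u)" using ann_line[OF unimodD(1)[OF u(1)]] by simp
    then show "V \<in> ann ` free_subs 1" using line_free_sub[OF u(1)] by blast
  qed
qed

text \<open>By symmetry of the dot product, both inclusions say that L and L' are
  orthogonal.\<close>

lemma subset_ann_swap:
  assumes L: "L \<subseteq> carrier M" and L': "L' \<subseteq> carrier M" and sub: "L \<subseteq> ann L'"
  shows "L' \<subseteq> ann L"
proof
  fix v assume v: "v \<in> L'"
  then have vM: "v \<in> carrier M" using L' by (rule subsetD[rotated])
  have "dot u v = \<zero>" if u: "u \<in> L" for u
  proof -
    have uM: "u \<in> carrier M" using L u by (rule subsetD)
    have "u \<in> ann L'" using sub u by (rule subsetD)
    then have "dot v u = \<zero>" using v by (simp add: ann_def)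
    then show ?thesis using dot_comm[OF uM vM] by simp
  qed
  then show "v \<in> ann L" using vM by (simp add: ann_def)
qed

text \<open>Row i of the block matrix (I | A), where the columns of A are numbered from n to d -
  1.\<close>

definition graph_row :: "nat \<Rightarrow> (nat \<times> nat \<Rightarrow> 'a) \<Rightarrow> nat \<Rightarrow> nat \<Rightarrow> 'a" where
  "graph_row n A i = (\<lambda>l\<in>{..<d}. if l < n then (if l = i then \<one> else \<zero>) else A (i, l))"

text \<open>Row spaces of matrices \<open>(I | A)\<close> already outnumber the points.\<close>

lemma points_less:
  assumes n: "2 \<le> n" "n + 2 \<le> d"
  shows "card (free_subs 1) < card (free_subs n)"
proof -
  define D where "D = ({..<n} \<times> {n..<d}) \<rightarrow>\<^sub>E carrier R"
  have row: "graph_row n A i \<in> carrier M" if A: "A \<in> D" and i: "i \<in> {..<n}" for A i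
  proof -
    have "A (i, l) \<in> carrier R" if "l < d" "\<not> l < n" for l
      using PiE_mem[OF A[unfolded D_def], of "(i, l)"] i that by auto
    then show ?thesis by (auto simp: graph_row_def coord_module_simps)
  qed
  have coord: "lc {..<n} a (graph_row n A) l = a l"
    if A: "A \<in> D" and a: "a \<in> {..<n} \<rightarrow> carrier R" and l: "l < n" for A a l
  proof -
    have b: "graph_row n A \<in> {..<n} \<rightarrow> carrier M" using row[OF A] by blast
    have ld: "l < d" using l n by simp
    have v: "graph_row n A j l = (if l = j then \<one> else \<zero>)" for j
      using l ld by (simp add: graph_row_def)
    have "lc {..<n} a (graph_row n A) l = (\<Oplus>j\<in>{..<n}. a j \<otimes> graph_row n A j l)"
      by (rule lc_coord[OF _ a b ld]) simp
    also have "\<dots> = a l \<otimes> graph_row n A l l"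
      by (rule base_sum_single) (use a l in \<open>auto simp: v Pi_def\<close>)
    also have "\<dots> = a l" using a l by (simp add: v Pi_def)
    finally show ?thesis .
  qed
  have ind: "indep {..<n} (graph_row n A)" if A: "A \<in> D" for A
    unfolding indep_def
  proof (intro conjI ballI impI)
    fix a l assume a: "a \<in> {..<n} \<rightarrow> carrier R" "lc {..<n} a (graph_row n A) = \<zero>\<^bsub>M\<^esub>" "l \<in> {..<n}"
    then have "a l = \<zero>\<^bsub>M\<^esub> l" using coord[OF A a(1), of l] by simp
    then show "a l = \<zero>" using a(3) n by (simp add: coord_module_simps)
  qed (use row[OF A] in auto)
  \<comment> \<open>The identity block shows the coefficients of a combination in its first n
    coordinates, so the row space determines every row.\<close>
  have "inj_on (\<lambda>A. spn {..<n} (graph_row n A)) D"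
  proof (rule inj_onI)
    fix A B assume A: "A \<in> D" and B: "B \<in> D"
      and eq: "spn {..<n} (graph_row n A) = spn {..<n} (graph_row n B)"
    show "A = B"
    proof (rule PiE_ext[OF A[unfolded D_def] B[unfolded D_def]])
      fix p assume "p \<in> {..<n} \<times> {n..<d}"
      then obtain i l where p: "p = (i, l)" "i < n" "n \<le> l" "l < d" by auto
      have bA: "graph_row n A \<in> {..<n} \<rightarrow> carrier M" and bB: "graph_row n B \<in> {..<n} \<rightarrow> carrier M"
        using row A B by blast+
      have "graph_row n A i \<in> spn {..<n} (graph_row n B)"
        using basis_mem_spn[OF _ bA, of i] p(2) eq by simp
      then obtain a where a: "a \<in> {..<n} \<rightarrow> carrier R" "graph_row n A i = lc {..<n} a (graph_row n B)"
        by (elim spnE)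
      have "a j = (if j = i then \<one> else \<zero>)" if "j < n" for j
        using coord[OF B a(1) that] that n unfolding a(2)[symmetric] by (simp add: graph_row_def)
      then have "lc {..<n} a (graph_row n B) = lc {..<n} (\<lambda>j. if j = i then \<one> else \<zero>) (graph_row n B)"
        by (intro lc_cong bB) auto
      also have "\<dots> = \<one> \<odot>\<^bsub>M\<^esub> graph_row n B i" by (rule lc_single) (use p(2) bB in auto)
      also have "\<dots> = graph_row n B i" using row[OF B] p(2) by simp
      finally have "graph_row n A i l = graph_row n B i l" using a(2) by simp
      then show "A p = B p" using p by (simp add: graph_row_def)
    qed
  qed
  moreover have "(\<lambda>A. spn {..<n} (graph_row n A)) ` D \<subseteq> free_subs n"
    using free_subsI[OF ind] by auto
  ultimately have "card D \<le> card (free_subs n)" by (rule card_inj_on_le[OF _ _ finite_free_subs_set])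
  moreover have "card D = card (carrier R) ^ (n * (d - n))"
    unfolding D_def by (simp add: card_PiE)
  \<comment> \<open>Points correspond to normalised vectors, and the zero vector is not one of
    them.\<close>
  moreover have "card (free_subs 1) < card (carrier R) ^ d"
  proof -
    have "card (free_subs 1) = card normal_vectors"
      using bij_betw_same_card[OF bij_normal_points] by simp
    also have "\<dots> < card (carrier M)"
    proof (rule psubset_card_mono[OF finite_free_subs[OF carrier_free]])
      have "\<zero>\<^bsub>M\<^esub> \<notin> normal_vectors"
        using one_not_zero by (auto simp: normal_vectors_def coord_module_simps)
      moreover have "normal_vectors \<subseteq> carrier M" by (auto simp: normal_vectors_def)
      ultimately show "normal_vectors \<subset> carrier M" using M.zero_closed by blast
    qed
    finally show ?thesis using card_free_subs[OF carrier_free] by simp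
  qed
  moreover have "card (carrier R) ^ d \<le> card (carrier R) ^ (n * (d - n))"
  proof (rule power_increasing)
    obtain k where k: "d = n + 2 + k" using n(2) le_Suc_ex by blast
    have "n * (d - n) = 2 * n + n * k" unfolding k by (simp add: distrib_left)
    moreover have "2 * k \<le> n * k" using n(1) by simp
    ultimately show "d \<le> n * (d - n)" unfolding k using n(1) by linarith
  qed (use card_carrier_gt_1 in simp)
  ultimately show ?thesis by linarith
qed

end

section \<open>The spectrum of a bipartite graph\<close>

lemma poly_const_sum: "(\<Sum>j\<in>A. [:f j:]) = [:\<Sum>j\<in>A. (f j :: complex):]"
  by (induction A rule: infinite_finite_induct) auto

text \<open>Multiplying \<open>X - (0, B; B\<^sup>T, 0)\<close> on the right by \<open>(X, 0; B\<^sup>T, 1)\<close> gives the block triangular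
  matrix \<open>(X\<^sup>2 - B B\<^sup>T, -B; 0, X)\<close>.\<close>

lemma char_poly_bipartite:
  fixes B :: "complex mat"
  assumes B: "B \<in> carrier_mat m k"
  shows "char_poly (four_block_mat (0\<^sub>m m m) B B\<^sup>T (0\<^sub>m k k)) * [:0, 1:] ^ m =
    det (mat m m (\<lambda>(i, i'). (if i = i' then [:0, 0, 1:] else 0) - [:\<Sum>j<k. B $$ (i, j) * B $$ (i', j):]))
      * [:0, 1:] ^ k"
proof -
  define Y :: "complex poly" where "Y = [:0, 1:]"
  define A where "A = four_block_mat (0\<^sub>m m m) B B\<^sup>T (0\<^sub>m k k)"
  define C where "C = map_mat (\<lambda>a. [:a:]) B"
  define D where "D = mat m m (\<lambda>(i, i'). (if i = i' then [:0, 0, 1:] else 0) - [:\<Sum>j<k. B $$ (i, j) * B $$ (i', j):])"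
  have C: "C \<in> carrier_mat m k" "C\<^sup>T \<in> carrier_mat k m" "- C \<in> carrier_mat m k" "- C\<^sup>T \<in> carrier_mat k m"
    using B by (auto simp: C_def)
  have A: "A \<in> carrier_mat (m + k) (m + k)" using B by (simp add: A_def)
  have D: "D \<in> carrier_mat m m" by (simp add: D_def)
  have diag: "Y \<cdot>\<^sub>m 1\<^sub>m n \<in> carrier_mat n n" "(1\<^sub>m n :: complex poly mat) \<in> carrier_mat n n" for n by auto
  have cpm: "char_poly_matrix A = four_block_mat (Y \<cdot>\<^sub>m 1\<^sub>m m) (- C) (- C\<^sup>T) (Y \<cdot>\<^sub>m 1\<^sub>m k)"
    by (rule eq_matI) (use B A in \<open>auto simp: char_poly_matrix_def A_def C_def Y_def\<close>)
  define N where "N = four_block_mat (Y \<cdot>\<^sub>m 1\<^sub>m m) (0\<^sub>m m k) C\<^sup>T (1\<^sub>m k)"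
  have N: "N \<in> carrier_mat (m + k) (m + k)" by (simp add: N_def)
  have detN: "det N = Y ^ m"
    unfolding N_def by (subst det_four_block_mat_upper_right_zero[OF diag(1) refl C(2) diag(2)]) simp
  have "char_poly_matrix A * N = four_block_mat ((Y \<cdot>\<^sub>m 1\<^sub>m m) * (Y \<cdot>\<^sub>m 1\<^sub>m m) + (- C) * C\<^sup>T)
      ((Y \<cdot>\<^sub>m 1\<^sub>m m) * 0\<^sub>m m k + (- C) * 1\<^sub>m k) ((- C\<^sup>T) * (Y \<cdot>\<^sub>m 1\<^sub>m m) + (Y \<cdot>\<^sub>m 1\<^sub>m k) * C\<^sup>T)
      ((- C\<^sup>T) * 0\<^sub>m m k + (Y \<cdot>\<^sub>m 1\<^sub>m k) * 1\<^sub>m k)"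
    unfolding cpm N_def
    by (rule mult_four_block_mat[OF diag(1) C(3,4) diag(1) diag(1) _ C(2) diag(2)]) simp
  also have "(Y \<cdot>\<^sub>m 1\<^sub>m m) * (Y \<cdot>\<^sub>m 1\<^sub>m m) + (- C) * C\<^sup>T = D"
  proof (rule eq_matI)
    fix i i' assume "i < dim_row D" "i' < dim_col D"
    then have i: "i < m" "i' < m" by (simp_all add: D_def)
    have 1: "((- C) * C\<^sup>T) $$ (i, i') = - [:\<Sum>j<k. B $$ (i, j) * B $$ (i', j):]"
      using i B
      by (simp add: C_def scalar_prod_def lessThan_atLeast0 poly_const_sum sum_negf mult.commute)
    have "(Y \<cdot>\<^sub>m 1\<^sub>m m) * (Y \<cdot>\<^sub>m 1\<^sub>m m) = Y \<cdot>\<^sub>m (Y \<cdot>\<^sub>m 1\<^sub>m m)"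
      by (subst mult_smult_assoc_mat[of _ m m _ m]) simp_all
    then have 2: "((Y \<cdot>\<^sub>m 1\<^sub>m m) * (Y \<cdot>\<^sub>m 1\<^sub>m m)) $$ (i, i') = (if i = i' then [:0, 0, 1:] else 0)"
      using i by (simp add: Y_def)
    show "((Y \<cdot>\<^sub>m 1\<^sub>m m) * (Y \<cdot>\<^sub>m 1\<^sub>m m) + (- C) * C\<^sup>T) $$ (i, i') = D $$ (i, i')"
      using i C(1) 1 2 by (simp add: D_def)
  qed (use C in \<open>simp_all add: D_def\<close>)
  also have "(Y \<cdot>\<^sub>m 1\<^sub>m m) * 0\<^sub>m m k + (- C) * 1\<^sub>m k = - C"
    using C(3) by (subst right_mult_zero_mat[OF diag(1)]) simp
  also have "(- C\<^sup>T) * (Y \<cdot>\<^sub>m 1\<^sub>m m) + (Y \<cdot>\<^sub>m 1\<^sub>m k) * C\<^sup>T = 0\<^sub>m k m"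
  proof -
    have "(- C\<^sup>T) * (Y \<cdot>\<^sub>m 1\<^sub>m m) = Y \<cdot>\<^sub>m (- C\<^sup>T)"
      using C(4) by (subst mult_smult_distrib[OF C(4) diag(2)]) simp
    moreover have "(Y \<cdot>\<^sub>m 1\<^sub>m k) * C\<^sup>T = Y \<cdot>\<^sub>m C\<^sup>T"
      using C(2) by (subst mult_smult_assoc_mat[OF diag(2) C(2)]) simp
    ultimately show ?thesis using C(2) by (intro eq_matI) auto
  qed
  also have "(- C\<^sup>T) * 0\<^sub>m m k + (Y \<cdot>\<^sub>m 1\<^sub>m k) * 1\<^sub>m k = Y \<cdot>\<^sub>m 1\<^sub>m k"
    using diag(1)[of k] by (subst right_mult_zero_mat[OF C(4)]) simp
  finally have "det (char_poly_matrix A * N) = det D * det (Y \<cdot>\<^sub>m 1\<^sub>m k)"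
    by (simp only: det_four_block_mat_lower_left_zero[OF D C(3) refl diag(1)])
  moreover have "det (char_poly_matrix A * N) = char_poly A * Y ^ m"
    using det_mult[OF _ N, of "char_poly_matrix A"] A detN by (simp add: char_poly_def)
  ultimately show ?thesis by (simp add: A_def D_def Y_def)
qed

text \<open>After multiplication by X^m, both sides become the same determinant in the Gram matrix
  times X^k, and X^m cancels. Hence agreement of B B^T suffices.\<close>

lemma char_poly_bipartite_eq:
  fixes B B' :: "complex mat"
  assumes B: "B \<in> carrier_mat m k" and B': "B' \<in> carrier_mat m k"
    and eq: "\<And>i i'. i < m \<Longrightarrow> i' < m \<Longrightarrow>
      (\<Sum>j<k. B $$ (i, j) * B $$ (i', j)) = (\<Sum>j<k. B' $$ (i, j) * B' $$ (i', j))"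
  shows "char_poly (four_block_mat (0\<^sub>m m m) B B\<^sup>T (0\<^sub>m k k)) =
    char_poly (four_block_mat (0\<^sub>m m m) B' B'\<^sup>T (0\<^sub>m k k))"
proof -
  have "mat m m (\<lambda>(i, i'). (if i = i' then [:0, 0, 1:] else 0) - [:\<Sum>j<k. B $$ (i, j) * B $$ (i', j):]) =
      mat m m (\<lambda>(i, i'). (if i = i' then [:0, 0, 1:] else 0) - [:\<Sum>j<k. B' $$ (i, j) * B' $$ (i', j):])"
    by (rule cong_mat) (simp_all add: eq)
  then have "char_poly (four_block_mat (0\<^sub>m m m) B B\<^sup>T (0\<^sub>m k k)) * [:0, 1:] ^ m =
      char_poly (four_block_mat (0\<^sub>m m m) B' B'\<^sup>T (0\<^sub>m k k)) * [:0, 1:] ^ m"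
    unfolding char_poly_bipartite[OF B] char_poly_bipartite[OF B'] by simp
  then show ?thesis by simp
qed

definition inclusion_graph :: "'v set set \<Rightarrow> 'v set set \<Rightarrow> 'v set pair_pre_digraph" where
  "inclusion_graph P Q = \<lparr>pverts = P \<union> Q,
    parcs = {(L, V). L \<in> P \<and> V \<in> Q \<and> L \<subseteq> V} \<union> {(V, L). L \<in> P \<and> V \<in> Q \<and> L \<subseteq> V}\<rparr>"

definition inclusion_matrix :: "'v set list \<Rightarrow> 'v set list \<Rightarrow> complex mat" where
  "inclusion_matrix ps qs = mat (length ps) (length qs) (\<lambda>(i, j). if ps ! i \<subseteq> qs ! j then 1 else 0)"

text \<open>Listing P before Q gives the block form; disjointness of the classes empties the
  diagonal blocks.\<close>

lemma adjacency_inclusion_graph: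
  assumes "set ps = P" "set qs = Q" and disj: "P \<inter> Q = {}"
  shows "adjacency_matrix (inclusion_graph P Q) (ps @ qs) =
    four_block_mat (0\<^sub>m (length ps) (length ps)) (inclusion_matrix ps qs) (inclusion_matrix ps qs)\<^sup>T
      (0\<^sub>m (length qs) (length qs))"
proof (rule eq_matI)
  let ?m = "length ps" and ?k = "length qs"
  have P: "ps ! i \<in> P" if "i < ?m" for i using assms(1) that by auto
  have Q: "qs ! i \<in> Q" if "i < ?k" for i using assms(2) that by auto
  have arc: "(x, y) \<in> parcs (inclusion_graph P Q) \<longleftrightarrow> x \<in> P \<and> y \<in> Q \<and> x \<subseteq> y \<or> y \<in> P \<and> x \<in> Q \<and> y \<subseteq> x" for x y
    by (auto simp: inclusion_graph_def)
  have nP: "qs ! i \<notin> P" if "i < ?k" for i using Q[OF that] disj by blast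
  have nQ: "ps ! i \<notin> Q" if "i < ?m" for i using P[OF that] disj by blast
  fix i j
  assume "i < dim_row (four_block_mat (0\<^sub>m ?m ?m) (inclusion_matrix ps qs) (inclusion_matrix ps qs)\<^sup>T (0\<^sub>m ?k ?k))"
    and "j < dim_col (four_block_mat (0\<^sub>m ?m ?m) (inclusion_matrix ps qs) (inclusion_matrix ps qs)\<^sup>T (0\<^sub>m ?k ?k))"
  then have ij: "i < ?m + ?k" "j < ?m + ?k" by simp_all
  have ik: "i - ?m < ?k" if "\<not> i < ?m" using ij that by simp
  have jk: "j - ?m < ?k" if "\<not> j < ?m" using ij that by simp
  show "adjacency_matrix (inclusion_graph P Q) (ps @ qs) $$ (i, j) =
    four_block_mat (0\<^sub>m ?m ?m) (inclusion_matrix ps qs) (inclusion_matrix ps qs)\<^sup>T (0\<^sub>m ?k ?k) $$ (i, j)"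
    using ij ik jk P Q nP nQ
    by (cases "i < ?m"; cases "j < ?m") (simp_all add: adjacency_matrix_def inclusion_matrix_def arc nth_append)
qed (simp_all add: adjacency_matrix_def inclusion_matrix_def)

text \<open>An entry of B B^T counts common neighbours; \<open>distinct\<close> turns the sum over
  positions into a sum over submodules.\<close>

lemma gram_inclusion_matrix:
  assumes "distinct qs" "i < length ps" "i' < length ps"
  shows "(\<Sum>j<length qs. inclusion_matrix ps qs $$ (i, j) * inclusion_matrix ps qs $$ (i', j)) =
    of_nat (card {V \<in> set qs. ps ! i \<subseteq> V \<and> ps ! i' \<subseteq> V})"
proof -
  have "(\<Sum>j<length qs. inclusion_matrix ps qs $$ (i, j) * inclusion_matrix ps qs $$ (i', j)) =
      (\<Sum>j<length qs. (if ps ! i \<subseteq> qs ! j \<and> ps ! i' \<subseteq> qs ! j then 1 else 0 :: complex))"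
    by (rule sum.cong) (use assms in \<open>auto simp: inclusion_matrix_def\<close>)
  also have "\<dots> = (\<Sum>V\<in>set qs. if ps ! i \<subseteq> V \<and> ps ! i' \<subseteq> V then 1 else 0)"
    by (rule sum.reindex_bij_betw[OF bij_betw_nth[OF assms(1) refl refl]])
  also have "\<dots> = of_nat (card {V \<in> set qs. ps ! i \<subseteq> V \<and> ps ! i' \<subseteq> V})"
    by (simp add: sum.If_cases Int_def)
  finally show ?thesis .
qed

text \<open>The points of the second graph are listed along g, so that the Gram matrices coincide
  entry by entry. Q and Q' are listed in any order, as permuting the columns of B leaves B B^T
  unchanged.\<close>

lemma isospectral_inclusion_graphs:
  assumes fin: "finite P" "finite Q" "finite Q'" and disj: "P \<inter> Q = {}" "P' \<inter> Q' = {}"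
    and g: "bij_betw g P P'" and Q: "card Q = card Q'"
    and common: "\<And>L L'. L \<in> P \<Longrightarrow> L' \<in> P \<Longrightarrow>
      card {V \<in> Q'. g L \<subseteq> V \<and> g L' \<subseteq> V} = card {V \<in> Q. L \<subseteq> V \<and> L' \<subseteq> V}"
  shows "isospectral (inclusion_graph P Q) (inclusion_graph P' Q')"
proof -
  obtain ps where ps: "set ps = P" "distinct ps" using finite_distinct_list[OF fin(1)] by blast
  obtain qs where qs: "set qs = Q" "distinct qs" using finite_distinct_list[OF fin(2)] by blast
  obtain qs' where qs': "set qs' = Q'" "distinct qs'" using finite_distinct_list[OF fin(3)] by blast
  define ps' where "ps' = map g ps"
  have ps': "set ps' = P'" "distinct ps'" "length ps' = length ps"
    using ps g by (auto simp: ps'_def bij_betw_def distinct_map)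
  have len: "length qs' = length qs" using qs qs' Q distinct_card by metis
  have "char_poly (adjacency_matrix (inclusion_graph P Q) (ps @ qs)) =
      char_poly (adjacency_matrix (inclusion_graph P' Q') (ps' @ qs'))"
    unfolding adjacency_inclusion_graph[OF ps(1) qs(1) disj(1)]
      adjacency_inclusion_graph[OF ps'(1) qs'(1) disj(2)] ps'(3) len
  proof (rule char_poly_bipartite_eq)
    show "inclusion_matrix ps qs \<in> carrier_mat (length ps) (length qs)"
      "inclusion_matrix ps' qs' \<in> carrier_mat (length ps) (length qs)"
      using ps'(3) len by (simp_all add: inclusion_matrix_def)
    fix i i' assume i: "i < length ps" "i' < length ps"
    have "ps ! i \<in> P" "ps ! i' \<in> P" using i ps(1) by auto
    from common[OF this]
    show "(\<Sum>j<length qs. inclusion_matrix ps qs $$ (i, j) * inclusion_matrix ps qs $$ (i', j)) =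
      (\<Sum>j<length qs. inclusion_matrix ps' qs' $$ (i, j) * inclusion_matrix ps' qs' $$ (i', j))"
      using gram_inclusion_matrix[OF qs(2) i] gram_inclusion_matrix[OF qs'(2), of i ps' i'] i ps'(3) len qs qs'
      by (simp add: ps'_def)
  qed
  then have "eigenvalue_mset (adjacency_matrix (inclusion_graph P Q) (ps @ qs)) =
      eigenvalue_mset (adjacency_matrix (inclusion_graph P' Q') (ps' @ qs'))"
    by (simp add: eigenvalue_mset_def)
  moreover have "distinct (ps @ qs)" "set (ps @ qs) = pverts (inclusion_graph P Q)"
    "distinct (ps' @ qs')" "set (ps' @ qs') = pverts (inclusion_graph P' Q')"
    using ps qs ps' qs' disj by (auto simp: inclusion_graph_def)
  ultimately show ?thesis unfolding isospectral_def by blast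
qed

section \<open>The two rings\<close>

text \<open>Base p digits: distinct ones differ by an integer prime to p, which is a unit modulo
  p^r. As r >= 2, p is itself a reduced residue.\<close>

lemma chain_ring_residue_ring:
  fixes p :: int
  assumes p: "Factorial_Ring.prime p" and r: "2 \<le> r"
  shows "chain_ring (residue_ring (p ^ r)) {0..<p} p r"
proof -
  have p1: "1 < p" using p by (rule prime_gt_1_int)
  define m where "m = p ^ r"
  have "p ^ 1 < p ^ r" using p1 r by (intro power_strict_increasing) auto
  then have pm: "p < m" by (simp add: m_def)
  have m1: "1 < m" using pm p1 by simp
  define R where "R = residue_ring m"
  interpret residues m R by unfold_locales (simp_all add: m1 R_def)
  have pmod: "p mod m = p" using pm p1 by simp
  have pow: "p [^]\<^bsub>R\<^esub> k = p ^ k mod m" for k :: nat using pow_cong[of p k] pmod by simp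
  have "chain_ring R {0..<p} p r"
  proof (unfold_locales)
    show "{0..<p} \<subseteq> carrier R" using pm by (auto simp: res_carrier_eq)
    show "\<zero>\<^bsub>R\<^esub> \<in> {0..<p}" "\<one>\<^bsub>R\<^esub> \<in> {0..<p}" using p1 by (simp_all add: res_zero_eq res_one_eq)
    show "p \<in> carrier R" using pm p1 by (simp add: res_carrier_eq)
    show "p [^]\<^bsub>R\<^esub> r = \<zero>\<^bsub>R\<^esub>" by (simp add: pow m_def res_zero_eq)
    have "p ^ (r - 1) < p ^ r" using p1 r by (intro power_strict_increasing) auto
    then show "p [^]\<^bsub>R\<^esub> (r - 1) \<noteq> \<zero>\<^bsub>R\<^esub>" using p1 by (simp add: pow res_zero_eq m_def)
    fix s t assume st: "s \<in> {0..<p}" "t \<in> {0..<p}" "s \<noteq> t"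
    have "\<not> p dvd s - t"
    proof
      assume "p dvd s - t"
      then have "s mod p = t mod p" by (simp add: mod_eq_dvd_iff)
      then show False using st by simp
    qed
    then have "coprime (s - t) m"
      using prime_imp_coprime[OF p] coprime_commute unfolding m_def by (metis coprime_power_right_iff)
    moreover have "s \<ominus>\<^bsub>R\<^esub> t = (s - t) mod m"
      by (simp add: a_minus_def res_neg_eq res_add_eq mod_add_right_eq)
    ultimately show "s \<ominus>\<^bsub>R\<^esub> t \<in> Units R" using m1 by simp
  next
    fix x assume "x \<in> carrier R"
    then have x: "0 \<le> x" "x < m" by (auto simp: res_carrier_eq)
    have "x div p \<in> carrier R"
      using x p1 pos_imp_zdiv_nonneg_iff[of p x] zdiv_mono2[of x 1 p] by (simp add: res_carrier_eq)
    moreover have "x = x mod p \<oplus>\<^bsub>R\<^esub> p \<otimes>\<^bsub>R\<^esub> (x div p)"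
      using x by (simp add: res_add_eq res_mult_eq mod_add_right_eq)
    ultimately show "\<exists>t\<in>{0..<p}. \<exists>y\<in>carrier R. x = t \<oplus>\<^bsub>R\<^esub> p \<otimes>\<^bsub>R\<^esub> y"
      using p1 by (intro bexI[of _ "x mod p"] bexI[of _ "x div p"]) auto
  qed simp
  then show ?thesis by (simp add: R_def m_def)
qed

text \<open>Evaluated twice: p times 1 vanishes modulo p but not modulo p^r.\<close>

lemma add_pow_one_residue_ring:
  assumes "1 < m" shows "add_pow (residue_ring m) k \<one>\<^bsub>residue_ring m\<^esub> = int k mod m"
proof -
  define R where "R = residue_ring m"
  interpret residues m R by unfold_locales (simp_all add: assms R_def)
  have "add_pow R k \<one>\<^bsub>R\<^esub> = int k mod m"
  proof (induction k)
    case 0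
    show ?case by (simp add: res_zero_eq)
  next
    case (Suc k)
    have "add_pow R (Suc k) \<one>\<^bsub>R\<^esub> = add_pow R k \<one>\<^bsub>R\<^esub> \<oplus>\<^bsub>R\<^esub> \<one>\<^bsub>R\<^esub>" by simp
    then show ?case using Suc by (simp add: res_add_eq res_one_eq mod_add_right_eq add.commute)
  qed
  then show ?thesis by (simp add: R_def)
qed

section \<open>Truncated polynomials over a finite field\<close>

context field
begin

context
  fixes r :: nat
  assumes r: "0 < r"
begin

private abbreviation "A \<equiv> (carrier R)[X]"
private abbreviation "J \<equiv> PIdl\<^bsub>A\<^esub> (X [^]\<^bsub>A\<^esub> r)"
private abbreviation "coset \<equiv> (+>\<^bsub>A\<^esub>) J"

private lemma A_domain: "domain A"
  by (rule univ_poly_is_domain[OF carrier_is_subring])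

private lemma X_closed: "X \<in> carrier A"
  by (rule var_closed(1)[OF carrier_is_subring])

private lemma ideal_J: "ideal J A"
proof -
  interpret A: domain A by (rule A_domain)
  show ?thesis by (rule A.cgenideal_ideal) (simp add: X_closed)
qed

private lemma coset_hom: "ring_hom_ring A (A Quot J) coset"
  by (rule ideal.rcos_ring_hom_ring[OF ideal_J])

private lemma coset_zero_iff: "f \<in> carrier A \<Longrightarrow> coset f = \<zero>\<^bsub>A Quot J\<^esub> \<longleftrightarrow> f \<in> J"
  using ideal.rcos_const_imp_mem[OF ideal_J, of f] ring.a_rcos_zero[OF _ ideal_J, of f] A_domain
  by (auto simp: FactRing_def domain_def cring_def)

text \<open>From X^(r-1) = g X^r, cancellation in the domain of polynomials leaves 1 = g X, although
  X is no unit.\<close>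

private lemma X_pow_not_mem: "X [^]\<^bsub>A\<^esub> (r - 1) \<notin> J"
proof
  interpret A: domain A by (rule A_domain)
  define Y where "Y = X [^]\<^bsub>A\<^esub> (r - 1)"
  have Y: "Y \<in> carrier A" unfolding Y_def using X_closed by simp
  assume "X [^]\<^bsub>A\<^esub> (r - 1) \<in> J"
  then obtain g where g: "g \<in> carrier A" "Y = g \<otimes>\<^bsub>A\<^esub> X [^]\<^bsub>A\<^esub> r"
    by (auto simp: cgenideal_def Y_def)
  have "X [^]\<^bsub>A\<^esub> r = Y \<otimes>\<^bsub>A\<^esub> X" using A.nat_pow_Suc[of X "r - 1"] r by (simp add: Y_def)
  then have "Y \<otimes>\<^bsub>A\<^esub> \<one>\<^bsub>A\<^esub> = Y \<otimes>\<^bsub>A\<^esub> (g \<otimes>\<^bsub>A\<^esub> X)"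
    using g Y X_closed by (simp add: A.m_lcomm)
  moreover have "Y = monom \<one> (r - 1)"
    unfolding Y_def by (rule unitary_monom_eq_var_pow[OF carrier_is_subring, symmetric])
  then have "Y \<noteq> \<zero>\<^bsub>A\<^esub>" by (simp add: monom_def univ_poly_zero)
  ultimately have "\<one>\<^bsub>A\<^esub> = g \<otimes>\<^bsub>A\<^esub> X" using A.m_lcancel[of Y "\<one>\<^bsub>A\<^esub>" "g \<otimes>\<^bsub>A\<^esub> X"] Y g X_closed by simp
  \<comment> \<open>Coefficient lists end with the constant term, so multiplication by X appends a
    zero, whereas \<open>[\<one>]\<close> ends in 1.\<close>
  then have "[\<one>] = (if g = [] then [] else g @ [\<zero>])"
    using poly_mult_var[OF carrier_is_subring g(1)] by (simp add: univ_poly_one)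
  then show False by (auto split: if_splits simp: Cons_eq_append_conv)
qed

private lemma const_hom: "ring_hom_ring R A poly_of_const"
  using canonical_embedding_ring_hom[OF carrier_is_subring] by simp

text \<open>Nonzero constants are units of the quotient, so their cosets serve as digits, and
  division by X splits off the first digit. The last claim passes the characteristic on from the
  field.\<close>

lemma chain_ring_truncated:
  assumes fin: "finite (carrier R)"
  shows "chain_ring (A Quot J) ((\<lambda>c. coset (poly_of_const c)) ` carrier R) (coset X) r"
    and "card ((\<lambda>c. coset (poly_of_const c)) ` carrier R) = card (carrier R)"
    and "add_pow R (k::nat) \<one> = \<zero> \<Longrightarrow> add_pow (A Quot J) k \<one>\<^bsub>A Quot J\<^esub> = \<zero>\<^bsub>A Quot J\<^esub>"
proof -
  interpret A: domain A by (rule A_domain)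
  interpret J: ideal J A by (rule ideal_J)
  interpret Q: cring "A Quot J" by (rule J.quotient_is_cring[OF A.is_cring])
  interpret h: ring_hom_ring A "A Quot J" coset by (rule coset_hom)
  interpret c: ring_hom_ring R A poly_of_const by (rule const_hom)
  define e where "e c = coset (poly_of_const c)" for c
  have e_closed: "e c \<in> carrier (A Quot J)" if "c \<in> carrier R" for c using that by (simp add: e_def)
  have e_diff: "e a \<ominus>\<^bsub>A Quot J\<^esub> e b = e (a \<ominus> b)" if "a \<in> carrier R" "b \<in> carrier R" for a b
    using that by (simp add: e_def a_minus_def)
  have e_unit: "e a \<in> Units (A Quot J)" if a: "a \<in> carrier R" "a \<noteq> \<zero>" for a
  proof -
    have u: "a \<in> Units R" using a by (simp add: field_Units)
    have "e a \<otimes>\<^bsub>A Quot J\<^esub> e (inv a) = \<one>\<^bsub>A Quot J\<^esub>"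
      using a u by (simp add: e_def h.hom_mult[symmetric] c.hom_mult[symmetric] del: h.hom_mult c.hom_mult)
    then show ?thesis
      using a u e_closed[OF a(1)] e_closed[of "inv a"] Q.m_comm[of "e a" "e (inv a)"] by (auto simp: Units_def)
  qed
  have pow: "coset X [^]\<^bsub>A Quot J\<^esub> k = coset (X [^]\<^bsub>A\<^esub> k)" for k :: nat
    by (rule h.hom_nat_pow[OF X_closed, symmetric])
  have one_ne: "\<one>\<^bsub>A Quot J\<^esub> \<noteq> \<zero>\<^bsub>A Quot J\<^esub>"
  proof
    assume "\<one>\<^bsub>A Quot J\<^esub> = \<zero>\<^bsub>A Quot J\<^esub>"
    then have "carrier (A Quot J) = {\<zero>\<^bsub>A Quot J\<^esub>}" by (rule Q.one_zeroD)
    moreover have "coset (X [^]\<^bsub>A\<^esub> (r - 1)) \<in> carrier (A Quot J)" using X_closed by simp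
    ultimately show False using X_pow_not_mem coset_zero_iff[of "X [^]\<^bsub>A\<^esub> (r - 1)"] X_closed by simp
  qed
  \<comment> \<open>A nonzero constant mapped to 0 would make 0 a unit in a nonzero ring.\<close>
  have inj: "inj_on e (carrier R)"
  proof (rule inj_onI)
    fix a b assume ab: "a \<in> carrier R" "b \<in> carrier R" "e a = e b"
    have z: "e (a \<ominus> b) = \<zero>\<^bsub>A Quot J\<^esub>"
      using e_diff[OF ab(1,2)] e_closed[OF ab(2)] by (simp add: ab(3) a_minus_def Q.r_neg)
    show "a = b"
    proof (rule ccontr)
      assume "a \<noteq> b"
      then have "a \<ominus> b \<noteq> \<zero>" using ab by simp
      then have "\<zero>\<^bsub>A Quot J\<^esub> \<in> Units (A Quot J)" using e_unit[of "a \<ominus> b"] z ab by simp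
      then have "\<one>\<^bsub>A Quot J\<^esub> = \<zero>\<^bsub>A Quot J\<^esub>" using Q.Units_r_inv Q.Units_inv_closed Q.l_null by metis
      then show False using one_ne by simp
    qed
  qed
  show "card ((\<lambda>c. coset (poly_of_const c)) ` carrier R) = card (carrier R)"
    using card_image[OF inj] by (simp add: e_def)
  have "chain_ring (A Quot J) (e ` carrier R) (coset X) r"
  proof (unfold_locales)
    show "finite (e ` carrier R)" using fin by simp
    show "e ` carrier R \<subseteq> carrier (A Quot J)" using e_closed by blast
    have "e \<zero> = \<zero>\<^bsub>A Quot J\<^esub>" "e \<one> = \<one>\<^bsub>A Quot J\<^esub>" by (simp_all add: e_def)
    then show "\<zero>\<^bsub>A Quot J\<^esub> \<in> e ` carrier R" "\<one>\<^bsub>A Quot J\<^esub> \<in> e ` carrier R"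
      by (metis zero_closed imageI, metis one_closed imageI)
    show "coset X \<in> carrier (A Quot J)" using X_closed by simp
    have "X [^]\<^bsub>A\<^esub> r \<in> J" using A.cgenideal_self[of "X [^]\<^bsub>A\<^esub> r"] X_closed by simp
    then show "coset X [^]\<^bsub>A Quot J\<^esub> r = \<zero>\<^bsub>A Quot J\<^esub>"
      unfolding pow using coset_zero_iff X_closed by simp
    show "coset X [^]\<^bsub>A Quot J\<^esub> (r - 1) \<noteq> \<zero>\<^bsub>A Quot J\<^esub>"
      unfolding pow using coset_zero_iff X_closed X_pow_not_mem by simp
    fix s t assume "s \<in> e ` carrier R" "t \<in> e ` carrier R" "s \<noteq> t"
    then obtain a b where ab: "a \<in> carrier R" "b \<in> carrier R" "s = e a" "t = e b" "a \<noteq> b" by blast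
    then have "a \<ominus> b \<noteq> \<zero>" by simp
    then show "s \<ominus>\<^bsub>A Quot J\<^esub> t \<in> Units (A Quot J)" using e_unit[of "a \<ominus> b"] e_diff ab by simp
  next
    fix x assume "x \<in> carrier (A Quot J)"
    then have "x \<in> a_rcosets\<^bsub>A\<^esub> J" unfolding FactRing_def partial_object.select_convs(1) .
    then obtain f where f: "f \<in> carrier A" "x = coset f"
      unfolding A_RCOSETS_def' by (elim UN_E) (rule that, assumption, erule singletonD)
    have "X \<noteq> \<zero>\<^bsub>A\<^esub>" by (simp add: var_def univ_poly_zero)
    then obtain q s where qs: "q \<in> carrier A" "s \<in> carrier A" "f = X \<otimes>\<^bsub>A\<^esub> q \<oplus>\<^bsub>A\<^esub> s"
      "s = \<zero>\<^bsub>A\<^esub> \<or> length s - 1 < length X - 1"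
      using field_long_division_theorem_shell[OF carrier_is_subfield f(1) X_closed] by blast
    \<comment> \<open>With truncated subtraction this covers the zero polynomial and the nonzero
      constants.\<close>
    have "length s - 1 = 0" using qs(4) by (auto simp: var_def univ_poly_zero)
    then have "s \<in> poly_of_const ` carrier R"
      unfolding poly_of_const_over_carrier using qs(2) by (intro CollectI conjI)
    then obtain a where a: "a \<in> carrier R" "s = poly_of_const a" by blast
    have "x = coset X \<otimes>\<^bsub>A Quot J\<^esub> coset q \<oplus>\<^bsub>A Quot J\<^esub> e a"
      using f qs a X_closed by (simp add: e_def)
    also have "\<dots> = e a \<oplus>\<^bsub>A Quot J\<^esub> coset X \<otimes>\<^bsub>A Quot J\<^esub> coset q"
      using e_closed[OF a(1)] X_closed qs(1) by (simp add: Q.a_comm)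
    finally show "\<exists>t\<in>e ` carrier R. \<exists>y\<in>carrier (A Quot J). x = t \<oplus>\<^bsub>A Quot J\<^esub> coset X \<otimes>\<^bsub>A Quot J\<^esub> y"
      by (intro bexI[of _ "e a"] bexI[of _ "coset q"] imageI a(1) h.hom_closed qs(1))
  qed
  then show "chain_ring (A Quot J) ((\<lambda>c. coset (poly_of_const c)) ` carrier R) (coset X) r"
    by (simp add: e_def)
  have e_pow: "add_pow (A Quot J) k \<one>\<^bsub>A Quot J\<^esub> = e (add_pow R k \<one>)" for k :: nat
    by (induction k) (simp_all add: e_def)
  show "add_pow R (k::nat) \<one> = \<zero> \<Longrightarrow> add_pow (A Quot J) k \<one>\<^bsub>A Quot J\<^esub> = \<zero>\<^bsub>A Quot J\<^esub>"
    unfolding e_pow by (simp add: e_def)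
qed

end

end

lemma truncated_poly_ring_chain_ring:
  fixes p :: int
  assumes p: "Factorial_Ring.prime p" and r: "0 < r"
  obtains T \<pi> where "chain_ring (truncated_poly_ring p r) T \<pi> r" "card T = nat p"
    "add_pow (truncated_poly_ring p r) (nat p) \<one>\<^bsub>truncated_poly_ring p r\<^esub> = \<zero>\<^bsub>truncated_poly_ring p r\<^esub>"
proof -
  have p1: "1 < p" using p by (rule prime_gt_1_int)
  define F where "F = residue_ring p"
  have np: "Factorial_Ring.prime (nat p)" using p prime_int_nat_transfer by blast
  have F_eq: "F \<equiv> residue_ring (int (nat p))" using p1 by (simp add: F_def)
  interpret F: residues_prime "nat p" F
    by unfold_locales (rule np, rule F_eq)
  have c: "finite (carrier F)" "card (carrier F) = nat p"
    using p1 by (simp_all add: F_def residue_ring_def)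
  have z: "add_pow F (nat p) \<one>\<^bsub>F\<^esub> = \<zero>\<^bsub>F\<^esub>"
    using add_pow_one_residue_ring[OF p1, of "nat p"] p1 by (simp add: F_def residue_ring_def)
  show thesis
    using that F.chain_ring_truncated[OF r c(1)] z c(2)
    unfolding truncated_poly_ring_def Let_def F_def[symmetric] by metis
qed

section \<open>Isomorphisms of incidence graphs\<close>

text \<open>Two maps are kept because an exchange of the classes is corrected by the inverse of the
  duality on one class and by the duality itself on the other.\<close>

definition incidence_iso ::
  "'v set set \<Rightarrow> 'v set set \<Rightarrow> 'w set set \<Rightarrow> 'w set set \<Rightarrow> ('v set \<Rightarrow> 'w set) \<Rightarrow> ('v set \<Rightarrow> 'w set) \<Rightarrow> bool" where
  "incidence_iso P Q P' Q' \<phi> \<psi> \<longleftrightarrow> bij_betw \<phi> P P' \<and> bij_betw \<psi> Q Q' \<and>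
    (\<forall>L\<in>P. \<forall>V\<in>Q. L \<subseteq> V \<longleftrightarrow> \<phi> L \<subseteq> \<psi> V)"

lemma coll_transport:
  assumes iso: "incidence_iso P Q P' Q' \<phi> \<psi>" and x: "x \<in> P" "y \<in> P" "z \<in> P"
  shows "coll Q' (\<phi> x) (\<phi> y) (\<phi> z) \<longleftrightarrow> coll Q x y z"
proof -
  have Q': "Q' = \<psi> ` Q" and inc: "\<And>L V. L \<in> P \<Longrightarrow> V \<in> Q \<Longrightarrow> L \<subseteq> V \<longleftrightarrow> \<phi> L \<subseteq> \<psi> V"
    using iso by (auto simp: incidence_iso_def bij_betw_def)
  show ?thesis unfolding coll_def Q' using inc x by simp
qed

lemma distant_transport:
  assumes iso: "incidence_iso P Q P' Q' \<phi> \<psi>" and x: "x \<in> P" "y \<in> P"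
  shows "distant P' Q' (\<phi> x) (\<phi> y) \<longleftrightarrow> distant P Q x y"
proof -
  have P': "P' = \<phi> ` P" using iso by (auto simp: incidence_iso_def bij_betw_def)
  show ?thesis unfolding distant_def P' using coll_transport[OF iso] x by simp
qed

text \<open>Every clause consists of inclusions between the two classes and quantifiers over them,
  or of equations of points, so it passes along the pair of bijections.\<close>

lemma translation_config_transport:
  assumes iso: "incidence_iso P Q P' Q' \<phi> \<psi>" and c: "translation_config P Q m E S U C C' f g"
  shows "translation_config P' Q' m (\<phi> E) (\<phi> S) (\<phi> U) (\<phi> C) (\<phi> C') (\<lambda>i. \<phi> (f i)) (\<lambda>i. \<phi> (g i))"
proof -
  have P': "P' = \<phi> ` P" using iso by (auto simp: incidence_iso_def bij_betw_def)
  note tr = coll_transport[OF iso] distant_transport[OF iso]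
  have mem: "E \<in> P" "S \<in> P" "U \<in> P" "C \<in> P" "C' \<in> P" "\<And>i. i \<le> m \<Longrightarrow> f i \<in> P" "\<And>i. i < m \<Longrightarrow> g i \<in> P"
    using c by (simp_all add: translation_config_def)
  have "\<forall>w\<in>P'. coll Q' (\<phi> S) (\<phi> U) w \<longrightarrow> distant P' Q' w (\<phi> E)"
    unfolding P' using c tr mem P' by (simp add: translation_config_def)
  moreover have "coll Q' (\<phi> E) (\<phi> S) (\<phi> (f i))" if "i \<le> m" for i
    using c tr mem that by (simp add: translation_config_def)
  moreover have "coll Q' (\<phi> E) (\<phi> U) (\<phi> (g i)) \<and> coll Q' (\<phi> C) (\<phi> (f i)) (\<phi> (g i)) \<and>
      coll Q' (\<phi> C') (\<phi> (g i)) (\<phi> (f (Suc i)))" if "i < m" for i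
    using c tr mem that by (simp add: translation_config_def)
  moreover have "{\<phi> E, \<phi> S, \<phi> U, \<phi> C, \<phi> C'} \<subseteq> P'" "\<And>i. i \<le> m \<Longrightarrow> \<phi> (f i) \<in> P'" "\<And>i. i < m \<Longrightarrow> \<phi> (g i) \<in> P'"
    unfolding P' using mem by simp_all
  moreover have "distant P' Q' (\<phi> S) (\<phi> U)" "coll Q' (\<phi> S) (\<phi> U) (\<phi> C)" "distant P' Q' (\<phi> C) (\<phi> S)"
    "distant P' Q' (\<phi> C) (\<phi> U)" "coll Q' (\<phi> E) (\<phi> C) (\<phi> C')" "distant P' Q' (\<phi> C') (\<phi> E)"
    "distant P' Q' (\<phi> C') (\<phi> C)" "\<phi> (f 0) = \<phi> S" "\<phi> (f m) = \<phi> S"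
    using c tr mem by (simp_all add: translation_config_def)
  ultimately show ?thesis unfolding translation_config_def by simp
qed

lemma inclusion_graph_arc_iff:
  "(x, y) \<in> parcs (inclusion_graph P Q) \<longleftrightarrow> x \<in> P \<and> y \<in> Q \<and> x \<subseteq> y \<or> y \<in> P \<and> x \<in> Q \<and> y \<subseteq> x"
  by (auto simp: inclusion_graph_def)

text \<open>The graphs are connected, so an isomorphism either preserves or exchanges the two classes.\<close>

lemma inclusion_graph_iso_cases:
  assumes disj: "P \<inter> Q = {}" "P' \<inter> Q' = {}" and F: "bij_betw F (P \<union> Q) (P' \<union> Q')"
    and arcs: "\<And>u v. u \<in> P \<union> Q \<Longrightarrow> v \<in> P \<union> Q \<Longrightarrow>
      (u, v) \<in> parcs (inclusion_graph P Q) \<longleftrightarrow> (F u, F v) \<in> parcs (inclusion_graph P' Q')"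
    and joined: "\<And>L L'. L \<in> P \<Longrightarrow> L' \<in> P \<Longrightarrow> \<exists>V\<in>Q. L \<subseteq> V \<and> L' \<subseteq> V"
    and contains: "\<And>V. V \<in> Q \<Longrightarrow> \<exists>L\<in>P. L \<subseteq> V"
  shows "incidence_iso P Q P' Q' F F \<or>
    (bij_betw F P Q' \<and> bij_betw F Q P' \<and> (\<forall>L\<in>P. \<forall>V\<in>Q. L \<subseteq> V \<longleftrightarrow> F V \<subseteq> F L))"
proof -
  have mem: "F L \<in> P' \<union> Q'" if "L \<in> P \<union> Q" for L using F that by (rule bij_betw_apply)
  have arc: "F L \<in> P' \<and> F V \<in> Q' \<and> F L \<subseteq> F V \<or> F V \<in> P' \<and> F L \<in> Q' \<and> F V \<subseteq> F L"
    if "L \<in> P" "V \<in> Q" "L \<subseteq> V" for L V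
    using arcs[of L V] that by (simp add: inclusion_graph_arc_iff)
  have arc2: "L \<subseteq> V" if "L \<in> P" "V \<in> Q"
    "F L \<in> P' \<and> F V \<in> Q' \<and> F L \<subseteq> F V \<or> F V \<in> P' \<and> F L \<in> Q' \<and> F V \<subseteq> F L" for L V
    using arcs[of L V] that disj by (auto simp: inclusion_graph_arc_iff)
  have split: "bij_betw F P A \<and> bij_betw F Q B"
    if "A \<union> B = P' \<union> Q'" "A \<inter> B = {}" "\<And>L. L \<in> P \<Longrightarrow> F L \<in> A" "\<And>V. V \<in> Q \<Longrightarrow> F V \<in> B" for A B
  proof -
    have im: "F ` P \<subseteq> A" "F ` Q \<subseteq> B" using that(3,4) by blast+
    have un: "F ` P \<union> F ` Q = A \<union> B" using bij_betw_imp_surj_on[OF F] that(1) by (simp add: image_Un)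
    have "A \<subseteq> F ` P"
    proof
      fix x assume x: "x \<in> A"
      then have "x \<in> F ` P \<union> F ` Q" unfolding un by simp
      moreover have "x \<notin> F ` Q" using im(2) that(2) x by (meson disjoint_iff subsetD)
      ultimately show "x \<in> F ` P" by simp
    qed
    moreover have "B \<subseteq> F ` Q"
    proof
      fix x assume x: "x \<in> B"
      then have "x \<in> F ` P \<union> F ` Q" unfolding un by simp
      moreover have "x \<notin> F ` P" using im(1) that(2) x by (meson disjoint_iff subsetD)
      ultimately show "x \<in> F ` Q" by simp
    qed
    ultimately have "F ` P = A" "F ` Q = B" using im by simp_all
    then show ?thesis
      using inj_on_subset[OF bij_betw_imp_inj_on[OF F] Un_upper1]
        inj_on_subset[OF bij_betw_imp_inj_on[OF F] Un_upper2] by (simp add: bij_betw_def)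
  qed
  show ?thesis
  \<comment> \<open>The image of a single point decides: any two points share a neighbour, and arcs
    only join opposite classes.\<close>
  proof (cases "\<exists>L0\<in>P. F L0 \<in> P'")
    case True
    then obtain L0 where L0: "L0 \<in> P" "F L0 \<in> P'" by blast
    have P: "F L \<in> P'" if L: "L \<in> P" for L
    proof -
      obtain V where V: "V \<in> Q" "L0 \<subseteq> V" "L \<subseteq> V" using joined[OF L0(1) L] by blast
      show ?thesis using arc[OF L0(1) V(1,2)] arc[OF L V(1,3)] L0(2) disj(2) by blast
    qed
    have Q: "F V \<in> Q'" if V: "V \<in> Q" for V
    proof -
      obtain L where L: "L \<in> P" "L \<subseteq> V" using contains[OF V] by blast
      show ?thesis using arc[OF L(1) V L(2)] P[OF L(1)] disj(2) by blast
    qed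
    have "L \<subseteq> V \<longleftrightarrow> F L \<subseteq> F V" if "L \<in> P" "V \<in> Q" for L V
      using arc[OF that] arc2[OF that] P[OF that(1)] Q[OF that(2)] disj(2) by blast
    then show ?thesis using split[of P' Q'] P Q disj(2) by (simp add: incidence_iso_def)
  next
    case False
    then have P: "F L \<in> Q'" if L: "L \<in> P" for L using mem[of L] L by blast
    have Q: "F V \<in> P'" if V: "V \<in> Q" for V
    proof -
      obtain L where L: "L \<in> P" "L \<subseteq> V" using contains[OF V] by blast
      show ?thesis using arc[OF L(1) V L(2)] P[OF L(1)] disj(2) by blast
    qed
    have "L \<subseteq> V \<longleftrightarrow> F V \<subseteq> F L" if "L \<in> P" "V \<in> Q" for L V
      using arc[OF that] arc2[OF that] P[OF that(1)] Q[OF that(2)] disj(2) by blast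
    moreover have "Q' \<union> P' = P' \<union> Q'" "Q' \<inter> P' = {}" using disj(2) by auto
    ultimately show ?thesis using split[of Q' P'] P Q by simp
  qed
qed

lemma (in chain_module) free_subs_disjoint: "m \<noteq> n \<Longrightarrow> free_subs m \<inter> free_subs n = {}"
  using free_subs_rank_unique by blast

context coord_chain_module
begin

lemma incidence_graph_eq: "incidence_graph R d n = inclusion_graph (free_subs 1) (free_subs n)"
  by (simp add: incidence_graph_def inclusion_graph_def Let_def free_submodules_eq)

text \<open>The vectors x and w of a level decomposition span both points, and n >= 2 leaves room
  for them in a basis of rank n.\<close>

lemma points_joined:
  assumes n: "2 \<le> n" "n \<le> d" and L: "L \<in> free_subs 1" "L' \<in> free_subs 1"
  shows "\<exists>V\<in>free_subs n. L \<subseteq> V \<and> L' \<subseteq> V"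
proof -
  obtain x where x: "unimod x" "L = line x" using L(1) by (elim pointE)
  obtain y where y: "unimod y" "L' = line y" using L(2) by (elim pointE)
  have d: "2 \<le> d" using n by simp
  obtain k \<alpha> w where k: "k \<le> r" "\<alpha> \<in> carrier R" "indep2 x w" "y = \<alpha> \<odot>\<^bsub>M\<^esub> x \<oplus>\<^bsub>M\<^esub> \<pi> [^] k \<odot>\<^bsub>M\<^esub> w"
    by (rule level_decomposition[OF x(1) unimodD(1)[OF y(1)] d])
  define b0 where "b0 i = (if i = (0::nat) then x else w)" for i
  have i0: "indep {0, 1} b0" using indep2_iff_indep[of b0 0 x 1 w] k(3) by (simp add: b0_def)
  have sub: "{0, 1} \<subseteq> {..<d}" using d by auto
  obtain b where b: "\<forall>i\<in>{0, 1}. b i = b0 i" "indep {..<d} b" using extend_to_full_basis[OF i0 sub] by blast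
  have bn: "indep {..<n} b" by (rule indep_subset[OF b(2)]) (use n in auto)
  note bD = indepD[OF bn]
  have V: "spn {..<n} b \<in> free_subs n" by (rule free_subsI[OF bn]) simp
  note Vs = free_subs_submodule[OF V]
  have "x = b 0" "w = b 1" using b(1) by (simp_all add: b0_def)
  then have xw: "x \<in> spn {..<n} b" "w \<in> spn {..<n} b"
    using basis_mem_spn[OF bD(1,2), of 0] basis_mem_spn[OF bD(1,2), of 1] n by simp_all
  then have "y \<in> spn {..<n} b" unfolding k(4) using submoduleE(4,5)[OF Vs] k(2) by simp
  then have "L \<subseteq> spn {..<n} b" "L' \<subseteq> spn {..<n} b"
    using xw x(2) y(2) line_subset_iff[OF Vs] unimodD(1)[OF x(1)] unimodD(1)[OF y(1)] by simp_all
  then show ?thesis using V by blast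
qed

lemma contains_point:
  assumes V: "V \<in> free_subs n" and n: "1 \<le> n" shows "\<exists>L\<in>free_subs 1. L \<subseteq> V"
proof -
  obtain b where b: "indep {..<n} b" "b \<in> {..<n} \<rightarrow> V" "spn {..<n} b = V"
    by (rule free_subs_basis[OF V finite_lessThan card_lessThan])
  have i: "indep {0} b" by (rule indep_subset[OF b(1)]) (use n in auto)
  have "spn {0} b \<in> free_subs 1" by (rule free_subsI[OF i]) simp
  moreover have "spn {0} b \<subseteq> V"
    by (rule spn_subset[OF free_subs_submodule[OF V]]) (use b(2) n in auto)
  ultimately show ?thesis by blast
qed

end

text \<open>For n <= d - 2 both rings have more submodules of rank n than points, so an exchange
  would make each number of points smaller than the other. Thus n = d - 1, and composition with the
  annihilator over S restores the inclusions.\<close>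

lemma swap_to_incidence_iso:
  fixes R (structure) and S (structure)
  assumes R: "chain_ring R T \<pi> r" and S: "chain_ring S T' \<pi>' r"
    and n: "2 \<le> n" "n < d"
    and P: "bij_betw F (free_submodules R (coord_module R d) 1) (free_submodules S (coord_module S d) n)"
    and Q: "bij_betw F (free_submodules R (coord_module R d) n) (free_submodules S (coord_module S d) 1)"
    and inc: "\<And>L V. L \<in> free_submodules R (coord_module R d) 1 \<Longrightarrow>
      V \<in> free_submodules R (coord_module R d) n \<Longrightarrow> L \<subseteq> V \<longleftrightarrow> F V \<subseteq> F L"
  shows "\<exists>\<phi> \<psi>. incidence_iso (free_submodules R (coord_module R d) 1) (free_submodules R (coord_module R d) n)
    (free_submodules S (coord_module S d) 1) (free_submodules S (coord_module S d) n) \<phi> \<psi>"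
proof -
  interpret R: coord_chain_module R T \<pi> r d by (rule coord_chain_module.intro[OF R])
  interpret S: coord_chain_module S T' \<pi>' r d by (rule coord_chain_module.intro[OF S])
  note P = P[unfolded R.free_submodules_eq S.free_submodules_eq]
    and Q = Q[unfolded R.free_submodules_eq S.free_submodules_eq]
    and inc = inc[unfolded R.free_submodules_eq S.free_submodules_eq]
  have "\<not> n + 2 \<le> d"
  proof
    assume nd: "n + 2 \<le> d"
    have "card (R.free_subs 1) < card (R.free_subs n)" by (rule R.points_less[OF n(1) nd])
    also have "\<dots> = card (S.free_subs 1)" by (rule bij_betw_same_card[OF Q])
    also have "\<dots> < card (S.free_subs n)" by (rule S.points_less[OF n(1) nd])
    also have "\<dots> = card (R.free_subs 1)" by (rule bij_betw_same_card[OF P, symmetric])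
    finally show False by simp
  qed
  then have nd: "n = d - 1" and d: "1 \<le> d" using n by auto
  have ann: "bij_betw S.ann (S.free_subs 1) (S.free_subs n)" unfolding nd by (rule S.bij_ann[OF d])
  \<comment> \<open>The hyperplane F L is replaced by the point whose annihilator it is, the point F
    V by its annihilator.\<close>
  define \<phi> where "\<phi> = inv_into (S.free_subs 1) S.ann \<circ> F"
  define \<psi> where "\<psi> = S.ann \<circ> F"
  have \<phi>: "bij_betw \<phi> (R.free_subs 1) (S.free_subs 1)"
    unfolding \<phi>_def by (rule bij_betw_trans[OF P bij_betw_inv_into[OF ann]])
  have \<psi>: "bij_betw \<psi> (R.free_subs n) (S.free_subs n)"
    unfolding \<psi>_def by (rule bij_betw_trans[OF Q ann])
  have "L \<subseteq> V \<longleftrightarrow> \<phi> L \<subseteq> \<psi> V" if LV: "L \<in> R.free_subs 1" "V \<in> R.free_subs n" for L V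
  proof -
    have eq: "F L = S.ann (\<phi> L)"
      unfolding \<phi>_def using bij_betw_inv_into_right[OF ann bij_betw_apply[OF P LV(1)]] by simp
    have c: "F V \<subseteq> carrier S.M" "\<phi> L \<subseteq> carrier S.M"
      using S.free_subs_carrier bij_betw_apply[OF Q LV(2)] bij_betw_apply[OF \<phi> LV(1)] by blast+
    have "L \<subseteq> V \<longleftrightarrow> F V \<subseteq> S.ann (\<phi> L)" using inc[OF LV] eq by simp
    also have "\<dots> \<longleftrightarrow> \<phi> L \<subseteq> S.ann (F V)"
      using S.subset_ann_swap[OF c] S.subset_ann_swap[OF c(2,1)] by blast
    finally show ?thesis by (simp add: \<psi>_def)
  qed
  then have "incidence_iso (R.free_subs 1) (R.free_subs n) (S.free_subs 1) (S.free_subs n) \<phi> \<psi>"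
    using \<phi> \<psi> by (simp add: incidence_iso_def)
  then show ?thesis unfolding R.free_submodules_eq S.free_submodules_eq by blast
qed

text \<open>A configuration closing after m steps exists over R because m times 1 vanishes there;
  its image over S, after correction by duality if the classes are exchanged, yields the same
  relation.\<close>

lemma incidence_graph_iso_add_pow_eq_zero:
  fixes R (structure) and S (structure)
  assumes R: "chain_ring R T \<pi> r" and S: "chain_ring S T' \<pi>' r"
    and n: "2 \<le> n" "n < d" and z: "add_pow R (m::nat) \<one>\<^bsub>R\<^esub> = \<zero>\<^bsub>R\<^esub>"
    and F: "bij_betw F (pverts (incidence_graph R d n)) (pverts (incidence_graph S d n))"
    and arcs: "\<And>u v. u \<in> pverts (incidence_graph R d n) \<Longrightarrow> v \<in> pverts (incidence_graph R d n) \<Longrightarrow>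
      (u, v) \<in> parcs (incidence_graph R d n) \<longleftrightarrow> (F u, F v) \<in> parcs (incidence_graph S d n)"
  shows "add_pow S m \<one>\<^bsub>S\<^esub> = \<zero>\<^bsub>S\<^esub>"
proof -
  interpret R: coord_chain_module R T \<pi> r d by (rule coord_chain_module.intro[OF R])
  interpret S: coord_chain_module S T' \<pi>' r d by (rule coord_chain_module.intro[OF S])
  note F = F[unfolded R.incidence_graph_eq S.incidence_graph_eq]
    and arcs = arcs[unfolded R.incidence_graph_eq S.incidence_graph_eq]
  have verts: "pverts (inclusion_graph P Q) = P \<union> Q" for P Q :: "'z set set"
    by (simp add: inclusion_graph_def)
  have disj: "R.free_subs 1 \<inter> R.free_subs n = {}" "S.free_subs 1 \<inter> S.free_subs n = {}"
    using R.free_subs_disjoint S.free_subs_disjoint n by simp_all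
  have "\<exists>\<phi> \<psi>. incidence_iso (R.free_subs 1) (R.free_subs n) (S.free_subs 1) (S.free_subs n) \<phi> \<psi>"
  proof -
    have "incidence_iso (R.free_subs 1) (R.free_subs n) (S.free_subs 1) (S.free_subs n) F F \<or>
      (bij_betw F (R.free_subs 1) (S.free_subs n) \<and> bij_betw F (R.free_subs n) (S.free_subs 1) \<and>
        (\<forall>L\<in>R.free_subs 1. \<forall>V\<in>R.free_subs n. L \<subseteq> V \<longleftrightarrow> F V \<subseteq> F L))"
    proof (rule inclusion_graph_iso_cases[OF disj])
      show "bij_betw F (R.free_subs 1 \<union> R.free_subs n) (S.free_subs 1 \<union> S.free_subs n)"
        using F by (simp add: inclusion_graph_def)
      show "(u, v) \<in> parcs (inclusion_graph (R.free_subs 1) (R.free_subs n)) \<longleftrightarrow>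
          (F u, F v) \<in> parcs (inclusion_graph (S.free_subs 1) (S.free_subs n))"
        if "u \<in> R.free_subs 1 \<union> R.free_subs n" "v \<in> R.free_subs 1 \<union> R.free_subs n" for u v
        by (rule arcs) (use that in \<open>simp_all add: inclusion_graph_def\<close>)
      show "\<exists>V\<in>R.free_subs n. L \<subseteq> V \<and> L' \<subseteq> V"
        if "L \<in> R.free_subs 1" "L' \<in> R.free_subs 1" for L L'
        using R.points_joined[OF n(1) _ that] n by simp
      show "\<exists>L\<in>R.free_subs 1. L \<subseteq> V" if "V \<in> R.free_subs n" for V
        using R.contains_point[OF that] n by simp
    qed
    then show ?thesis
    proof
      assume "bij_betw F (R.free_subs 1) (S.free_subs n) \<and> bij_betw F (R.free_subs n) (S.free_subs 1) \<and>
        (\<forall>L\<in>R.free_subs 1. \<forall>V\<in>R.free_subs n. L \<subseteq> V \<longleftrightarrow> F V \<subseteq> F L)"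
      then show ?thesis
        using swap_to_incidence_iso[OF R S n, of F] unfolding R.free_submodules_eq S.free_submodules_eq by blast
    qed blast
  qed
  then obtain \<phi> \<psi> where iso: "incidence_iso (R.free_subs 1) (R.free_subs n) (S.free_subs 1) (S.free_subs n) \<phi> \<psi>"
    by blast
  obtain E S' U C C' f g where "translation_config (R.free_subs 1) (R.free_subs n) m E S' U C C' f g"
    by (rule R.translation_config_exists[OF n z])
  from S.translation_config_imp[OF n translation_config_transport[OF iso this]] show ?thesis .
qed

theorem theorem6p1:
  fixes p :: int and r d n :: nat
  assumes "Factorial_Ring.prime p" and "r \<ge> 2" and "d \<ge> 3" and "1 < n" and "n < d"
  shows "isospectral (incidence_graph (residue_ring (p ^ r)) d n)
                     (incidence_graph (truncated_poly_ring p r) d n) \<and>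
         \<not> digraph_iso (with_proj (incidence_graph (residue_ring (p ^ r)) d n))
                       (with_proj (incidence_graph (truncated_poly_ring p r) d n))"
proof
  define Z where "Z = residue_ring (p ^ r)"
  define S where "S = truncated_poly_ring p r"
  have p1: "1 < p" using assms(1) by (rule prime_gt_1_int)
  have Zc: "chain_ring Z {0..<p} p r"
    unfolding Z_def by (rule chain_ring_residue_ring[OF assms(1,2)])
  have r: "0 < r" using assms(2) by simp
  obtain T \<pi> where Sc: "chain_ring S T \<pi> r" and cT: "card T = nat p"
    and char: "add_pow S (nat p) \<one>\<^bsub>S\<^esub> = \<zero>\<^bsub>S\<^esub>"
    unfolding S_def by (rule truncated_poly_ring_chain_ring[OF assms(1) r])
  have cards: "card {0..<p} = card T" using cT by simp
  interpret Z: coord_chain_module Z "{0..<p}" p r d by (rule coord_chain_module.intro[OF Zc])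
  interpret S: coord_chain_module S T \<pi> r d by (rule coord_chain_module.intro[OF Sc])
  show "isospectral (incidence_graph (residue_ring (p ^ r)) d n) (incidence_graph (truncated_poly_ring p r) d n)"
  proof -
    have n: "1 \<le> n" "n \<le> d" "2 \<le> d" using assms by auto
    obtain g where g: "bij_betw g (Z.free_subs 1) (S.free_subs 1)"
      and common: "\<forall>L\<in>Z.free_subs 1. \<forall>L'\<in>Z.free_subs 1.
        card {V \<in> S.free_subs n. g L \<subseteq> V \<and> g L' \<subseteq> V} = card {V \<in> Z.free_subs n. L \<subseteq> V \<and> L' \<subseteq> V}"
      using level_preserving_bijection[OF Zc Sc cards n]
      unfolding Z.free_submodules_eq S.free_submodules_eq by blast
    show ?thesis
      unfolding Z_def[symmetric] S_def[symmetric] Z.incidence_graph_eq S.incidence_graph_eq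
    proof (rule isospectral_inclusion_graphs[OF Z.finite_free_subs_set Z.finite_free_subs_set
          S.finite_free_subs_set _ _ g])
      show "Z.free_subs 1 \<inter> Z.free_subs n = {}" "S.free_subs 1 \<inter> S.free_subs n = {}"
        using Z.free_subs_disjoint S.free_subs_disjoint assms(4) by simp_all
      show "card (Z.free_subs n) = card (S.free_subs n)"
        using Z.card_free_subs_set[OF n(2)] S.card_free_subs_set[OF n(2)] cards by simp
      show "card {V \<in> S.free_subs n. g L \<subseteq> V \<and> g L' \<subseteq> V} = card {V \<in> Z.free_subs n. L \<subseteq> V \<and> L' \<subseteq> V}"
        if "L \<in> Z.free_subs 1" "L' \<in> Z.free_subs 1" for L L'
        by (rule common[rule_format, OF that])
    qed
  qed
  show "\<not> digraph_iso (with_proj (incidence_graph (residue_ring (p ^ r)) d n))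
                       (with_proj (incidence_graph (truncated_poly_ring p r) d n))"
    unfolding Z_def[symmetric] S_def[symmetric]
  proof
    let ?G = "incidence_graph Z d n" and ?H = "incidence_graph S d n"
    have wf: "pair_wf_digraph (incidence_graph R d n)" for R :: "('x, 'y) ring_scheme"
      by (rule pair_sym_digraph.axioms(1)[OF pair_sym_digraph_incidence_graph])
    assume "digraph_iso (with_proj ?G) (with_proj ?H)"
    then obtain f where f: "bij_betw f (pverts ?G) (pverts ?H)"
      "\<forall>u\<in>pverts ?G. \<forall>v\<in>pverts ?G. (u, v) \<in> parcs ?G \<longleftrightarrow> (f u, f v) \<in> parcs ?H"
      unfolding digraph_iso_with_proj_iff[OF wf wf] by blast
    \<comment> \<open>The isomorphism is inverted, as the configuration of length p exists over the
      truncated polynomials and has to be carried to the residue ring.\<close>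
    define F where "F = inv_into (pverts ?G) f"
    have F: "bij_betw F (pverts ?H) (pverts ?G)" unfolding F_def by (rule bij_betw_inv_into[OF f(1)])
    have arcs: "(u, v) \<in> parcs ?H \<longleftrightarrow> (F u, F v) \<in> parcs ?G" if "u \<in> pverts ?H" "v \<in> pverts ?H" for u v
      using f(2) bij_betw_apply[OF F that(1)] bij_betw_apply[OF F that(2)]
        bij_betw_inv_into_right[OF f(1) that(1)] bij_betw_inv_into_right[OF f(1) that(2)]
      by (simp add: F_def)
    have n: "2 \<le> n" "n < d" using assms by auto
    have "add_pow Z (nat p) \<one>\<^bsub>Z\<^esub> = \<zero>\<^bsub>Z\<^esub>"
      by (rule incidence_graph_iso_add_pow_eq_zero[OF Sc Zc n char F arcs])
    \<comment> \<open>As r >= 2, p is a nonzero residue modulo p^r, and this separates the two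
      rings.\<close>
    moreover have "p ^ 1 < p ^ r" using p1 assms(2) by (intro power_strict_increasing) auto
    ultimately have "p mod p ^ r = 0"
      using add_pow_one_residue_ring[of "p ^ r" "nat p"] p1 by (simp add: Z_def residue_ring_def)
    then show False using \<open>p ^ 1 < p ^ r\<close> p1 by simp
  qed
qed

end
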